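(* Let $G$ be a finite multigraph with $m$ edges, and let $$\gamma_l'(G) := \max_{uv\in E(G)} \left\lceil \max \left\{ d(u)+\tfrac 12(d(v)-\mu(uv)),\ d(v)+\tfrac 12(d(u)-\mu(uv)),\ \tfrac 12\bigl( d(u)+d(v)-\mu(uv)+t(uv)\bigr) \right\}\right\rceil,$$ where the outer maximum is over all edges of $G$ with (distinct) endpoints $u$ and $v$. Then the chromatic index satisfies $\chi'(G)\leq \gamma_l'(G)$, and there is an algorithm that finds a proper edge-colouring of $G$ with $\gamma_l'(G)$ colours in $O(m^2)$ time.
   Context: Multigraphs are finite and may have parallel edges (and loops). $d(w)$ denotes the degree of vertex $w$. For distinct vertices $u,v$, $\mu(uv)$ is the number of edges between $u$ and $v$, and $t(uv)$ is the maximum, over all vertices $w\notin\{u,v\}$, of the number of edges with both endpoints in $\{u,v,w\}$, i.e. $t(uv)=\max_{w}(\mu(uv)+\mu(uw)+\mu(vw))$ (taken to be $\mu(uv)$ if there is no vertex outside $\{u,v\}$). A proper edge-colouring assigns colours to edges so that edges sharing an endpoint get different colours; $\chi'(G)$ is the minimum number of colours in such a colouring.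
   Formalization: Assumes every vertex carrying a loop also has an edge to another vertex; otherwise the claim is false: an edge plus a separate vertex with two loops needs 2 colours, but γ_l' = 1. Loops count twice in degrees and are not counted in t(uv). *)

theory Defs
  imports Complex_Main "HOL-Library.Landau_Symbols"
begin

section \<open>Multigraphs\<close>

text \<open>An edge \<open>e\<close> has the set \<open>ends G e\<close> of endpoints: two vertices, or one if \<open>e\<close> is a loop.\<close>

record ('v, 'e) multigraph =
  verts :: "'v set"
  edges :: "'e set"
  ends :: "'e \<Rightarrow> 'v set"

definition fin_multigraph :: "('v, 'e) multigraph \<Rightarrow> bool" where
  "fin_multigraph G \<longleftrightarrow> finite (verts G) \<and> finite (edges G) \<and>
     (\<forall>e\<in>edges G. \<exists>u\<in>verts G. \<exists>v\<in>verts G. ends G e = {u, v})"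

text \<open>A loop contributes 2 to the degree of its endpoint.\<close>

definition vertex_degree :: "('v, 'e) multigraph \<Rightarrow> 'v \<Rightarrow> nat" where
  "vertex_degree G v = card {e \<in> edges G. v \<in> ends G e} + card {e \<in> edges G. ends G e = {v}}"

definition edge_mult :: "('v, 'e) multigraph \<Rightarrow> 'v \<Rightarrow> 'v \<Rightarrow> nat" where
  "edge_mult G u v = card {e \<in> edges G. ends G e = {u, v}}"

definition triple :: "('v, 'e) multigraph \<Rightarrow> 'v \<Rightarrow> 'v \<Rightarrow> nat" where
  "triple G u v =
     (if verts G - {u, v} = {} then edge_mult G u v
      else Max ((\<lambda>w. edge_mult G u v + edge_mult G u w + edge_mult G v w) ` (verts G - {u, v})))"

text \<open>The empty maximum is taken to be 0; inserting 0 has no effect on a nonempty one.\<close>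

definition gamma_l' :: "('v, 'e) multigraph \<Rightarrow> nat" where
  "gamma_l' G = Max (insert 0
     {nat \<lceil>Max {real (vertex_degree G u) + 1/2 * (real (vertex_degree G v) - real (edge_mult G u v)),
               real (vertex_degree G v) + 1/2 * (real (vertex_degree G u) - real (edge_mult G u v)),
               1/2 * (real (vertex_degree G u) + real (vertex_degree G v) - real (edge_mult G u v)
                       + real (triple G u v))}\<rceil>
      | u v. u \<noteq> v \<and> (\<exists>e\<in>edges G. ends G e = {u, v})})"

text \<open>
  A connected component consisting of one vertex and \<open>k\<close> loops needs \<open>k\<close> colours but contributes
  nothing to \<open>gamma_l'\<close>, which only looks at edges with two distinct endpoints. The bound
  therefore requires that no such component exists; loopless multigraphs satisfy this trivially.
\<close>

definition loops_attached :: "('v, 'e) multigraph \<Rightarrow> bool" where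
  "loops_attached G \<longleftrightarrow>
     (\<forall>e\<in>edges G. \<forall>v. ends G e = {v} \<longrightarrow> (\<exists>f\<in>edges G. \<exists>w. w \<noteq> v \<and> ends G f = {v, w}))"

definition proper_edge_colouring :: "('v, 'e) multigraph \<Rightarrow> ('e \<Rightarrow> nat) \<Rightarrow> bool" where
  "proper_edge_colouring G c \<longleftrightarrow>
     (\<forall>e\<in>edges G. \<forall>f\<in>edges G. e \<noteq> f \<and> ends G e \<inter> ends G f \<noteq> {} \<longrightarrow> c e \<noteq> c f)"

definition edge_colouring_with :: "('v, 'e) multigraph \<Rightarrow> nat \<Rightarrow> ('e \<Rightarrow> nat) \<Rightarrow> bool" where
  "edge_colouring_with G k c \<longleftrightarrow> proper_edge_colouring G c \<and> c ` edges G \<subseteq> {..<k}"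

definition chromatic_index :: "('v, 'e) multigraph \<Rightarrow> nat" where
  "chromatic_index G = (LEAST k. \<exists>c. edge_colouring_with G k c)"

lemma chromatic_index_attained:
  assumes "fin_multigraph G"
  shows "\<exists>c. edge_colouring_with G (chromatic_index G) c"
proof -
  from assms have "finite (edges G)" by (simp add: fin_multigraph_def)
  then obtain c :: "_ \<Rightarrow> nat" and k where "c ` edges G = {i. i < k}" "inj_on c (edges G)"
    using finite_imp_inj_to_nat_seg by blast
  then have "edge_colouring_with G k c"
    by (auto simp: edge_colouring_with_def proper_edge_colouring_def inj_on_def)
  then show ?thesis
    unfolding chromatic_index_def by (intro LeastI[where P = "\<lambda>k. \<exists>c. edge_colouring_with G k c"]) blast
qed


section \<open>Random access programs with uniform cost\<close>

text \<open>
  The memory consists of zero-initialised arrays of natural numbers, one for each name, with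
  constant-time access to every cell; the cell with index 0 serves as a scalar variable. A program
  mentions only finitely many arrays. Every memory access, addition, truncated subtraction,
  comparison and control step costs one time unit; multiplication and bit operations are not
  primitive. This is the random access machine with uniform cost, with structured control flow.
\<close>

type_synonym memory = "string \<Rightarrow> nat \<Rightarrow> nat"

datatype exp =
    Const nat
  | Cell string exp
  | Plus exp exp
  | Minus exp exp

datatype test =
    Less exp exp
  | Equal exp exp
  | Neg test
  | Conj test test

datatype program =
    Skip
  | Store string exp exp
  | Seq program program
  | Cond test program program
  | While test program

fun exp_val :: "exp \<Rightarrow> memory \<Rightarrow> nat" where
  "exp_val (Const k) s = k"
| "exp_val (Cell x a) s = s x (exp_val a s)"
| "exp_val (Plus a b) s = exp_val a s + exp_val b s"
| "exp_val (Minus a b) s = exp_val a s - exp_val b s"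

fun exp_cost :: "exp \<Rightarrow> nat" where
  "exp_cost (Const k) = 1"
| "exp_cost (Cell x a) = exp_cost a + 1"
| "exp_cost (Plus a b) = exp_cost a + exp_cost b + 1"
| "exp_cost (Minus a b) = exp_cost a + exp_cost b + 1"

fun test_val :: "test \<Rightarrow> memory \<Rightarrow> bool" where
  "test_val (Less a b) s = (exp_val a s < exp_val b s)"
| "test_val (Equal a b) s = (exp_val a s = exp_val b s)"
| "test_val (Neg t) s = (\<not> test_val t s)"
| "test_val (Conj t u) s = (test_val t s \<and> test_val u s)"

fun test_cost :: "test \<Rightarrow> nat" where
  "test_cost (Less a b) = exp_cost a + exp_cost b + 1"
| "test_cost (Equal a b) = exp_cost a + exp_cost b + 1"
| "test_cost (Neg t) = test_cost t + 1"
| "test_cost (Conj t u) = test_cost t + test_cost u + 1"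

text \<open>\<open>runs P s t s'\<close>: started in memory \<open>s\<close>, program \<open>P\<close> halts after \<open>t\<close> time units in \<open>s'\<close>.\<close>

inductive runs :: "program \<Rightarrow> memory \<Rightarrow> nat \<Rightarrow> memory \<Rightarrow> bool" where
  Skip: "runs Skip s 1 s"
| Store: "runs (Store x a b) s (exp_cost a + exp_cost b + 1)
            (s(x := (s x)(exp_val a s := exp_val b s)))"
| Seq: "runs P s t s' \<Longrightarrow> runs Q s' t' s'' \<Longrightarrow> runs (Seq P Q) s (t + t' + 1) s''"
| CondTrue: "test_val b s \<Longrightarrow> runs P s t s' \<Longrightarrow> runs (Cond b P Q) s (test_cost b + t + 1) s'"
| CondFalse: "\<not> test_val b s \<Longrightarrow> runs Q s t s' \<Longrightarrow> runs (Cond b P Q) s (test_cost b + t + 1) s'"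
| WhileFalse: "\<not> test_val b s \<Longrightarrow> runs (While b P) s (test_cost b + 1) s"
| WhileTrue: "test_val b s \<Longrightarrow> runs P s t s' \<Longrightarrow> runs (While b P) s' t' s'' \<Longrightarrow>
    runs (While b P) s (test_cost b + t + t' + 1) s''"

inductive_cases Skip_runsE: "runs Skip s t s'"
inductive_cases Store_runsE: "runs (Store x a b) s t s'"
inductive_cases Seq_runsE: "runs (Seq P Q) s t s'"
inductive_cases Cond_runsE: "runs (Cond b P Q) s t s'"
inductive_cases While_runsE: "runs (While b P) s t s'"

lemma runs_deterministic:
  "runs P s t s' \<Longrightarrow> runs P s u s'' \<Longrightarrow> t = u \<and> s' = s''"
proof (induction arbitrary: u s'' rule: runs.induct)
  case (Skip s) then show ?case by (auto elim: Skip_runsE)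
next
  case (Store x a b s) then show ?case by (auto elim: Store_runsE)
next
  case (Seq P s t s1 Q t1 s2)
  from Seq.prems show ?case by (rule Seq_runsE) (auto dest!: Seq.IH)
next
  case (CondTrue b s P t s1 Q)
  from CondTrue.prems show ?case by (rule Cond_runsE) (use CondTrue.hyps(1) in \<open>auto dest!: CondTrue.IH\<close>)+
next
  case (CondFalse b s Q t s1 P)
  from CondFalse.prems show ?case by (rule Cond_runsE) (use CondFalse.hyps(1) in \<open>auto dest!: CondFalse.IH\<close>)+
next
  case (WhileFalse b s P)
  from WhileFalse.prems show ?case by (rule While_runsE) (use WhileFalse.hyps in auto)+
next
  case (WhileTrue b s P t s1 t1 s2)
  from WhileTrue.prems show ?case by (rule While_runsE) (use WhileTrue.hyps(1) in \<open>auto dest!: WhileTrue.IH\<close>)+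
qed


section \<open>Multigraphs as input\<close>

text \<open>
  The list \<open>es\<close> describes the multigraph with vertices \<open>0, \<dots>, n - 1\<close> whose edge \<open>i\<close> joins the two
  vertices of the pair \<open>es ! i\<close>. Every finite multigraph is isomorphic to one of this form.
\<close>

definition edge_list :: "nat \<Rightarrow> (nat \<times> nat) list \<Rightarrow> bool" where
  "edge_list n es \<longleftrightarrow> (\<forall>(u, v)\<in>set es. u < n \<and> v < n)"

definition multigraph_of :: "nat \<Rightarrow> (nat \<times> nat) list \<Rightarrow> (nat, nat) multigraph" where
  "multigraph_of n es =
     \<lparr>verts = {..<n}, edges = {..<length es}, ends = (\<lambda>i. {fst (es ! i), snd (es ! i)})\<rparr>"

definition input :: "nat \<Rightarrow> (nat \<times> nat) list \<Rightarrow> memory" where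
  "input n es = (\<lambda>x i.
     if x = ''n'' \<and> i = 0 then n
     else if x = ''m'' \<and> i = 0 then length es
     else if x = ''fst'' \<and> i < length es then fst (es ! i)
     else if x = ''snd'' \<and> i < length es then snd (es ! i)
     else 0)"

lemma fin_multigraph_multigraph_of: "edge_list n es \<Longrightarrow> fin_multigraph (multigraph_of n es)"
  by (fastforce simp: edge_list_def multigraph_of_def fin_multigraph_def dest: nth_mem)

end

theory Submission
  imports Defs
begin

text \<open>
  The edges with two ends are coloured one after another with \<open>k\<close> colours, where \<open>k\<close> grows by one
  whenever an edge cannot be accommodated; what has to be shown is that this only happens while
  \<open>k < gamma_l' G\<close>, so \<open>gamma_l'\<close> itself is never computed. Loops are coloured greedily at the end.

  Let \<open>vr\<close> be the uncoloured edge (the hole). A fan at \<open>v\<close> consists of \<open>r\<close> and of neighbours joined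
  to \<open>v\<close> by edges whose colour is missing at \<open>r\<close>. If a colour is missing at \<open>v\<close> and at a fan vertex,
  or (after swapping a Kempe chain that starts at \<open>v\<close>) at two fan vertices, the hole can be closed.
  By the first two terms of \<open>gamma_l'\<close> the missing sets of three fan vertices are too large to be
  disjoint from each other and from that of \<open>v\<close>, so fans of size three suffice, which keeps the
  work per edge linear in the number of edges. If only a fan \<open>{r, x}\<close> exists at \<open>v\<close>, and only a fan
  \<open>{v, y}\<close> at \<open>r\<close>, then either \<open>x = y\<close>, and all missing colours live inside the triangle \<open>v\<close>, \<open>r\<close>, \<open>x\<close>,
  contradicting the third term of \<open>gamma_l'\<close>; or \<open>x\<close> and \<open>y\<close> miss a common colour, and the Kempe
  chain from \<open>v\<close> ends at \<open>y\<close>, which frees that colour at both \<open>v\<close> and \<open>x\<close>.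
\<close>

text \<open>Why fans of size three: once k has reached the bound, a neighbour w of v misses at least
  (d(v) - mu(vw))/2 colours. The multiplicities at v sum to at most d(v), so t disjoint missing sets
  at distinct neighbours contain at least (t - 1)d(v)/2 colours. For t = 3 this is d(v), yet all
  these colours occur at v, where the hole leaves at most d(v) - 1 coloured edges. The running time
  may depend only on the number of edges. The invariant that k is at most the number of coloured
  edges keeps every colour-indexed table within length m, and vertex-indexed tables are cleared only
  at ends of edges, so isolated vertices cost nothing. Each fresh colour for an edge with two ends
  is justified by a violation of the inequalities \<open>good k\<close>; as these hold for every k
  from the bound upwards, a violation proves that k is still below it.\<close>

section \<open>Programs with bounded loops\<close>

text \<open>
  All loops of the algorithm run over \<open>0, \<dots>, m - 1\<close>. For such programs the effect is a total function
  of the memory, and the running time is bounded by the nesting depth of the loops. The memory is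
  wrapped in a datatype because states of function type get eta-expanded by unification, which
  spoils rewriting.
\<close>

datatype store = Store_of (get: memory)

definition put :: "string \<Rightarrow> nat \<Rightarrow> nat \<Rightarrow> store \<Rightarrow> store" where
  "put x i v s = Store_of ((get s)(x := (get s x)(i := v)))"

lemma get_put [simp]:
  "get (put x i v s) x i = v"
  "j \<noteq> i \<Longrightarrow> get (put x i v s) x j = get s x j"
  "y \<noteq> x \<Longrightarrow> get (put x i v s) y = get s y"
  by (simp_all add: put_def)

lemma get_put_if: "get (put x i v s) y j = (if y = x \<and> j = i then v else get s y j)"
  by (simp add: put_def)

section \<open>Structured commands and their measures\<close>

datatype cmd =
    Pass
  | Put string exp exp
  | Then cmd cmd (infixr ";;" 60)
  | IfElse test cmd cmd
  | Repeat string cmd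

abbreviation var :: "string \<Rightarrow> exp" where
  "var x \<equiv> Cell x (Const 0)"

primrec prog :: "cmd \<Rightarrow> program" where
  "prog Pass = Skip"
| "prog (Put x a b) = Store x a b"
| "prog (c ;; d) = Seq (prog c) (prog d)"
| "prog (IfElse b c d) = Cond b (prog c) (prog d)"
| "prog (Repeat x c) = Seq (Store x (Const 0) (Const 0))
     (While (Less (var x) (var ''m''))
       (Seq (prog c) (Store x (Const 0) (Plus (var x) (Const 1)))))"

text \<open>\<open>Repeat\<close> reads its number of rounds once on entry, whereas its translation
  tests \<open>''m''\<close> in every round. The two agree under \<open>wf_cmd\<close>, where the
  body writes neither \<open>''m''\<close> nor the counter.\<close>

primrec sem :: "cmd \<Rightarrow> store \<Rightarrow> store" where
  "sem Pass s = s"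
| "sem (Put x a b) s = put x (exp_val a (get s)) (exp_val b (get s)) s"
| "sem (c ;; d) s = sem d (sem c s)"
| "sem (IfElse b c d) s = (if test_val b (get s) then sem c s else sem d s)"
| "sem (Repeat x c) s =
     ((\<lambda>s. put x 0 (Suc (get (sem c s) x 0)) (sem c s)) ^^ get s ''m'' 0) (put x 0 0 s)"

primrec writes :: "cmd \<Rightarrow> string set" where
  "writes Pass = {}"
| "writes (Put x a b) = {x}"
| "writes (c ;; d) = writes c \<union> writes d"
| "writes (IfElse b c d) = writes c \<union> writes d"
| "writes (Repeat x c) = insert x (writes c)"

primrec wf_cmd :: "cmd \<Rightarrow> bool" where
  "wf_cmd Pass = True"
| "wf_cmd (Put x a b) = (x \<noteq> ''m'')"
| "wf_cmd (c ;; d) = (wf_cmd c \<and> wf_cmd d)"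
| "wf_cmd (IfElse b c d) = (wf_cmd c \<and> wf_cmd d)"
| "wf_cmd (Repeat x c) = (wf_cmd c \<and> x \<noteq> ''m'' \<and> x \<notin> writes c)"

primrec nesting :: "cmd \<Rightarrow> nat" where
  "nesting Pass = 0"
| "nesting (Put x a b) = 0"
| "nesting (c ;; d) = max (nesting c) (nesting d)"
| "nesting (IfElse b c d) = max (nesting c) (nesting d)"
| "nesting (Repeat x c) = Suc (nesting c)"

text \<open>Coefficient of \<open>(m + 1) ^ nesting c\<close> in the running time. The 13 of a loop
  are its overhead per round: 5 for the guard, 6 for the increment, 1 each for \<open>Seq\<close>
  and \<open>While\<close>. The branches of a conditional are added, which bounds their
  maximum.\<close>

primrec cost :: "cmd \<Rightarrow> nat" where
  "cost Pass = 1"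
| "cost (Put x a b) = exp_cost a + exp_cost b + 1"
| "cost (c ;; d) = cost c + cost d + 1"
| "cost (IfElse b c d) = test_cost b + cost c + cost d + 1"
| "cost (Repeat x c) = cost c + 13"

section \<open>Agreement with the machine, and the loop rule\<close>

lemma sem_frame: "x \<notin> writes c \<Longrightarrow> get (sem c s) x = get s x"
proof (induction c arbitrary: s)
  case (Repeat y c)
  have "get (((\<lambda>s. put y 0 (Suc (get (sem c s) y 0)) (sem c s)) ^^ n) t) x = get t x" for n t
    using Repeat by (induction n) auto
  then show ?case using Repeat.prems by auto
qed auto

lemma wf_cmd_writes: "wf_cmd c \<Longrightarrow> ''m'' \<notin> writes c"
  by (induction c) auto

lemma runs_put:
  "runs (Store x a b) (get s) (exp_cost a + exp_cost b + 1)
     (get (put x (exp_val a (get s)) (exp_val b (get s)) s))"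
  using runs.Store[of x a b "get s"] by (simp add: put_def)

text \<open>Induction on the number \<open>n\<close> of rounds left, for arbitrary starting states.
  The 6 is the cost of the last guard, which fails.\<close>

lemma While_runs:
  fixes c :: cmd and x :: string
  defines "body \<equiv> Seq (prog c) (Store x (Const 0) (Plus (var x) (Const 1)))"
  defines "F \<equiv> \<lambda>s. put x 0 (Suc (get (sem c s) x 0)) (sem c s)"
  assumes wf: "wf_cmd (Repeat x c)"
    and body: "\<And>s. get s ''m'' 0 = M \<Longrightarrow> \<exists>t. runs (prog c) (get s) t (get (sem c s)) \<and> t \<le> B"
    and s: "get s ''m'' 0 = M" "get s x 0 + n = M"
  shows "\<exists>t. runs (While (Less (var x) (var ''m'')) body) (get s) t (get ((F ^^ n) s)) \<and>
    t \<le> 6 + n * (B + 13)"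
  using s
proof (induction n arbitrary: s)
  case 0
  have "runs (While (Less (var x) (var ''m'')) body) (get s)
      (test_cost (Less (var x) (var ''m'')) + 1) (get s)"
    by (rule WhileFalse) (use 0 in auto)
  then show ?case by (intro exI[where x = 6]) (simp add: eval_nat_numeral)
next
  case (Suc n)
  have fr: "get (sem c s) ''m'' = get s ''m''" "get (sem c s) x = get s x"
    using wf wf_cmd_writes[of c] by (auto intro: sem_frame)
  obtain t1 where t1: "runs (prog c) (get s) t1 (get (sem c s))" "t1 \<le> B"
    using body Suc.prems by blast
  have Fs: "get (F s) ''m'' 0 = M" "get (F s) x 0 + n = M" using Suc.prems fr wf by (auto simp: F_def)
  obtain t2 where t2: "runs (While (Less (var x) (var ''m'')) body) (get (F s)) t2 (get ((F ^^ n) (F s)))"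
    "t2 \<le> 6 + n * (B + 13)" using Suc.IH[of "F s"] Fs by blast
  have "runs (Store x (Const 0) (Plus (var x) (Const 1))) (get (sem c s)) 6 (get (F s))"
    using runs_put[of x "Const 0" "Plus (var x) (Const 1)" "sem c s"]
    by (simp add: F_def eval_nat_numeral)
  then have b: "runs body (get s) (t1 + 6 + 1) (get (F s))"
    unfolding body_def by (rule runs.Seq[OF t1(1)])
  have "runs (While (Less (var x) (var ''m'')) body) (get s)
     (test_cost (Less (var x) (var ''m'')) + (t1 + 6 + 1) + t2 + 1) (get ((F ^^ n) (F s)))"
    by (rule WhileTrue[OF _ b t2(1)]) (use Suc.prems in auto)
  then show ?case using t1(2) t2(2)
    by (intro exI[where x = "5 + (t1 + 6 + 1) + t2 + 1"]) (simp add: funpow_swap1)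
qed

lemma runs_prog:
  "wf_cmd c \<Longrightarrow> \<exists>t. runs (prog c) (get s) t (get (sem c s)) \<and>
     t \<le> cost c * (get s ''m'' 0 + 1) ^ nesting c"
proof (induction c arbitrary: s)
  case Pass
  show ?case using runs.Skip[of "get s"] by (intro exI[where x = 1]) simp
next
  case (Put x a b)
  show ?case using runs_put[of x a b s] by (intro exI[where x = "exp_cost a + exp_cost b + 1"]) simp
next
  case (Then c d)
  let ?m = "get s ''m'' 0 + 1"
  have m: "get (sem c s) ''m'' = get s ''m''" using Then.prems by (simp add: sem_frame wf_cmd_writes)
  obtain t1 where t1: "runs (prog c) (get s) t1 (get (sem c s))" "t1 \<le> cost c * ?m ^ nesting c"
    using Then by fastforce
  obtain t2 where t2: "runs (prog d) (get (sem c s)) t2 (get (sem d (sem c s)))"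
    "t2 \<le> cost d * ?m ^ nesting d"
    using Then m by (metis wf_cmd.simps(3))
  have "cost c * ?m ^ nesting c \<le> cost c * ?m ^ max (nesting c) (nesting d)"
    "cost d * ?m ^ nesting d \<le> cost d * ?m ^ max (nesting c) (nesting d)"
    by (auto intro!: mult_le_mono2 power_increasing)
  moreover have "1 \<le> ?m ^ max (nesting c) (nesting d)" by simp
  ultimately have "t1 + t2 + 1 \<le> (cost c + cost d + 1) * ?m ^ max (nesting c) (nesting d)"
    using t1(2) t2(2) unfolding distrib_right by linarith
  then show ?case using runs.Seq[OF t1(1) t2(1)] by auto
next
  case (IfElse b c d)
  let ?m = "get s ''m'' 0 + 1"
  let ?M = "?m ^ max (nesting c) (nesting d)"
  obtain t1 where t1: "runs (prog c) (get s) t1 (get (sem c s))" "t1 \<le> cost c * ?m ^ nesting c"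
    using IfElse by fastforce
  obtain t2 where t2: "runs (prog d) (get s) t2 (get (sem d s))" "t2 \<le> cost d * ?m ^ nesting d"
    using IfElse by fastforce
  have 1: "cost c * ?m ^ nesting c \<le> cost c * ?M" "cost d * ?m ^ nesting d \<le> cost d * ?M"
    by (auto intro!: mult_le_mono2 power_increasing)
  have "(test_cost b + 1) * 1 \<le> (test_cost b + 1) * ?M" by (intro mult_le_mono2) simp
  then have 2: "test_cost b + 1 \<le> (test_cost b + 1) * ?M" by simp
  show ?case
  proof (cases "test_val b (get s)")
    case True
    have "test_cost b + t1 + 1 \<le> (test_cost b + cost c + cost d + 1) * ?M"
      using t1(2) 1 2 unfolding distrib_right by linarith
    then show ?thesis using CondTrue[OF True t1(1), of "prog d"] True by auto
  next
    case False
    have "test_cost b + t2 + 1 \<le> (test_cost b + cost c + cost d + 1) * ?M"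
      using t2(2) 1 2 unfolding distrib_right by linarith
    then show ?thesis using CondFalse[OF False t2(1), of "prog c"] False by auto
  qed
next
  case (Repeat x c)
  define M where "M = get s ''m'' 0"
  define B where "B = cost c * (M + 1) ^ nesting c"
  have body: "\<exists>t. runs (prog c) (get s) t (get (sem c s)) \<and> t \<le> B" if "get s ''m'' 0 = M" for s
    using Repeat.IH[of s] Repeat.prems that by (auto simp: B_def)
  have s: "get (put x 0 0 s) ''m'' 0 = M" "get (put x 0 0 s) x 0 + M = M"
    using Repeat.prems by (auto simp: M_def)
  obtain t where t: "runs (While (Less (var x) (var ''m''))
       (Seq (prog c) (Store x (Const 0) (Plus (var x) (Const 1))))) (get (put x 0 0 s)) t
       (get (sem (Repeat x c) s))"
    "t \<le> 6 + M * (B + 13)"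
    using While_runs[OF Repeat.prems body s] unfolding sem.simps M_def by blast
  have "runs (Store x (Const 0) (Const 0)) (get s) 3 (get (put x 0 0 s))"
    using runs_put[of x "Const 0" "Const 0" s] by (simp add: eval_nat_numeral)
  then have r: "runs (prog (Repeat x c)) (get s) (3 + t + 1) (get (sem (Repeat x c) s))"
    unfolding prog.simps using t(1) by (rule runs.Seq)
  \<comment> \<open>The factor \<open>M + 1\<close> instead of \<open>M\<close> pays for the
    initialisation and the failing guard, 10 units in all.\<close>
  have "3 + t + 1 \<le> (M + 1) * (B + 13)" using t(2) by simp
  also have "\<dots> \<le> (M + 1) * ((cost c + 13) * (M + 1) ^ nesting c)"
    by (intro mult_le_mono2) (simp add: B_def distrib_right)
  also have "\<dots> = cost (Repeat x c) * (get s ''m'' 0 + 1) ^ nesting (Repeat x c)"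
    by (simp add: M_def algebra_simps)
  finally show ?case using r by blast
qed

text \<open>The step may assume that everything outside the write set still has its value from the
  loop entry, so an invariant \<open>I\<close> only has to speak of what the loop changes.\<close>

lemma Repeat_invariant:
  assumes "x \<notin> writes c" "''m'' \<notin> writes c" "x \<noteq> ''m''"
    and base: "I 0 (put x 0 0 s)"
    and step: "\<And>i t. \<lbrakk>i < get s ''m'' 0; get t x 0 = i;
      \<And>y. y \<notin> insert x (writes c) \<Longrightarrow> get t y = get s y; I i t\<rbrakk> \<Longrightarrow>
      I (Suc i) (put x 0 (Suc i) (sem c t))"
  shows "I (get s ''m'' 0) (sem (Repeat x c) s)"
proof -
  let ?F = "\<lambda>s. put x 0 (Suc (get (sem c s) x 0)) (sem c s)"
  have "n \<le> get s ''m'' 0 \<Longrightarrow> I n ((?F ^^ n) (put x 0 0 s)) \<and> get ((?F ^^ n) (put x 0 0 s)) x 0 = n \<and>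
     (\<forall>y. y \<notin> insert x (writes c) \<longrightarrow> get ((?F ^^ n) (put x 0 0 s)) y = get s y)" for n
  proof (induction n)
    case 0
    show ?case using base by simp
  next
    case (Suc n)
    let ?t = "(?F ^^ n) (put x 0 0 s)"
    have t: "I n ?t" "get ?t x 0 = n" "\<And>y. y \<notin> insert x (writes c) \<Longrightarrow> get ?t y = get s y"
      using Suc by auto
    have "get (sem c ?t) x = get ?t x" using assms(1) by (rule sem_frame)
    moreover have "I (Suc n) (put x 0 (Suc n) (sem c ?t))"
      using step[of n ?t] t Suc.prems by simp
    ultimately show ?case using t by (simp add: sem_frame)
  qed
  then show ?thesis by simp
qed

section \<open>Partial edge colourings, fans and Kempe chains\<close>

locale edge_set =
  fixes E :: "'e set" and p q :: "'e \<Rightarrow> 'v"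
  assumes finite_E: "finite E"
begin

definition inc :: "'e \<Rightarrow> 'v \<Rightarrow> bool" where
  "inc e w \<longleftrightarrow> p e = w \<or> q e = w"

definition joins :: "'e \<Rightarrow> 'v \<Rightarrow> 'v \<Rightarrow> bool" where
  "joins e u w \<longleftrightarrow> p e = u \<and> q e = w \<or> p e = w \<and> q e = u"

definition links :: "'e set" where
  "links = {e \<in> E. p e \<noteq> q e}"

definition deg :: "'v \<Rightarrow> nat" where
  "deg w = card {e \<in> links. inc e w}"

definition mu :: "'v \<Rightarrow> 'v \<Rightarrow> nat" where
  "mu u w = card {e \<in> E. joins e u w}"

text \<open>Colour 0 means uncoloured.\<close>

definition proper :: "('e \<Rightarrow> nat) \<Rightarrow> bool" where
  "proper c \<longleftrightarrow> (\<forall>e\<in>E. \<forall>f\<in>E. \<forall>w. e \<noteq> f \<and> inc e w \<and> inc f w \<and> c e \<noteq> 0 \<longrightarrow> c e \<noteq> c f)"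

definition miss :: "nat \<Rightarrow> ('e \<Rightarrow> nat) \<Rightarrow> 'v \<Rightarrow> nat set" where
  "miss k c w = {t \<in> {1..k}. \<forall>e\<in>E. inc e w \<longrightarrow> c e \<noteq> t}"

definition coloured :: "'e set \<Rightarrow> nat \<Rightarrow> ('e \<Rightarrow> nat) \<Rightarrow> bool" where
  "coloured S k c \<longleftrightarrow> proper c \<and> (\<forall>e\<in>E. c e \<le> k) \<and> {e \<in> E. c e \<noteq> 0} = S"

text \<open>\<open>S\<close> includes the hole: closing the hole gives \<open>coloured S\<close>,
  and moving it leaves \<open>S\<close> unchanged.\<close>

definition holed :: "'e set \<Rightarrow> nat \<Rightarrow> ('e \<Rightarrow> nat) \<Rightarrow> 'e \<Rightarrow> 'v \<Rightarrow> 'v \<Rightarrow> bool" where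
  "holed S k c h v r \<longleftrightarrow> coloured (S - {h}) k c \<and> h \<in> S \<and> S \<subseteq> links \<and> joins h v r"

text \<open>\<open>good k\<close> is the bound \<open>gamma_l' \<le> k\<close> for the multigraph without its loops, without fractions.\<close>

definition good :: "nat \<Rightarrow> bool" where
  "good k \<longleftrightarrow> (\<forall>u v. u \<noteq> v \<and> 0 < mu u v \<longrightarrow>
     2 * deg u + deg v \<le> 2 * k + mu u v \<and>
     (\<forall>w. w \<noteq> u \<and> w \<noteq> v \<and> 0 < mu u w \<longrightarrow> deg u + deg v + mu u w + mu v w \<le> 2 * k))"

lemma links_subset: "links \<subseteq> E" and finite_links: "finite links"
  using finite_E by (auto simp: links_def)

lemma joins_commute: "joins e u w \<longleftrightarrow> joins e w u"
  by (auto simp: joins_def)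

lemma mu_commute: "mu u w = mu w u"
  by (simp add: mu_def joins_commute)

lemma joins_inc: "joins e u w \<Longrightarrow> inc e u" "joins e u w \<Longrightarrow> inc e w"
  by (auto simp: joins_def inc_def)

lemma joins_inc_iff: "joins e u w \<Longrightarrow> inc e x \<longleftrightarrow> x = u \<or> x = w"
  by (auto simp: joins_def inc_def)

lemma joins_neq: "joins e u w \<Longrightarrow> e \<in> links \<Longrightarrow> u \<noteq> w"
  by (auto simp: joins_def links_def)

lemma joins_unique: "joins e u w \<Longrightarrow> joins e u x \<Longrightarrow> x = w"
  by (auto simp: joins_def)

lemma mu_pos: "e \<in> E \<Longrightarrow> joins e u w \<Longrightarrow> 0 < mu u w"
  using finite_E by (auto simp: mu_def card_gt_0_iff)

lemma miss_iff: "t \<in> miss k c w \<longleftrightarrow> 0 < t \<and> t \<le> k \<and> (\<forall>e\<in>E. inc e w \<longrightarrow> c e \<noteq> t)"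
  by (auto simp: miss_def)

lemma finite_miss: "finite (miss k c w)"
  by (simp add: miss_def)

lemma coloured_subset: "coloured S k c \<Longrightarrow> S \<subseteq> E"
  by (auto simp: coloured_def)

lemma holedD:
  assumes "holed S k c h v r"
  shows "proper c" "e \<in> E \<Longrightarrow> c e \<le> k" "e \<in> E \<Longrightarrow> c e \<noteq> 0 \<longleftrightarrow> e \<in> S \<and> e \<noteq> h" "h \<in> E" "h \<in> S"
    "S \<subseteq> links" "joins h v r" "c h = 0" "v \<noteq> r" "inc h v" "inc h r" "inc h x \<longleftrightarrow> x = v \<or> x = r"
proof -
  show [simp]: "joins h v r" and "proper c" and "h \<in> S" and "S \<subseteq> links" and "e \<in> E \<Longrightarrow> c e \<le> k"
    and "e \<in> E \<Longrightarrow> c e \<noteq> 0 \<longleftrightarrow> e \<in> S \<and> e \<noteq> h"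
    using assms by (auto simp: holed_def coloured_def)
  then have *: "h \<in> links" by blast
  then show "h \<in> E" using links_subset by blast
  then show "c h = 0" using assms by (auto simp: holed_def coloured_def)
  show "v \<noteq> r" using * by (rule joins_neq[rotated]) simp
  show "inc h v" "inc h r" "inc h x \<longleftrightarrow> x = v \<or> x = r"
    using joins_inc[of h v r] joins_inc_iff[of h v r x] by auto
qed

lemma proper_update:
  assumes "proper c" "\<And>f w. \<lbrakk>f \<in> E; f \<noteq> e; inc e w; inc f w\<rbrakk> \<Longrightarrow> c f \<noteq> t"
  shows "proper (c(e := t))"
  unfolding proper_def
proof (intro ballI allI impI)
  fix f g w assume "f \<in> E" "g \<in> E" "f \<noteq> g \<and> inc f w \<and> inc g w \<and> (c(e := t)) f \<noteq> 0"
  then show "(c(e := t)) f \<noteq> (c(e := t)) g"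
    using assms(1) assms(2)[of f w] assms(2)[of g w] unfolding proper_def
    by (cases "f = e"; cases "g = e") auto
qed

lemma coloured_update:
  assumes "coloured S k c" "e \<in> E" "0 < t" "t \<le> k"
    "\<And>f w. \<lbrakk>f \<in> E; f \<noteq> e; inc e w; inc f w\<rbrakk> \<Longrightarrow> c f \<noteq> t"
  shows "coloured (insert e S) k (c(e := t))"
  using assms proper_update[of c e t] unfolding coloured_def by auto

lemma colour_hole:
  assumes "holed S k c h v r" "t \<in> miss k c v" "t \<in> miss k c r"
  shows "coloured S k (c(h := t))"
proof -
  note H = holedD[OF assms(1)]
  have "coloured (insert h (S - {h})) k (c(h := t))"
    by (rule coloured_update) (use assms H in \<open>auto simp: holed_def miss_iff\<close>)
  then show ?thesis using H(5) by (simp add: insert_absorb)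
qed

lemma fresh_colour:
  assumes "coloured S k c" "h \<in> E"
  shows "coloured (insert h S) (Suc k) (c(h := Suc k))"
proof (rule coloured_update)
  show "coloured S (Suc k) c" using assms(1) by (auto simp: coloured_def le_Suc_eq)
  show "c f \<noteq> Suc k" if "f \<in> E" for f using assms(1) that by (fastforce simp: coloured_def)
qed (use assms in auto)

section \<open>Moving the hole along a fan edge\<close>

text \<open>The colour of \<open>f\<close> is missing at \<open>r\<close>, and at \<open>v\<close>
  it merely changes from \<open>f\<close> to \<open>h\<close>. So \<open>v\<close> sees the same
  colours as before, and only \<open>r\<close> and \<open>x\<close> are affected.\<close>

lemma move_hole:
  assumes H: "holed S k c h v r" and f: "f \<in> E" "joins f v x" "c f \<in> miss k c r"
  shows "holed S k (c(h := c f, f := 0)) f v x"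
    "c f \<in> miss k (c(h := c f, f := 0)) x"
    "miss k (c(h := c f, f := 0)) v = miss k c v"
    "x \<noteq> r" "x \<noteq> v" "f \<noteq> h"
proof -
  note h = holedD[OF H]
  have 0: "c f \<noteq> 0" using f(3) by (auto simp: miss_iff)
  show fh: "f \<noteq> h" using h(8) 0 by auto
  have fl: "f \<in> links" "f \<in> S" using h(3)[OF f(1)] h(6) 0 by auto
  show xr: "x \<noteq> r" using f joins_inc by (auto simp: miss_iff)
  show "x \<noteq> v" using joins_neq[OF f(2) fl(1)] by simp
  have fx: "inc f y \<longleftrightarrow> y = v \<or> y = x" for y using f(2) by (rule joins_inc_iff)
  \<comment> \<open>Uncolouring \<open>f\<close> comes first: with both \<open>h\<close> and
    \<open>f\<close> in colour \<open>c f\<close> the two would clash at \<open>v\<close>.\<close>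
  have pr: "proper (c(f := 0))" using h(1) by (auto simp: proper_def)
  have pr2: "proper (c(f := 0, h := c f))"
  proof (rule proper_update[OF pr])
    fix g w assume g: "g \<in> E" "g \<noteq> h" "inc h w" "inc g w"
    show "(c(f := 0)) g \<noteq> c f"
    proof (cases "g = f")
      case False
      have "w = v \<or> w = r" using g(3) h(12) by auto
      then show ?thesis
      proof
        assume "w = v"
        then show ?thesis using h(1) f(1) g False fx[of v] 0 unfolding proper_def by (metis fun_upd_other)
      next
        assume "w = r"
        then show ?thesis using f(3) g False by (auto simp: miss_iff)
      qed
    qed (use 0 in auto)
  qed
  let ?c = "c(h := c f, f := 0)"
  have c: "?c = c(f := 0, h := c f)" using fh by (simp add: fun_upd_twist)
  have "coloured (S - {f}) k ?c"
    unfolding coloured_def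
  proof (intro conjI)
    show "proper ?c" using pr2 c by simp
    show "\<forall>e\<in>E. ?c e \<le> k" using h(2) f(1) by auto
    show "{e \<in> E. ?c e \<noteq> 0} = S - {f}" using h(3,5,6) links_subset 0 fh by auto
  qed
  then show "holed S k ?c f v x" using fl h f(2) by (auto simp: holed_def)
  have "c g \<noteq> c f" if "g \<in> E" "inc g x" "g \<noteq> f" for g
    using h(1) f(1) that fx 0 unfolding proper_def by metis
  moreover have "\<not> inc h x" using h(12) xr \<open>x \<noteq> v\<close> by auto
  ultimately show "c f \<in> miss k ?c x" using 0 h(2)[OF f(1)] by (auto simp: miss_iff)
  have "inc f v" using fx by simp
  then have "(\<forall>e\<in>E. inc e v \<longrightarrow> ?c e \<noteq> t) \<longleftrightarrow> (\<forall>e\<in>E. inc e v \<longrightarrow> c e \<noteq> t)" if "0 < t" for t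
    using h(4,8,10) f(1) fh that by (metis fun_upd_apply less_irrefl)
  then show "miss k ?c v = miss k c v" unfolding miss_iff set_eq_iff by blast
qed

text \<open>The colour \<open>c f\<close> passes from the missing set of \<open>r\<close> to that of
  \<open>x\<close>. Rerooting a fan needs these sets exactly, in order to keep them
  disjoint.\<close>

lemma move_hole_miss:
  assumes H: "holed S k c h v r" and f: "f \<in> E" "joins f v x" "c f \<in> miss k c r"
  shows "miss k (c(h := c f, f := 0)) x = insert (c f) (miss k c x)"
    "miss k (c(h := c f, f := 0)) r = miss k c r - {c f}"
proof -
  note h = holedD[OF H] and m = move_hole[OF assms]
  have fx: "inc f y \<longleftrightarrow> y = v \<or> y = x" for y using f(2) by (rule joins_inc_iff)
  have nhx: "\<not> inc h x" using h(12)[of x] m(4,5) by auto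
  have nfr: "\<not> inc f r" using fx[of r] m(4) h(9) by auto
  have ihr: "inc h r" by (rule h)
  show "miss k (c(h := c f, f := 0)) x = insert (c f) (miss k c x)"
  proof (intro set_eqI iffI)
    fix t assume "t \<in> miss k (c(h := c f, f := 0)) x"
    then show "t \<in> insert (c f) (miss k c x)" using nhx by (auto simp: miss_iff split: if_splits)
  next
    fix t assume "t \<in> insert (c f) (miss k c x)"
    then show "t \<in> miss k (c(h := c f, f := 0)) x"
      using m(2) nhx by (auto simp: miss_iff split: if_splits)
  qed
  show "miss k (c(h := c f, f := 0)) r = miss k c r - {c f}"
  proof (intro set_eqI iffI)
    fix t assume t: "t \<in> miss k (c(h := c f, f := 0)) r"
    then have "t \<noteq> c f" using h(4) ihr m(6) by (force simp: miss_iff)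
    then show "t \<in> miss k c r - {c f}" using t h(8) nfr by (auto simp: miss_iff split: if_splits)
  next
    fix t assume "t \<in> miss k c r - {c f}"
    then show "t \<in> miss k (c(h := c f, f := 0)) r" using nfr by (auto simp: miss_iff split: if_splits)
  qed
qed

text \<open>Moving the hole to \<open>f\<close> preserves the missing set of \<open>v\<close> and
  enlarges that of \<open>x\<close>, so \<open>t\<close> is still available at both ends.\<close>

lemma shift_hole:
  assumes H: "holed S k c h v r" and f: "f \<in> E" "joins f v x" "c f \<in> miss k c r"
    and t: "t \<in> miss k c v" "t \<in> miss k c x"
  shows "coloured S k (c(h := c f, f := t))"
proof -
  have "coloured S k ((c(h := c f, f := 0))(f := t))"
    by (rule colour_hole[OF move_hole(1)[OF H f]])
      (use move_hole(3)[OF H f] move_hole_miss(1)[OF H f] t in auto)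
  then show ?thesis by simp
qed

section \<open>Kempe chains\<close>

text \<open>The chain from \<open>v\<close> to \<open>w\<close> is described by what a swap relies
  on instead of as a path: \<open>K\<close> is closed under meeting edges of the two colours, and
  all vertices it touches other than \<open>v\<close> and \<open>w\<close> are inner ones, where
  both colours occur.\<close>

definition kempe :: "('e \<Rightarrow> nat) \<Rightarrow> nat \<Rightarrow> nat \<Rightarrow> 'v \<Rightarrow> 'e set \<Rightarrow> 'v \<Rightarrow> bool" where
  "kempe c a b v K w \<longleftrightarrow> K \<subseteq> {e \<in> E. c e \<in> {a, b}} \<and>
     (\<forall>x. x = v \<or> (\<exists>e\<in>K. inc e x) \<longrightarrow> (\<forall>e\<in>E. inc e x \<and> c e \<in> {a, b} \<longrightarrow> e \<in> K)) \<and>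
     (\<forall>x. x \<noteq> v \<and> x \<noteq> w \<and> (\<exists>e\<in>K. inc e x) \<longrightarrow>
        (\<exists>e\<in>E. inc e x \<and> c e = a) \<and> (\<exists>e\<in>E. inc e x \<and> c e = b))"

definition swap :: "nat \<Rightarrow> nat \<Rightarrow> 'e set \<Rightarrow> ('e \<Rightarrow> nat) \<Rightarrow> 'e \<Rightarrow> nat" where
  "swap a b K c e = (if e \<in> K then if c e = b then a else b else c e)"

text \<open>Closedness prevents a clash between swapped and unswapped edges. As \<open>b\<close> is
  missing at \<open>v\<close>, the only chain colour at \<open>v\<close> is \<open>a\<close>, which
  the swap removes. A vertex that misses \<open>a\<close> and is no end of the chain is not touched
  by it, since inner vertices see both colours.\<close>

lemma kempe_swap:
  assumes H: "holed S k c h v r" and a: "0 < a" "a \<le> k" and ab: "a \<noteq> b" and b: "b \<in> miss k c v"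
    and K: "kempe c a b v K w"
  shows "holed S k (swap a b K c) h v r"
    "a \<in> miss k (swap a b K c) v"
    "x \<noteq> v \<Longrightarrow> x \<noteq> w \<Longrightarrow> a \<in> miss k c x \<Longrightarrow> a \<in> miss k (swap a b K c) x"
    "t \<noteq> a \<Longrightarrow> t \<noteq> b \<Longrightarrow> t \<in> miss k (swap a b K c) x \<longleftrightarrow> t \<in> miss k c x"
    "c e \<noteq> a \<Longrightarrow> c e \<noteq> b \<Longrightarrow> swap a b K c e = c e"
proof -
  note h = holedD[OF H]
  let ?c = "swap a b K c"
  have b': "0 < b" "b \<le> k" "\<And>e. e \<in> E \<Longrightarrow> inc e v \<Longrightarrow> c e \<noteq> b" using b by (auto simp: miss_iff)
  have Kc: "e \<in> K \<Longrightarrow> e \<in> E \<and> (c e = a \<or> c e = b)" for e using K by (auto simp: kempe_def)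
  have Kx: "e \<in> K" if "x = v \<or> (\<exists>e\<in>K. inc e x)" "e \<in> E" "inc e x" "c e = a \<or> c e = b" for x e
    using K that unfolding kempe_def by blast
  have Kends: "(\<exists>e\<in>E. inc e x \<and> c e = a)" if "x \<noteq> v" "x \<noteq> w" "e \<in> K" "inc e x" for x e
    using K that unfolding kempe_def by blast
  have nz: "?c e = 0 \<longleftrightarrow> c e = 0" for e using Kc[of e] a b' by (auto simp: swap_def)
  have "proper ?c"
    unfolding proper_def
  proof (intro ballI allI impI)
    fix e f w assume *: "e \<in> E" "f \<in> E" "e \<noteq> f \<and> inc e w \<and> inc f w \<and> ?c e \<noteq> 0"
    then have ne: "c e \<noteq> c f" "c e \<noteq> 0" using h(1) nz unfolding proper_def by auto
    have "e \<in> K \<Longrightarrow> c f = a \<or> c f = b \<Longrightarrow> f \<in> K" "f \<in> K \<Longrightarrow> c e = a \<or> c e = b \<Longrightarrow> e \<in> K"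
      using Kx[of w] * by blast+
    then show "?c e \<noteq> ?c f" using ne Kc[of e] Kc[of f] ab by (auto simp: swap_def)
  qed
  then have "coloured (S - {h}) k ?c"
    using H a b' nz by (auto simp: holed_def coloured_def swap_def)
  then show "holed S k ?c h v r" using H by (simp add: holed_def)
  have "?c e \<noteq> a" if "e \<in> E" "inc e v" for e
    using Kx[of v e] that b'(3)[OF that] ab by (auto simp: swap_def)
  then show "a \<in> miss k ?c v" using a by (auto simp: miss_iff)
  show "a \<in> miss k ?c x" if "x \<noteq> v" "x \<noteq> w" "a \<in> miss k c x"
    using Kends[of x] that by (auto simp: miss_iff swap_def)
  show "?c e = c e" if "c e \<noteq> a" "c e \<noteq> b" using Kc[of e] that by (auto simp: swap_def)
  show "t \<in> miss k ?c x \<longleftrightarrow> t \<in> miss k c x" if "t \<noteq> a" "t \<noteq> b"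
  proof -
    have "?c e = t \<longleftrightarrow> c e = t" for e using Kc[of e] that by (auto simp: swap_def)
    then show ?thesis by (simp add: miss_iff)
  qed
qed

text \<open>
  The \<open>a\<close>-\<open>b\<close> chain is explored edge by edge from its end \<open>v\<close>: \<open>K\<close> is the explored part,
  \<open>w\<close> its last vertex and \<open>n\<close> the colour of the edge sought there. That an edge cannot be met
  twice is not needed, since the exploration simply stops at an edge of \<open>K\<close>.
\<close>

definition explored :: "('e \<Rightarrow> nat) \<Rightarrow> nat \<Rightarrow> nat \<Rightarrow> 'v \<Rightarrow> 'e set \<Rightarrow> 'v \<Rightarrow> nat \<Rightarrow> bool" where
  "explored c a b v K w n \<longleftrightarrow> K \<subseteq> {e \<in> E. c e \<in> {a, b}} \<and> n \<in> {a, b} \<and>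
     (\<forall>x. x \<noteq> w \<and> (x = v \<or> (\<exists>e\<in>K. inc e x)) \<longrightarrow> (\<forall>e\<in>E. inc e x \<and> c e \<in> {a, b} \<longrightarrow> e \<in> K)) \<and>
     (\<forall>e\<in>E. inc e w \<and> c e \<in> {a, b} - {n} \<longrightarrow> e \<in> K) \<and>
     (w \<noteq> v \<longrightarrow> (\<exists>e\<in>E. inc e w \<and> c e \<in> {a, b} - {n})) \<and>
     (\<forall>x. x \<noteq> v \<and> x \<noteq> w \<and> (\<exists>e\<in>K. inc e x) \<longrightarrow>
        (\<exists>e\<in>E. inc e x \<and> c e = a) \<and> (\<exists>e\<in>E. inc e x \<and> c e = b))"

lemma explored_start: "b \<in> miss k c v \<Longrightarrow> explored c a b v {} v a"
  by (auto simp: explored_def miss_iff)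

text \<open>Closedness can fail only at \<open>w\<close> for the colour \<open>n\<close>. The
  condition covers both ways of getting stuck: no such edge exists, or it has already been
  explored.\<close>

lemma explored_stop:
  assumes "explored c a b v K w n" "\<And>e. e \<in> E \<Longrightarrow> inc e w \<Longrightarrow> c e = n \<Longrightarrow> e \<in> K"
  shows "kempe c a b v K w"
  unfolding kempe_def
proof (intro conjI allI impI ballI)
  show "K \<subseteq> {e \<in> E. c e \<in> {a, b}}" using assms(1) by (simp add: explored_def)
next
  fix x e assume "x = v \<or> (\<exists>e\<in>K. inc e x)" "e \<in> E" "inc e x \<and> c e \<in> {a, b}"
  then show "e \<in> K" using assms unfolding explored_def by (cases "x = w") auto
next
  fix x assume x: "x \<noteq> v \<and> x \<noteq> w \<and> (\<exists>e\<in>K. inc e x)"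
  have "\<forall>x. x \<noteq> v \<and> x \<noteq> w \<and> (\<exists>e\<in>K. inc e x) \<longrightarrow>
        (\<exists>e\<in>E. inc e x \<and> c e = a) \<and> (\<exists>e\<in>E. inc e x \<and> c e = b)"
    using assms(1) by (simp add: explored_def)
  then show "\<exists>e\<in>E. inc e x \<and> c e = a" "\<exists>e\<in>E. inc e x \<and> c e = b" using x by auto
qed

text \<open>By properness \<open>g\<close> is the only edge of colour \<open>n\<close> at either of
  its ends. The old end \<open>w\<close>, unless it is \<open>v\<close>, now has \<open>g\<close>
  and the edge of the other colour by which it was reached, hence becomes an inner vertex.\<close>

lemma explored_step:
  assumes X: "explored c a b v K w n" and c: "proper c" "0 < a" "0 < b" "a \<noteq> b"
    and g: "g \<in> E" "g \<notin> K" "c g = n" "joins g w w'" "w \<noteq> w'"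
  shows "explored c a b v (insert g K) w' (a + b - n)"
proof -
  \<comment> \<open>For \<open>n\<close> in \<open>{a, b}\<close> this is the other colour; the
    program computes it in the same way.\<close>
  define l where "l = a + b - n"
  have n: "n = a \<and> l = b \<or> n = b \<and> l = a" using X by (auto simp: explored_def l_def)
  have gx: "inc g x \<longleftrightarrow> x = w \<or> x = w'" for x using g(4) by (rule joins_inc_iff)
  have uniq: "e = g" if "e \<in> E" "inc e x" "inc g x" "c e = n" for e x
    using c that g n unfolding proper_def by (metis gr_implies_not0)
  have K: "K \<subseteq> {e \<in> E. c e \<in> {a, b}}" using X by (simp add: explored_def)
  have closed: "e \<in> K" if "x \<noteq> w" "x = v \<or> (\<exists>e\<in>K. inc e x)" "e \<in> E" "inc e x" "c e \<in> {a, b}" for x e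
    using X that unfolding explored_def by blast
  have atw: "e \<in> K" if "e \<in> E" "inc e w" "c e = l" for e
    using X that n c(4) unfolding explored_def by auto
  have w_end: "w \<noteq> v \<longrightarrow> (\<exists>e\<in>E. inc e w \<and> c e = l)"
    using X n c(4) unfolding explored_def by auto
  have ends: "(\<exists>e\<in>E. inc e x \<and> c e = a) \<and> (\<exists>e\<in>E. inc e x \<and> c e = b)"
    if "x \<noteq> v" "x \<noteq> w" "\<exists>e\<in>K. inc e x" for x
    using X that unfolding explored_def by blast
  have "explored c a b v (insert g K) w' l"
    unfolding explored_def
  proof (intro conjI allI impI ballI)
    show "insert g K \<subseteq> {e \<in> E. c e \<in> {a, b}}" using K g n by auto
    show "l \<in> {a, b}" using n by auto
  next
    fix x e assume x: "x \<noteq> w' \<and> (x = v \<or> (\<exists>e\<in>insert g K. inc e x))"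
      and e: "e \<in> E" "inc e x \<and> c e \<in> {a, b}"
    show "e \<in> insert g K"
    proof (cases "x = w")
      case True
      then show ?thesis using e n uniq[of e w] gx atw[of e] by auto
    next
      case False
      then have "x = v \<or> (\<exists>e\<in>K. inc e x)" using x gx by auto
      then show ?thesis using closed[OF False _ e(1)] e(2) by blast
    qed
  next
    fix e assume "e \<in> E" "inc e w' \<and> c e \<in> {a, b} - {l}"
    then show "e \<in> insert g K" using n uniq[of e w'] gx by auto
  next
    show "\<exists>e\<in>E. inc e w' \<and> c e \<in> {a, b} - {l}" using n g gx c(4) by (intro bexI[of _ g]) auto
  next
    fix x assume x: "x \<noteq> v \<and> x \<noteq> w' \<and> (\<exists>e\<in>insert g K. inc e x)"
    have "(\<exists>e\<in>E. inc e x \<and> c e = a) \<and> (\<exists>e\<in>E. inc e x \<and> c e = b)"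
    proof (cases "x = w")
      case True
      then obtain e where e: "e \<in> E" "inc e x" "c e = l" using w_end x by auto
      have g': "g \<in> E" "inc g x" "c g = n" using g gx True by auto
      show ?thesis using n e g' by blast
    next
      case False
      then show ?thesis using ends[of x] x gx by auto
    qed
    then show "\<exists>e\<in>E. inc e x \<and> c e = a" "\<exists>e\<in>E. inc e x \<and> c e = b" by auto
  qed
  then show ?thesis by (simp add: l_def)
qed

section \<open>Counting missing colours\<close>

lemma miss_card:
  assumes "coloured S k c"
  shows "k \<le> card (miss k c w) + card {e \<in> S. inc e w}"
proof -
  have S: "S = {e \<in> E. c e \<noteq> 0}" using assms by (auto simp: coloured_def)
  have "{1..k} \<subseteq> miss k c w \<union> c ` {e \<in> S. inc e w}"
    by (force simp: miss_iff S)
  moreover have fin: "finite {e \<in> S. inc e w}" using S finite_E by auto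
  ultimately have "card {1..k} \<le> card (miss k c w \<union> c ` {e \<in> S. inc e w})"
    by (intro card_mono) (auto simp: finite_miss)
  also have "\<dots> \<le> card (miss k c w) + card (c ` {e \<in> S. inc e w})" by (rule card_Un_le)
  also have "\<dots> \<le> card (miss k c w) + card {e \<in> S. inc e w}" using card_image_le[OF fin, of c] by simp
  finally show ?thesis by simp
qed

text \<open>At an end of the hole the bound improves by one, because \<open>h\<close> counts in
  \<open>deg\<close> but carries no colour. This excess makes the later counting arguments
  strict.\<close>

lemma holed_miss_card:
  assumes H: "holed S k c h v r"
  shows "k \<le> card (miss k c w) + deg w"
    and "inc h w \<Longrightarrow> k + 1 \<le> card (miss k c w) + deg w"
proof -
  note h = holedD[OF H]
  have "coloured (S - {h}) k c" using H by (simp add: holed_def)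
  from miss_card[OF this, of w]
  have k: "k \<le> card (miss k c w) + card {e \<in> S - {h}. inc e w}" .
  have f: "finite {e \<in> links. inc e w}" using finite_links by simp
  have "card {e \<in> S - {h}. inc e w} \<le> deg w"
    unfolding deg_def by (intro card_mono[OF f]) (use h(6) in auto)
  then show "k \<le> card (miss k c w) + deg w" using k by simp
  assume "inc h w"
  then have "card {e \<in> S - {h}. inc e w} < deg w"
    unfolding deg_def by (intro psubset_card_mono[OF f]) (use h(5,6) in auto)
  then show "k + 1 \<le> card (miss k c w) + deg w" using k by simp
qed

lemma mu_sum_le_deg:
  assumes "finite A" "v \<notin> A"
  shows "(\<Sum>x\<in>A. mu v x) \<le> deg v"
proof -
  have "(\<Sum>x\<in>A. mu v x) = card (\<Union>x\<in>A. {e \<in> E. joins e v x})"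
    unfolding mu_def using assms finite_E
    by (intro card_UN_disjoint[symmetric]) (auto simp: joins_def)
  also have "\<dots> \<le> deg v"
    unfolding deg_def
  proof (rule card_mono)
    show "finite {e \<in> links. inc e v}" using finite_links by simp
    show "(\<Union>x\<in>A. {e \<in> E. joins e v x}) \<subseteq> {e \<in> links. inc e v}"
      using assms by (auto simp: links_def joins_def inc_def)
  qed
  finally show ?thesis .
qed

lemma goodD:
  assumes "good k" "e \<in> E" "joins e u v" "u \<noteq> v"
  shows "2 * deg u + deg v \<le> 2 * k + mu u v" "deg u \<le> k"
    "w \<noteq> u \<Longrightarrow> w \<noteq> v \<Longrightarrow> 0 < mu u w \<Longrightarrow> deg u + deg v + mu u w + mu v w \<le> 2 * k"
proof -
  have m: "0 < mu u v" using assms by (auto intro: mu_pos)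
  show 1: "2 * deg u + deg v \<le> 2 * k + mu u v"
    and "w \<noteq> u \<Longrightarrow> w \<noteq> v \<Longrightarrow> 0 < mu u w \<Longrightarrow> deg u + deg v + mu u w + mu v w \<le> 2 * k"
    using assms(1,4) m unfolding good_def by blast+
  \<comment> \<open>Since the multiplicity is at most \<open>deg v\<close>, the first inequality of
    \<open>good\<close> shrinks to \<open>2 * deg u \<le> 2 * k\<close>.\<close>
  have "mu v u \<le> deg v" using mu_sum_le_deg[of "{u}" v] assms(4) by simp
  then show "deg u \<le> k" using 1 mu_commute[of u v] by linarith
qed

text \<open>\<open>good k\<close> bounds both degrees by \<open>k\<close>, and the uncoloured hole
  leaves a colour over.\<close>

lemma holed_miss_nonempty:
  assumes "good k" "holed S k c h v r"
  shows "miss k c v \<noteq> {}" "miss k c r \<noteq> {}"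
proof -
  note h = holedD[OF assms(2)]
  have "deg v \<le> k" "deg r \<le> k"
    using goodD(2)[OF assms(1) h(4)] h(7,9) joins_commute by metis+
  then show "miss k c v \<noteq> {}" "miss k c r \<noteq> {}"
    using holed_miss_card(2)[OF assms(2), of v] holed_miss_card(2)[OF assms(2), of r] h(10,11) by auto
qed

text \<open>Each colour missing at \<open>r\<close>, \<open>x\<close> or \<open>z\<close> occurs at
  \<open>v\<close> on a coloured edge, so there are fewer than \<open>deg v\<close> of them. On the
  other hand twice their number is at least \<open>3 * deg v\<close> minus the three multiplicities
  plus 2, where the 2 stems from the hole at \<open>r\<close>; this is at least
  \<open>2 * deg v + 2\<close>.\<close>

lemma three_fan:
  assumes H: "holed S k c h v r"
    and x: "f \<in> E" "joins f v x" "x \<noteq> r" "x \<noteq> v"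
    and z: "g \<in> E" "joins g v z" "z \<noteq> r" "z \<noteq> x" "z \<noteq> v"
    and disj: "miss k c v \<inter> miss k c r = {}" "miss k c v \<inter> miss k c x = {}" "miss k c v \<inter> miss k c z = {}"
      "miss k c r \<inter> miss k c x = {}" "miss k c r \<inter> miss k c z = {}" "miss k c x \<inter> miss k c z = {}"
  shows "\<not> good k"
proof
  assume good: "good k"
  note h = holedD[OF H]
  let ?D = "{e \<in> S - {h}. inc e v}"
  let ?U = "miss k c r \<union> miss k c x \<union> miss k c z"
  have fin: "finite {e \<in> links. inc e v}" using finite_links by simp
  have finD: "finite ?D" using h(6) by (intro finite_subset[OF _ fin]) auto
  have "?U \<subseteq> c ` ?D"
  proof
    fix t assume t: "t \<in> ?U"
    then have "t \<notin> miss k c v" "0 < t" "t \<le> k" using disj by (auto simp: miss_iff)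
    then obtain e where e: "e \<in> E" "inc e v" "c e = t" by (auto simp: miss_iff)
    then have "e \<in> ?D" using h(3)[of e] \<open>0 < t\<close> by auto
    then show "t \<in> c ` ?D" using e by auto
  qed
  then have "card ?U \<le> card ?D" by (rule surj_card_le[OF finD])
  also have "card ?D < deg v"
    unfolding deg_def by (intro psubset_card_mono[OF fin]) (use h(5,6,10) in auto)
  finally have U: "card ?U < deg v" .
  have "card ?U = card (miss k c r \<union> miss k c x) + card (miss k c z)"
    using disj finite_miss by (intro card_Un_disjoint) auto
  moreover have "card (miss k c r \<union> miss k c x) = card (miss k c r) + card (miss k c x)"
    using disj finite_miss by (intro card_Un_disjoint) auto
  moreover have "k + 1 \<le> card (miss k c r) + deg r" using holed_miss_card(2)[OF H] h(11) by simp
  moreover have "k \<le> card (miss k c x) + deg x" "k \<le> card (miss k c z) + deg z"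
    by (rule holed_miss_card(1)[OF H])+
  moreover have "2 * deg r + deg v \<le> 2 * k + mu r v"
    using goodD(1)[OF good h(4)] h(7,9) joins_commute by metis
  moreover have "2 * deg x + deg v \<le> 2 * k + mu x v"
    using goodD(1)[OF good x(1)] x joins_commute by metis
  moreover have "2 * deg z + deg v \<le> 2 * k + mu z v"
    using goodD(1)[OF good z(1)] z joins_commute by metis
  moreover have "mu v r + mu v x + mu v z \<le> deg v"
    using mu_sum_le_deg[of "{r, x, z}" v] x z h(9) by simp
  ultimately show False using U mu_commute[of v r] mu_commute[of v x] mu_commute[of v z] by linarith
qed

section \<open>Fans of two vertices that cannot grow\<close>

definition closed_fan :: "nat \<Rightarrow> ('e \<Rightarrow> nat) \<Rightarrow> 'v \<Rightarrow> 'v \<Rightarrow> 'v \<Rightarrow> bool" where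
  "closed_fan k c v r x \<longleftrightarrow> miss k c v \<inter> miss k c r = {} \<and> miss k c v \<inter> miss k c x = {} \<and>
     (\<forall>t \<in> miss k c r \<union> miss k c x. \<forall>e\<in>E. inc e v \<and> c e = t \<longrightarrow> joins e v r \<or> joins e v x)"

text \<open>A colour missing at one of \<open>r\<close> and \<open>x\<close> occurs at
  \<open>v\<close>, and its edge cannot end at the vertex that misses it, so it ends at the other
  one. Its colour is positive, hence it is not the hole.\<close>

lemma closed_fan_edge:
  assumes H: "holed S k c h v r" and C: "closed_fan k c v r x"
  shows "t \<in> miss k c r \<Longrightarrow> \<exists>e\<in>E. joins e v x \<and> c e = t"
    and "t \<in> miss k c x \<Longrightarrow> \<exists>e\<in>E. e \<noteq> h \<and> joins e v r \<and> c e = t"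
proof -
  have ex: "\<exists>e\<in>E. inc e v \<and> c e = t \<and> (joins e v r \<or> joins e v x)" if "t \<in> miss k c r \<union> miss k c x" for t
  proof -
    have "t \<notin> miss k c v" "0 < t" "t \<le> k" using C that by (auto simp: closed_fan_def miss_iff)
    then obtain e where "e \<in> E" "inc e v" "c e = t" by (auto simp: miss_iff)
    then show ?thesis using C that unfolding closed_fan_def by blast
  qed
  show "\<exists>e\<in>E. joins e v x \<and> c e = t" if "t \<in> miss k c r"
    using ex[of t] that joins_inc by (auto simp: miss_iff)
  show "\<exists>e\<in>E. e \<noteq> h \<and> joins e v r \<and> c e = t" if t: "t \<in> miss k c x"
  proof -
    obtain e where e: "e \<in> E" "c e = t" "joins e v r \<or> joins e v x" using ex[of t] t by blast
    then have "joins e v r" using t joins_inc by (auto simp: miss_iff)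
    moreover have "e \<noteq> h" using t e(2) holedD(8)[OF H] by (auto simp: miss_iff)
    ultimately show ?thesis using e by blast
  qed
qed

lemma closed_fan_card:
  assumes H: "holed S k c h v r" and C: "closed_fan k c v r x"
  shows "card (miss k c r) \<le> mu v x"
proof -
  have fin: "finite {e \<in> E. joins e v x}" using finite_E by simp
  have "miss k c r \<subseteq> c ` {e \<in> E. joins e v x}" using closed_fan_edge(1)[OF H C] by blast
  then show ?thesis unfolding mu_def using surj_card_le[OF fin] by auto
qed

text \<open>Distinct colours sit on distinct parallel edges, and the hole is one of these edges
  without a colour, hence strictness. \<open>A\<close> is the missing set of one vertex in
  \<open>closed_triangle\<close> and the union of two in \<open>closed_pair\<close>.\<close>

lemma closed_fan_card':
  assumes H: "holed S k c h v r"
    and A: "\<And>t. t \<in> A \<Longrightarrow> \<exists>e\<in>E. e \<noteq> h \<and> joins e v r \<and> c e = t"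
  shows "card A < mu v r"
proof -
  note h = holedD[OF H]
  have fin: "finite {e \<in> E. joins e v r}" using finite_E by simp
  then have fin': "finite ({e \<in> E. joins e v r} - {h})" by simp
  have "A \<subseteq> c ` ({e \<in> E. joins e v r} - {h})" using A by blast
  then have "card A \<le> card ({e \<in> E. joins e v r} - {h})" using surj_card_le[OF fin'] by auto
  also have "\<dots> < mu v r" unfolding mu_def using h by (intro psubset_card_mono[OF fin]) auto
  finally show ?thesis .
qed

lemma holed_commute: "holed S k c h v r \<longleftrightarrow> holed S k c h r v"
  by (simp add: holed_def joins_commute)

text \<open>Write s for the sum of the three degrees and M for the sum of the three multiplicities.
  The missing sets of \<open>v\<close>, \<open>r\<close>, \<open>x\<close> have total size at least
  3k + 2 - s, and each fits onto the opposite side of the triangle, with a loss of one at the side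
  of the hole; so M is at least 3k + 3 - s. Adding the third inequality of \<open>good\<close> over
  the three sides gives s + M at most 3k.\<close>

lemma closed_triangle:
  assumes H: "holed S k c h v r" and C: "closed_fan k c v r x" "closed_fan k c r v x"
    and x: "x \<noteq> v" "x \<noteq> r"
  shows "\<not> good k"
proof
  assume good: "good k"
  note h = holedD[OF H]
  note H' = H[unfolded holed_commute[of S k c h v r]]
  have 1: "card (miss k c r) \<le> mu v x" by (rule closed_fan_card[OF H C(1)])
  have 2: "card (miss k c v) \<le> mu r x" by (rule closed_fan_card[OF H' C(2)])
  have 3: "card (miss k c x) < mu v r"
    by (rule closed_fan_card'[OF H]) (rule closed_fan_edge(2)[OF H C(1)])
  \<comment> \<open>Nonempty missing sets force edges \<open>vx\<close> and \<open>rx\<close>. All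
    three sides thus exist, so that \<open>good\<close> can be applied to each.\<close>
  have "card (miss k c v) \<noteq> 0" "card (miss k c r) \<noteq> 0"
    using holed_miss_nonempty[OF good H] finite_miss by auto
  then have pos: "0 < mu v x" "0 < mu r x" using 1 2 by auto
  then obtain f where f: "f \<in> E" "joins f v x"
    unfolding mu_def by (auto simp: card_gt_0_iff)
  obtain g where g: "g \<in> E" "joins g r x"
    using pos(2) unfolding mu_def by (auto simp: card_gt_0_iff)
  have "deg v + deg r + mu v x + mu r x \<le> 2 * k"
    by (rule goodD(3)[OF good h(4,7,9)]) (use x pos in auto)
  moreover have "deg v + deg x + mu v r + mu x r \<le> 2 * k"
    by (rule goodD(3)[OF good f]) (use x h(9) mu_pos[OF h(4) h(7)] in auto)
  moreover have "deg r + deg x + mu r v + mu x v \<le> 2 * k"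
    by (rule goodD(3)[OF good g]) (use x h(9) mu_pos[OF h(4) h(7)] mu_commute[of r v] in auto)
  moreover have "k + 1 \<le> card (miss k c r) + deg r" "k + 1 \<le> card (miss k c v) + deg v"
    using holed_miss_card(2)[OF H] h(10,11) by auto
  moreover have "k \<le> card (miss k c x) + deg x" by (rule holed_miss_card(1)[OF H])
  ultimately show False
    using 1 2 3 mu_commute[of v r] mu_commute[of x r] mu_commute[of x v] by linarith
qed

text \<open>All colours missing at \<open>x\<close> or \<open>y\<close> sit on coloured edges
  between \<open>v\<close> and \<open>r\<close>, fewer than \<open>mu v r\<close>. But
  \<open>k - deg x\<close> is at least half of \<open>deg v - mu v x\<close>, hence at least half of
  \<open>mu v r\<close>, and the same holds for \<open>y\<close> as seen from
  \<open>r\<close>.\<close>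

lemma closed_pair:
  assumes H: "holed S k c h v r" and C: "closed_fan k c v r x" "closed_fan k c r v y"
    and x: "f \<in> E" "joins f v x" "x \<noteq> v" "x \<noteq> r" and y: "g \<in> E" "joins g r y" "y \<noteq> v" "y \<noteq> r"
    and disj: "miss k c x \<inter> miss k c y = {}"
  shows "\<not> good k"
proof
  assume good: "good k"
  note h = holedD[OF H]
  note H' = H[unfolded holed_commute[of S k c h v r]]
  have "card (miss k c x \<union> miss k c y) < mu v r"
    by (rule closed_fan_card'[OF H])
      (use closed_fan_edge(2)[OF H C(1)] closed_fan_edge(2)[OF H' C(2)] joins_commute in blast)
  moreover have "card (miss k c x \<union> miss k c y) = card (miss k c x) + card (miss k c y)"
    using disj finite_miss by (intro card_Un_disjoint)
  moreover have "k \<le> card (miss k c x) + deg x" "k \<le> card (miss k c y) + deg y"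
    by (rule holed_miss_card(1)[OF H])+
  moreover have "2 * deg x + deg v \<le> 2 * k + mu x v"
    using goodD(1)[OF good x(1)] x joins_commute by metis
  moreover have "2 * deg y + deg r \<le> 2 * k + mu y r"
    using goodD(1)[OF good y(1)] y joins_commute by metis
  moreover have "mu v r + mu v x \<le> deg v" using mu_sum_le_deg[of "{r, x}" v] x h(9) by simp
  moreover have "mu r v + mu r y \<le> deg r" using mu_sum_le_deg[of "{v, y}" r] y h(9) by simp
  ultimately show False using mu_commute[of v r] mu_commute[of v x] mu_commute[of r y] by linarith
qed

text \<open>The chain from \<open>v\<close> runs \<open>v\<close>, \<open>r\<close>, \<open>y\<close> and stops there, so it avoids \<open>x\<close>.\<close>

lemma closed_pair_end:
  assumes H: "holed S k c h v r" and C: "closed_fan k c v r x" "closed_fan k c r v y"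
    and xy: "y \<noteq> v" "a \<in> miss k c x" "a \<in> miss k c y" "b \<in> miss k c v"
    and K: "kempe c a b v K w"
  shows "w = y"
proof -
  note H' = H[unfolded holed_commute[of S k c h v r]]
  obtain e where e: "e \<in> E" "joins e v r" "c e = a" using closed_fan_edge(2)[OF H C(1) xy(2)] by blast
  obtain g where g: "g \<in> E" "joins g r y" "c g = b" using closed_fan_edge(1)[OF H' C(2) xy(4)] by blast
  have Kx: "e \<in> K" if "x = v \<or> (\<exists>e\<in>K. inc e x)" "e \<in> E" "inc e x" "c e = a \<or> c e = b" for x e
    using K that unfolding kempe_def by blast
  have "e \<in> K" using Kx[of v e] e joins_inc by auto
  then have "g \<in> K" using Kx[of r g] e g joins_inc by metis
  then have "\<exists>e\<in>K. inc e y" using g joins_inc by metis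
  moreover have "\<not> (\<exists>e\<in>E. inc e y \<and> c e = a)" using xy(3) by (auto simp: miss_iff)
  ultimately show ?thesis using K xy(1) unfolding kempe_def by blast
qed

end

section \<open>The program\<close>

text \<open>
  \<open>''c''\<close> holds the colours \<open>1, \<dots>, k\<close>, with 0 for uncoloured edges, hence the shift by one against the
  loop counter throughout. \<open>''h''\<close> is the hole, joining \<open>''v''\<close> and \<open>''r''\<close>; the fan edges \<open>''f''\<close> and \<open>''g''\<close>
  lead from \<open>''v''\<close> to \<open>''x''\<close> and \<open>''z''\<close>. \<open>''V''\<close>, \<open>''R''\<close>, \<open>''X''\<close>, \<open>''Z''\<close> flag the colours missing at these
  vertices. The edge \<open>e\<close> of colour \<open>t\<close> at \<open>''v''\<close> is stored as \<open>e + 1\<close> in \<open>''at''\<close>, its other end in \<open>''ot''\<close>;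
  \<open>''na''\<close> and \<open>''nb''\<close> do the same for every vertex and the two colours \<open>''del''\<close> and \<open>''bet''\<close> of a chain.
  \<open>''done''\<close> is 1 once the hole is closed.
\<close>

abbreviation one :: exp where "one \<equiv> Const 1"

section \<open>Subroutines: tables, searches, chains\<close>

text \<open>De Morgan form, as \<open>test\<close> has no disjunction.\<close>

definition inc_test :: "exp \<Rightarrow> exp \<Rightarrow> test" where
  "inc_test e w = Neg (Conj (Neg (Equal (Cell ''fst'' e) w)) (Neg (Equal (Cell ''snd'' e) w)))"

text \<open>Uncoloured edges write into cell 0, which stands for no colour. Length \<open>m\<close>
  suffices because \<open>k\<close> stays at most \<open>m\<close>.\<close>

definition fill :: "string \<Rightarrow> string \<Rightarrow> cmd" where
  "fill A w =
     Repeat ''j'' (Put A (Plus (var ''j'') one) one) ;;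
     Repeat ''j'' (IfElse (inc_test (var ''j'') (var w)) (Put A (Cell ''c'' (var ''j'')) (Const 0)) Pass)"

text \<open>The sum of both ends minus \<open>''v''\<close> is the other end, without a case
  distinction.\<close>

definition fill_at :: cmd where
  "fill_at =
     Repeat ''j'' (Put ''at'' (Plus (var ''j'') one) (Const 0)) ;;
     Repeat ''j'' (IfElse (inc_test (var ''j'') (var ''v''))
       (Put ''at'' (Cell ''c'' (var ''j'')) (Plus (var ''j'') one) ;;
        Put ''ot'' (Cell ''c'' (var ''j''))
          (Minus (Plus (Cell ''fst'' (var ''j'')) (Cell ''snd'' (var ''j''))) (var ''v''))) Pass)"

text \<open>All loops have \<open>m\<close> rounds; the guard restricts them to the \<open>k\<close>
  colours in use. The last match survives in \<open>''pick''\<close>.\<close>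

definition search :: "test \<Rightarrow> cmd" where
  "search b =
     Put ''found'' (Const 0) (Const 0) ;;
     Repeat ''j'' (IfElse (Conj (Less (var ''j'') (var ''k'')) b)
       (Put ''found'' (Const 0) one ;; Put ''pick'' (Const 0) (Plus (var ''j'') one)) Pass)"

abbreviation marked :: "string \<Rightarrow> test" where
  "marked A \<equiv> Equal (Cell A (Plus (var ''j'') one)) one"

definition common :: "string \<Rightarrow> string \<Rightarrow> cmd" where
  "common A B = search (Conj (marked A) (marked B))"

definition out_test :: "string \<Rightarrow> test" where
  "out_test A = Conj (marked A) (Conj (Less (Const 0) (Cell ''at'' (Plus (var ''j'') one)))
     (Conj (Neg (Equal (Cell ''ot'' (Plus (var ''j'') one)) (var ''r'')))
        (Neg (Equal (Cell ''ot'' (Plus (var ''j'') one)) (var ''x'')))))"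

definition search_out :: "string \<Rightarrow> cmd" where
  "search_out A = search (out_test A)"

text \<open>The first loop clears a vertex-indexed array by running over edges, so its time is
  bounded in \<open>m\<close> however many vertices there are.\<close>

definition edge_table :: "string \<Rightarrow> string \<Rightarrow> cmd" where
  "edge_table N a =
     Repeat ''j'' (Put N (Cell ''fst'' (var ''j'')) (Const 0) ;; Put N (Cell ''snd'' (var ''j'')) (Const 0)) ;;
     Repeat ''j'' (IfElse (Equal (Cell ''c'' (var ''j'')) (var a))
       (Put N (Cell ''fst'' (var ''j'')) (Plus (var ''j'') one) ;;
        Put N (Cell ''snd'' (var ''j'')) (Plus (var ''j'') one)) Pass)"

text \<open>\<open>''y''\<close> first holds a table entry, which is 0 or an edge plus one, and then
  the edge itself. \<open>''want''\<close> alternates between the two colours by subtraction from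
  their sum.\<close>

definition walk :: cmd where
  "walk =
     Repeat ''j'' (Put ''mark'' (var ''j'') (Const 0)) ;;
     Put ''w'' (Const 0) (var ''v'') ;; Put ''want'' (Const 0) (var ''del'') ;; Put ''stop'' (Const 0) (Const 0) ;;
     Repeat ''j'' (IfElse (Equal (var ''stop'') (Const 0))
       (IfElse (Equal (var ''want'') (var ''del''))
          (Put ''y'' (Const 0) (Cell ''na'' (var ''w''))) (Put ''y'' (Const 0) (Cell ''nb'' (var ''w''))) ;;
        IfElse (Equal (var ''y'') (Const 0)) (Put ''stop'' (Const 0) one)
          (Put ''y'' (Const 0) (Minus (var ''y'') one) ;;
           IfElse (Equal (Cell ''mark'' (var ''y'')) one) (Put ''stop'' (Const 0) one)
            (Put ''mark'' (var ''y'') one ;;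
             Put ''w'' (Const 0) (Minus (Plus (Cell ''fst'' (var ''y'')) (Cell ''snd'' (var ''y''))) (var ''w'')) ;;
             Put ''want'' (Const 0) (Minus (Plus (var ''del'') (var ''bet'')) (var ''want''))))) Pass)"

definition swap_marked :: cmd where
  "swap_marked =
     Repeat ''j'' (IfElse (Equal (Cell ''mark'' (var ''j'')) one)
       (IfElse (Equal (Cell ''c'' (var ''j'')) (var ''bet''))
          (Put ''c'' (var ''j'') (var ''del'')) (Put ''c'' (var ''j'') (var ''bet''))) Pass)"

definition kempe_cmd :: cmd where
  "kempe_cmd = edge_table ''na'' ''del'' ;; edge_table ''nb'' ''bet'' ;; walk ;; swap_marked"

definition finish :: "string \<Rightarrow> cmd" where
  "finish a = Put ''c'' (var ''h'') (var a) ;; Put ''done'' (Const 0) one"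

definition shift :: "string \<Rightarrow> string \<Rightarrow> cmd" where
  "shift f a =
     Put ''c'' (var ''h'') (Cell ''c'' (var f)) ;; Put ''c'' (var f) (var a) ;; Put ''done'' (Const 0) one"

definition fresh :: cmd where
  "fresh = Put ''k'' (Const 0) (Plus (var ''k'') one) ;; finish ''k''"

section \<open>Fan search at one end of the hole\<close>

text \<open>For a colour missing at both the root and the child, the chain from \<open>''v''\<close>
  has only one other end \<open>''w''\<close>. If that is the root, the child keeps the colour
  missing and the hole is shifted to it; otherwise the root keeps it and the hole is coloured
  directly.\<close>

definition test_child :: "string \<Rightarrow> string \<Rightarrow> string \<Rightarrow> cmd" where
  "test_child f x A =
     fill A x ;; common ''V'' A ;;
     IfElse (Equal (var ''found'') one) (shift f ''pick'')
       (common ''R'' A ;;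
        IfElse (Equal (var ''found'') one)
          (Put ''del'' (Const 0) (var ''pick'') ;; kempe_cmd ;;
           IfElse (Equal (var ''w'') (var ''r'')) (shift f ''del'') (finish ''del'')) Pass)"

text \<open>The case distinction on \<open>''w''\<close> of \<open>test_child\<close> is repeated
  for two children. \<open>fresh\<close> is reached only if the missing sets of \<open>''v''\<close>
  and of all three fan vertices are pairwise disjoint.\<close>

definition third_child :: cmd where
  "third_child =
     Put ''g'' (Const 0) (Minus (Cell ''at'' (var ''pick'')) one) ;;
     Put ''z'' (Const 0) (Cell ''ot'' (var ''pick'')) ;;
     test_child ''g'' ''z'' ''Z'' ;;
     IfElse (Equal (var ''done'') (Const 0))
       (common ''X'' ''Z'' ;;
        IfElse (Equal (var ''found'') one)
          (Put ''del'' (Const 0) (var ''pick'') ;; kempe_cmd ;;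
           IfElse (Equal (var ''w'') (var ''x'')) (shift ''g'' ''del'') (shift ''f'' ''del'')) fresh) Pass"

text \<open>
  A third vertex may hang on a colour missing at \<open>x\<close> but not at \<open>r\<close>. Moving the hole to \<open>vx\<close> makes
  \<open>x\<close> the root and \<open>r\<close> its child, so that every fan is a star around its root.
\<close>

definition reroot :: cmd where
  "reroot =
     Put ''c'' (var ''h'') (Cell ''c'' (var ''f'')) ;; Put ''c'' (var ''f'') (Const 0) ;;
     Put ''y'' (Const 0) (var ''h'') ;; Put ''h'' (Const 0) (var ''f'') ;; Put ''f'' (Const 0) (var ''y'') ;;
     Put ''y'' (Const 0) (var ''r'') ;; Put ''r'' (Const 0) (var ''x'') ;; Put ''x'' (Const 0) (var ''y'') ;;
     fill ''R'' ''r'' ;; fill ''X'' ''x''"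

definition grow_fan :: cmd where
  "grow_fan =
     search_out ''R'' ;;
     IfElse (Equal (var ''found'') one) third_child
       (search_out ''X'' ;; IfElse (Equal (var ''found'') one) (reroot ;; third_child) Pass)"

text \<open>\<open>common ''V'' ''V''\<close> selects any colour missing at \<open>''v''\<close>,
  the second colour of all chains. Setting \<open>''x''\<close> to \<open>''r''\<close> before the
  first search makes \<open>out_test\<close> exclude \<open>''r''\<close> alone.\<close>

definition fan :: cmd where
  "fan =
     Put ''done'' (Const 0) (Const 0) ;; fill ''V'' ''v'' ;; fill ''R'' ''r'' ;; fill_at ;;
     common ''V'' ''V'' ;;
     IfElse (Equal (var ''found'') (Const 0)) fresh
       (Put ''bet'' (Const 0) (var ''pick'') ;; common ''V'' ''R'' ;;
        IfElse (Equal (var ''found'') one) (finish ''pick'')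
          (Put ''x'' (Const 0) (var ''r'') ;; search_out ''R'' ;;
           IfElse (Equal (var ''found'') (Const 0)) fresh
             (Put ''f'' (Const 0) (Minus (Cell ''at'' (var ''pick'')) one) ;;
              Put ''x'' (Const 0) (Cell ''ot'' (var ''pick'')) ;;
              test_child ''f'' ''x'' ''X'' ;;
              IfElse (Equal (var ''done'') (Const 0)) grow_fan Pass)))"

section \<open>Both ends of the hole, and the main loops\<close>

definition swap_ends :: cmd where
  "swap_ends = Put ''y'' (Const 0) (var ''v'') ;; Put ''v'' (Const 0) (var ''r'') ;; Put ''r'' (Const 0) (var ''y'')"

text \<open>\<open>swap_ends\<close> restores the orientation of the first fan, to which
  \<open>''x1''\<close>, \<open>''f1''\<close>, \<open>''b1''\<close> belong, while
  \<open>''x''\<close> comes from the fan at the other end. The chain's end is not tested here,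
  since \<open>closed_pair_end\<close> determines it.\<close>

definition both_closed :: cmd where
  "both_closed =
     swap_ends ;;
     IfElse (Equal (var ''x'') (var ''x1'')) fresh
       (fill ''X'' ''x1'' ;; fill ''Z'' ''x'' ;; common ''X'' ''Z'' ;;
        IfElse (Equal (var ''found'') one)
          (Put ''del'' (Const 0) (var ''pick'') ;; Put ''bet'' (Const 0) (var ''b1'') ;; kempe_cmd ;;
           shift ''f1'' ''del'') fresh)"

definition extend :: cmd where
  "extend =
     fan ;;
     IfElse (Equal (var ''done'') (Const 0))
       (Put ''x1'' (Const 0) (var ''x'') ;; Put ''f1'' (Const 0) (var ''f'') ;; Put ''b1'' (Const 0) (var ''bet'') ;;
        swap_ends ;; fan ;; IfElse (Equal (var ''done'') (Const 0)) both_closed Pass) Pass"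

definition colour_links :: cmd where
  "colour_links =
     Repeat ''e'' (IfElse (Equal (Cell ''fst'' (var ''e'')) (Cell ''snd'' (var ''e''))) Pass
       (Put ''h'' (Const 0) (var ''e'') ;; Put ''v'' (Const 0) (Cell ''fst'' (var ''e'')) ;;
        Put ''r'' (Const 0) (Cell ''snd'' (var ''e'')) ;; extend))"

definition colour_loops :: cmd where
  "colour_loops =
     Repeat ''e'' (IfElse (Equal (Cell ''fst'' (var ''e'')) (Cell ''snd'' (var ''e'')))
       (Put ''h'' (Const 0) (var ''e'') ;; Put ''v'' (Const 0) (Cell ''fst'' (var ''e'')) ;;
        fill ''V'' ''v'' ;; common ''V'' ''V'' ;;
        IfElse (Equal (var ''found'') one) (finish ''pick'') fresh) Pass)"

definition output_colours :: cmd where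
  "output_colours = Repeat ''j'' (Put ''colour'' (var ''j'') (Minus (Cell ''c'' (var ''j'')) one))"

definition colour_edges :: cmd where
  "colour_edges = colour_links ;; colour_loops ;; output_colours"

section \<open>Write sets, well-formedness and loop depth\<close>

text \<open>Explicit write sets let the simplifier discharge the side condition of
  \<open>sem_frame\<close> without unfolding the programs.\<close>

lemma writes_simps [simp]:
  "writes (fill A w) = {''j'', A}"
  "writes fill_at = {''j'', ''at'', ''ot''}"
  "writes (search b) = {''j'', ''found'', ''pick''}"
  "writes (common A B) = {''j'', ''found'', ''pick''}"
  "writes (search_out A) = {''j'', ''found'', ''pick''}"
  "writes (edge_table N a) = {''j'', N}"
  "writes walk = {''j'', ''mark'', ''w'', ''want'', ''stop'', ''y''}"
  "writes swap_marked = {''j'', ''c''}"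
  "writes kempe_cmd = {''j'', ''na'', ''nb'', ''mark'', ''w'', ''want'', ''stop'', ''y'', ''c''}"
  "writes (finish a) = {''c'', ''done''}"
  "writes (shift f a) = {''c'', ''done''}"
  "writes fresh = {''k'', ''c'', ''done''}"
  unfolding fill_def fill_at_def search_def common_def search_out_def edge_table_def walk_def
    swap_marked_def kempe_cmd_def finish_def shift_def fresh_def
  by auto

lemma writes_simps2 [simp]:
  "writes (test_child f x A) = {''j'', A, ''found'', ''pick'', ''c'', ''done'', ''del'', ''na'', ''nb'', ''mark'', ''w'', ''want'', ''stop'', ''y''}"
  "writes reroot = {''c'', ''y'', ''h'', ''f'', ''r'', ''x'', ''j'', ''R'', ''X''}"
  unfolding test_child_def reroot_def by auto

lemma writes_third_child [simp]:
  "writes third_child = {''g'', ''z'', ''Z'', ''k''} \<union> {''j'', ''found'', ''pick'', ''c'', ''done'', ''del'', ''na'', ''nb'', ''mark'', ''w'', ''want'', ''stop'', ''y''}"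
  unfolding third_child_def by auto

lemma writes_fan [simp]:
  "writes fan = {''V'', ''at'', ''ot'', ''bet'', ''h'', ''f'', ''r'', ''x'', ''R'', ''X'', ''g'', ''z'', ''Z'', ''k''} \<union>
     {''j'', ''found'', ''pick'', ''c'', ''done'', ''del'', ''na'', ''nb'', ''mark'', ''w'', ''want'', ''stop'', ''y''}"
  unfolding fan_def grow_fan_def by auto

lemma writes_extend [simp]:
  "writes extend = {''V'', ''at'', ''ot'', ''bet'', ''h'', ''f'', ''r'', ''x'', ''R'', ''X'', ''g'', ''z'', ''Z'', ''k'', ''v'', ''x1'', ''f1'', ''b1''} \<union>
     {''j'', ''found'', ''pick'', ''c'', ''done'', ''del'', ''na'', ''nb'', ''mark'', ''w'', ''want'', ''stop'', ''y''}"
  unfolding extend_def both_closed_def swap_ends_def by auto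

lemma wf_colour_edges: "wf_cmd colour_edges"
proof -
  have 1: "wf_cmd (fill A w)" if "A \<noteq> ''m''" "A \<noteq> ''j''" for A w
    using that by (simp add: fill_def)
  have 2: "wf_cmd fill_at" "wf_cmd (common A B)" "wf_cmd (search_out A)" for A B
    by (simp_all add: fill_at_def common_def search_out_def search_def)
  have 3: "wf_cmd kempe_cmd" by (simp add: kempe_cmd_def edge_table_def walk_def swap_marked_def)
  have 4: "wf_cmd (finish a)" "wf_cmd (shift f a)" "wf_cmd fresh" for a f
    by (simp_all add: finish_def shift_def fresh_def)
  have 5: "wf_cmd (test_child f x A)" if "A \<noteq> ''m''" "A \<noteq> ''j''" for f x A
    using that by (simp add: test_child_def 1 2 3 4)
  have 6: "wf_cmd third_child" by (simp add: third_child_def 2 3 4 5)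
  have 7: "wf_cmd reroot" by (simp add: reroot_def 1)
  have 8: "wf_cmd fan" by (simp add: fan_def grow_fan_def 1 2 4 5 6 7)
  have 9: "wf_cmd extend" by (simp add: extend_def both_closed_def swap_ends_def 1 2 3 4 8)
  show ?thesis
    by (simp add: colour_edges_def colour_links_def colour_loops_def output_colours_def 1 2 4 9)
qed

text \<open>The work per edge contains no loop within a loop, so only the outer loop over the edges
  adds a second level. This depth is the exponent of the time bound.\<close>

lemma nesting_colour_edges: "nesting colour_edges = 2"
proof -
  have 1: "nesting (fill A w) = 1" "nesting fill_at = 1" "nesting (common A B) = 1" "nesting (search_out A) = 1" for A B w
    by (simp_all add: fill_def fill_at_def common_def search_out_def search_def)
  have 2: "nesting kempe_cmd = 1" by (simp add: kempe_cmd_def edge_table_def walk_def swap_marked_def)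
  have 3: "nesting (finish a) = 0" "nesting (shift f a) = 0" "nesting fresh = 0" for a f
    by (simp_all add: finish_def shift_def fresh_def)
  have 4: "nesting (test_child f x A) = 1" for f x A by (simp add: test_child_def 1 2 3)
  have 5: "nesting third_child = 1" by (simp add: third_child_def 1 2 3 4)
  have 6: "nesting fan = 1" by (simp add: fan_def grow_fan_def reroot_def 1 2 3 4 5)
  have 7: "nesting extend = 1" by (simp add: extend_def both_closed_def swap_ends_def 1 2 3 6)
  show ?thesis
    by (simp add: colour_edges_def colour_links_def colour_loops_def output_colours_def 1 2 3 7)
qed

section \<open>What tables and searches leave in memory\<close>

locale edge_memory =
  fixes m :: nat and p q :: "nat \<Rightarrow> nat"
begin

sublocale edge_set "{..<m}" p q
  by unfold_locales simp

definition graph :: "store \<Rightarrow> bool" where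
  "graph s \<longleftrightarrow> get s ''m'' 0 = m \<and> (\<forall>i<m. get s ''fst'' i = p i \<and> get s ''snd'' i = q i)"

lemma graph_cong:
  "get t ''m'' = get s ''m'' \<Longrightarrow> get t ''fst'' = get s ''fst'' \<Longrightarrow> get t ''snd'' = get s ''snd'' \<Longrightarrow>
    graph t \<longleftrightarrow> graph s"
  by (simp add: graph_def)

abbreviation col :: "store \<Rightarrow> nat \<Rightarrow> nat" where "col s \<equiv> get s ''c''"
abbreviation ncol :: "store \<Rightarrow> nat" where "ncol s \<equiv> get s ''k'' 0"
abbreviation free :: "store \<Rightarrow> nat \<Rightarrow> nat set" where "free s \<equiv> miss (ncol s) (col s)"

definition shows_free :: "string \<Rightarrow> nat \<Rightarrow> store \<Rightarrow> bool" where
  "shows_free A u s \<longleftrightarrow> (\<forall>t\<in>{1..ncol s}. get s A t = (if t \<in> free s u then 1 else 0))"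

lemma shows_free_cong:
  "get t A = get s A \<Longrightarrow> get t ''k'' = get s ''k'' \<Longrightarrow> get t ''c'' = get s ''c'' \<Longrightarrow>
    shows_free A u t \<longleftrightarrow> shows_free A u s"
  by (simp add: shows_free_def)

lemma inc_test_val:
  assumes "graph s" "exp_val e (get s) < m"
  shows "test_val (inc_test e w) (get s) \<longleftrightarrow> inc (exp_val e (get s)) (exp_val w (get s))"
  using assms by (auto simp: inc_test_def graph_def inc_def)

lemma fill_shows_free:
  assumes s: "graph s" "ncol s \<le> m" and A: "A \<notin> {''j'', ''m'', ''fst'', ''snd'', ''c'', ''k'', w}" and w: "w \<noteq> ''j''"
  shows "shows_free A (get s w 0) (sem (fill A w) s)"
proof -
  have An: "''j'' \<noteq> A" "''m'' \<noteq> A" "''fst'' \<noteq> A" "''snd'' \<noteq> A" "''c'' \<noteq> A" "''k'' \<noteq> A" "w \<noteq> A"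
    using A by auto
  let ?L1 = "Put A (Plus (var ''j'') one) one"
  let ?L2 = "IfElse (inc_test (var ''j'') (var w)) (Put A (Cell ''c'' (var ''j'')) (Const 0)) Pass"
  define s1 where "s1 = sem (Repeat ''j'' ?L1) s"
  define u where "u = get s w 0"
  have m: "get s ''m'' 0 = m" using s by (simp add: graph_def)
  have fr: "get s1 y = get s y" if "y \<notin> {''j'', A}" for y
    unfolding s1_def by (rule sem_frame) (use that in auto)
  have 1: "\<forall>j<m. get s1 A (Suc j) = 1"
    unfolding s1_def
    using Repeat_invariant[where I = "\<lambda>i t. \<forall>j<i. get t A (Suc j) = 1" and x = "''j''" and c = ?L1 and s = s] A m
    by (fastforce simp: get_put_if less_Suc_eq)
  have g1: "graph s1" using s fr An graph_cong[of s1 s] by simp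
  \<comment> \<open>Cell 0 is left out, as uncoloured edges write there.\<close>
  define I where "I = (\<lambda>i t. \<forall>a\<in>{1..m}. get t A a = (if \<exists>j<i. inc j u \<and> col s j = a then 0 else 1))"
  have "I (get s1 ''m'' 0) (sem (Repeat ''j'' ?L2) s1)"
  proof (rule Repeat_invariant)
    show "I 0 (put ''j'' 0 0 s1)"
      using 1 A by (auto simp: I_def get_put_if gr0_conv_Suc dest!: Suc_le_lessD)
  next
    fix i t assume i: "i < get s1 ''m'' 0" "get t ''j'' 0 = i"
      and t: "\<And>y. y \<notin> insert ''j'' (writes ?L2) \<Longrightarrow> get t y = get s1 y" and I: "I i t"
    have t': "get t y = get s y" if "y \<notin> {''j'', A}" for y using t[of y] fr[of y] that by simp
    have im: "i < m" using i fr[of "''m''"] m An by simp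
    have gt: "graph t" using s t' An graph_cong[of t s] by simp
    have "test_val (inc_test (var ''j'') (var w)) (get t) \<longleftrightarrow> inc i u"
      using inc_test_val[OF gt, of "var ''j''" "var w"] i im t'[of w] w An by (simp add: u_def)
    then show "I (Suc i) (put ''j'' 0 (Suc i) (sem ?L2 t))"
      using I i t'[of "''c''"] An by (auto simp: I_def get_put_if less_Suc_eq)
  qed (use A in auto)
  then have I: "I m (sem (fill A w) s)" using fr[of "''m''"] m An by (simp add: fill_def s1_def)
  have "get (sem (fill A w) s) y = get s y" if "y \<notin> {''j'', A}" for y
    by (rule sem_frame) (use that in simp)
  then have "ncol (sem (fill A w) s) = ncol s" "col (sem (fill A w) s) = col s" using An by auto
  then show ?thesis using I s(2) by (auto simp: shows_free_def I_def miss_iff u_def)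
qed

definition shows_at :: "nat \<Rightarrow> store \<Rightarrow> bool" where
  "shows_at u s \<longleftrightarrow> (\<forall>t\<in>{1..m}. get s ''at'' t = 0 \<and> (\<forall>e<m. inc e u \<longrightarrow> col s e \<noteq> t) \<or>
     (\<exists>e<m. get s ''at'' t = Suc e \<and> col s e = t \<and> joins e u (get s ''ot'' t)))"

lemma inc_joins_sum: "inc e u \<Longrightarrow> joins e u (p e + q e - u)"
  by (auto simp: inc_def joins_def)

lemma fill_at_shows:
  assumes s: "graph s"
  shows "shows_at (get s ''v'' 0) (sem fill_at s)"
proof -
  let ?L1 = "Put ''at'' (Plus (var ''j'') one) (Const 0)"
  let ?L2 = "IfElse (inc_test (var ''j'') (var ''v''))
       (Put ''at'' (Cell ''c'' (var ''j'')) (Plus (var ''j'') one) ;;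
        Put ''ot'' (Cell ''c'' (var ''j''))
          (Minus (Plus (Cell ''fst'' (var ''j'')) (Cell ''snd'' (var ''j''))) (var ''v''))) Pass"
  define s1 where "s1 = sem (Repeat ''j'' ?L1) s"
  define u where "u = get s ''v'' 0"
  have m: "get s ''m'' 0 = m" using s by (simp add: graph_def)
  have fr: "get s1 y = get s y" if "y \<notin> {''j'', ''at''}" for y
    unfolding s1_def by (rule sem_frame) (use that in auto)
  have 1: "\<forall>j<m. get s1 ''at'' (Suc j) = 0"
    unfolding s1_def
    using Repeat_invariant[where I = "\<lambda>i t. \<forall>j<i. get t ''at'' (Suc j) = 0" and x = "''j''" and c = ?L1 and s = s] m
    by (fastforce simp: get_put_if less_Suc_eq)
  define I where "I = (\<lambda>i t. \<forall>a\<in>{1..m}. get t ''at'' a = 0 \<and> (\<forall>e<i. inc e u \<longrightarrow> col s e \<noteq> a) \<or>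
     (\<exists>e<i. get t ''at'' a = Suc e \<and> col s e = a \<and> joins e u (get t ''ot'' a)))"
  have "I (get s1 ''m'' 0) (sem (Repeat ''j'' ?L2) s1)"
  proof (rule Repeat_invariant)
    show "I 0 (put ''j'' 0 0 s1)"
      using 1 by (auto simp: I_def get_put_if gr0_conv_Suc dest!: Suc_le_lessD)
  next
    fix i t assume i: "i < get s1 ''m'' 0" "get t ''j'' 0 = i"
      and t: "\<And>y. y \<notin> insert ''j'' (writes ?L2) \<Longrightarrow> get t y = get s1 y" and I: "I i t"
    have t': "get t y = get s y" if "y \<notin> {''j'', ''at'', ''ot''}" for y using t[of y] fr[of y] that by simp
    have im: "i < m" using i fr[of "''m''"] m by simp
    have gt: "graph t" using s t' graph_cong[of t s] by simp
    have test: "test_val (inc_test (var ''j'') (var ''v'')) (get t) \<longleftrightarrow> inc i u"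
      using inc_test_val[OF gt, of "var ''j''" "var ''v''"] i im t'[of "''v''"] by (simp add: u_def)
    have pq: "get t ''fst'' i = p i" "get t ''snd'' i = q i" using gt im by (auto simp: graph_def)
    show "I (Suc i) (put ''j'' 0 (Suc i) (sem ?L2 t))"
      unfolding I_def
    proof
      fix a assume a: "a \<in> {1..m}"
      let ?t = "put ''j'' 0 (Suc i) (sem ?L2 t)"
      consider "inc i u" "col s i = a" | "\<not> (inc i u \<and> col s i = a)" by blast
      then show "get ?t ''at'' a = 0 \<and> (\<forall>e<Suc i. inc e u \<longrightarrow> col s e \<noteq> a) \<or>
         (\<exists>e<Suc i. get ?t ''at'' a = Suc e \<and> col s e = a \<and> joins e u (get ?t ''ot'' a))"
      proof cases
        case 1
        then have "get ?t ''at'' a = Suc i" "get ?t ''ot'' a = p i + q i - u"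
          using test i pq t'[of "''c''"] t'[of "''v''"] by (auto simp: get_put_if u_def)
        then show ?thesis using 1 inc_joins_sum[of i u] by auto
      next
        case 2
        then have "get ?t ''at'' a = get t ''at'' a" "get ?t ''ot'' a = get t ''ot'' a"
          using test i t'[of "''c''"] by (auto simp: get_put_if)
        then show ?thesis using I[unfolded I_def, rule_format, OF a] 2 by (auto simp: less_Suc_eq)
      qed
    qed
  qed auto
  then have I: "I m (sem fill_at s)" using fr[of "''m''"] m by (simp add: fill_at_def s1_def)
  have "get (sem fill_at s) y = get s y" if "y \<notin> {''j'', ''at'', ''ot''}" for y
    by (rule sem_frame) (use that in simp)
  then show ?thesis using I by (simp add: shows_at_def I_def u_def)
qed

text \<open>\<open>Q\<close> is the meaning of the test \<open>b\<close> for the colour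
  \<open>j + 1\<close>. The test is evaluated in states that differ from \<open>s\<close> at most in
  the variables written by the search itself, so its meaning refers to \<open>s\<close>
  alone.\<close>

lemma search_result:
  assumes m: "get s ''m'' 0 = m" and k: "ncol s \<le> m"
    and b: "\<And>t. (\<And>y. y \<notin> {''j'', ''found'', ''pick''} \<Longrightarrow> get t y = get s y) \<Longrightarrow> get t ''j'' 0 < ncol s \<Longrightarrow>
      test_val b (get t) \<longleftrightarrow> Q (Suc (get t ''j'' 0))"
  obtains "get (sem (search b) s) ''found'' 0 = 1" "get (sem (search b) s) ''pick'' 0 \<in> {1..ncol s}"
      "Q (get (sem (search b) s) ''pick'' 0)"
  | "get (sem (search b) s) ''found'' 0 = 0" "\<And>t. t \<in> {1..ncol s} \<Longrightarrow> \<not> Q t"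
proof -
  let ?L = "IfElse (Conj (Less (var ''j'') (var ''k'')) b)
       (Put ''found'' (Const 0) one ;; Put ''pick'' (Const 0) (Plus (var ''j'') one)) Pass"
  define s1 where "s1 = put ''found'' 0 0 s"
  define I where "I = (\<lambda>i t. get t ''found'' 0 = 1 \<and> get t ''pick'' 0 \<in> {1..ncol s} \<and> Q (get t ''pick'' 0) \<or>
     get t ''found'' 0 = 0 \<and> (\<forall>j<i. j < ncol s \<longrightarrow> \<not> Q (Suc j)))"
  have "I (get s1 ''m'' 0) (sem (Repeat ''j'' ?L) s1)"
  proof (rule Repeat_invariant)
    show "I 0 (put ''j'' 0 0 s1)" by (simp add: I_def s1_def)
  next
    fix i t assume i: "i < get s1 ''m'' 0" "get t ''j'' 0 = i"
      and t: "\<And>y. y \<notin> insert ''j'' (writes ?L) \<Longrightarrow> get t y = get s1 y" and I: "I i t"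
    have t': "get t y = get s y" if "y \<notin> {''j'', ''found'', ''pick''}" for y using t[of y] that by (simp add: s1_def)
    then show "I (Suc i) (put ''j'' 0 (Suc i) (sem ?L t))"
      using I i b[of t] by (auto simp: I_def less_Suc_eq)
  qed auto
  then have I: "I m (sem (search b) s)" using m by (simp add: search_def s1_def)
  have "\<not> Q t" if "t \<in> {1..ncol s}" "\<forall>j<m. j < ncol s \<longrightarrow> \<not> Q (Suc j)" for t
    using that k by (cases t) auto
  then show ?thesis using I that unfolding I_def by blast
qed

lemma common_result:
  assumes m: "get s ''m'' 0 = m" "ncol s \<le> m"
    and A: "shows_free A u s" "A \<notin> {''j'', ''found'', ''pick''}"
    and B: "shows_free B w s" "B \<notin> {''j'', ''found'', ''pick''}"
  obtains "get (sem (common A B) s) ''found'' 0 = 1"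
      "get (sem (common A B) s) ''pick'' 0 \<in> free s u" "get (sem (common A B) s) ''pick'' 0 \<in> free s w"
  | "get (sem (common A B) s) ''found'' 0 = 0" "free s u \<inter> free s w = {}"
proof (rule search_result[OF m, of "Conj (marked A) (marked B)" "\<lambda>t. t \<in> free s u \<and> t \<in> free s w",
      folded common_def])
  fix t assume t: "\<And>y. y \<notin> {''j'', ''found'', ''pick''} \<Longrightarrow> get t y = get s y" "get t ''j'' 0 < ncol s"
  then have "Suc (get t ''j'' 0) \<in> {1..ncol s}" by auto
  then show "test_val (Conj (marked A) (marked B)) (get t) \<longleftrightarrow>
     Suc (get t ''j'' 0) \<in> free s u \<and> Suc (get t ''j'' 0) \<in> free s w"
    using A B t(1)[of A] t(1)[of B] by (auto simp: shows_free_def)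
next
  assume *: "get (sem (common A B) s) ''found'' 0 = 0" "\<And>t. t \<in> {1..ncol s} \<Longrightarrow> \<not> (t \<in> free s u \<and> t \<in> free s w)"
  have "free s u \<inter> free s w = {}" using *(2) by (auto simp: miss_def)
  then show thesis by (rule that(2)[OF *(1)])
qed (use that in blast)

lemma search_out_result:
  assumes m: "get s ''m'' 0 = m" "ncol s \<le> m"
    and A: "shows_free A u s" "A \<notin> {''j'', ''found'', ''pick''}" and at: "shows_at v s"
  obtains e where "get (sem (search_out A) s) ''found'' 0 = 1" "e < m"
      "get (sem (search_out A) s) ''pick'' 0 = col s e" "get s ''at'' (col s e) = Suc e" "col s e \<in> free s u"
      "joins e v (get s ''ot'' (col s e))"
      "get s ''ot'' (col s e) \<noteq> get s ''r'' 0" "get s ''ot'' (col s e) \<noteq> get s ''x'' 0"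
  | "get (sem (search_out A) s) ''found'' 0 = 0"
      "\<And>e. e < m \<Longrightarrow> inc e v \<Longrightarrow> col s e \<in> free s u \<Longrightarrow> proper (col s) \<Longrightarrow>
         joins e v (get s ''r'' 0) \<or> joins e v (get s ''x'' 0)"
proof (rule search_result[OF m, of "out_test A" "\<lambda>t. t \<in> free s u \<and> 0 < get s ''at'' t \<and> get s ''ot'' t \<noteq> get s ''r'' 0 \<and>
      get s ''ot'' t \<noteq> get s ''x'' 0", folded search_out_def[of A]])
  fix t assume t: "\<And>y. y \<notin> {''j'', ''found'', ''pick''} \<Longrightarrow> get t y = get s y" "get t ''j'' 0 < ncol s"
  let ?a = "Suc (get t ''j'' 0)"
  have "?a \<in> {1..ncol s}" using t(2) by auto
  then show "test_val (out_test A) (get t) \<longleftrightarrow>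
     ?a \<in> free s u \<and> 0 < get s ''at'' ?a \<and> get s ''ot'' ?a \<noteq> get s ''r'' 0 \<and> get s ''ot'' ?a \<noteq> get s ''x'' 0"
    using A t(1)[of A] t(1)[of "''at''"] t(1)[of "''ot''"] t(1)[of "''r''"] t(1)[of "''x''"]
    by (auto simp: shows_free_def out_test_def)
next
  let ?a = "get (sem (search_out A) s) ''pick'' 0"
  assume *: "get (sem (search_out A) s) ''found'' 0 = 1" "?a \<in> {1..ncol s}"
    "?a \<in> free s u \<and> 0 < get s ''at'' ?a \<and> get s ''ot'' ?a \<noteq> get s ''r'' 0 \<and> get s ''ot'' ?a \<noteq> get s ''x'' 0"
  then have "?a \<in> {1..m}" using m by auto
  then obtain e where "e < m" "get s ''at'' ?a = Suc e" "col s e = ?a" "joins e v (get s ''ot'' ?a)"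
    using at *(3) unfolding shows_at_def by fastforce
  then show thesis using that(1)[of e] * by simp
next
  assume *: "get (sem (search_out A) s) ''found'' 0 = 0"
    "\<And>t. t \<in> {1..ncol s} \<Longrightarrow> \<not> (t \<in> free s u \<and> 0 < get s ''at'' t \<and> get s ''ot'' t \<noteq> get s ''r'' 0 \<and>
      get s ''ot'' t \<noteq> get s ''x'' 0)"
  have "joins e v (get s ''r'' 0) \<or> joins e v (get s ''x'' 0)"
    if e: "e < m" "inc e v" "col s e \<in> free s u" "proper (col s)" for e
  proof -
    have a: "col s e \<in> {1..ncol s}" "col s e \<in> {1..m}" using e(3) m by (auto simp: miss_def)
    then obtain f where f: "f < m" "get s ''at'' (col s e) = Suc f" "col s f = col s e" "joins f v (get s ''ot'' (col s e))"
      using at e(1,2) unfolding shows_at_def by fastforce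
    \<comment> \<open>The table holds one edge per colour; properness identifies it with
      \<open>e\<close>.\<close>
    then have "e = f" using e a joins_inc(1)[OF f(4)] unfolding proper_def by fastforce
    moreover have "get s ''ot'' (col s e) = get s ''r'' 0 \<or> get s ''ot'' (col s e) = get s ''x'' 0"
      using *(2)[OF a(1)] e(3) f(2) by simp
    ultimately show ?thesis using f(4) by metis
  qed
  then show thesis by (intro that(2)[OF *(1)])
qed

text \<open>Restricted to ends of edges, because only their cells have been cleared; a chain visits
  no other vertices.\<close>

definition is_table :: "string \<Rightarrow> nat \<Rightarrow> (nat \<Rightarrow> nat) \<Rightarrow> store \<Rightarrow> bool" where
  "is_table N a c s \<longleftrightarrow> (\<forall>u. (\<exists>e<m. inc e u) \<longrightarrow>
     get s N u = 0 \<and> (\<forall>e<m. inc e u \<longrightarrow> c e \<noteq> a) \<or> (\<exists>e<m. get s N u = Suc e \<and> inc e u \<and> c e = a))"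

lemma edge_table_is_table:
  assumes s: "graph s" and N: "N \<notin> {''j'', ''m'', ''fst'', ''snd'', ''c'', a}" and a: "a \<noteq> ''j''"
  shows "is_table N (get s a 0) (col s) (sem (edge_table N a) s)"
proof -
  have Nn: "''j'' \<noteq> N" "''m'' \<noteq> N" "''fst'' \<noteq> N" "''snd'' \<noteq> N" "''c'' \<noteq> N" "a \<noteq> N" using N by auto
  let ?L1 = "Put N (Cell ''fst'' (var ''j'')) (Const 0) ;; Put N (Cell ''snd'' (var ''j'')) (Const 0)"
  let ?L2 = "IfElse (Equal (Cell ''c'' (var ''j'')) (var a))
       (Put N (Cell ''fst'' (var ''j'')) (Plus (var ''j'') one) ;;
        Put N (Cell ''snd'' (var ''j'')) (Plus (var ''j'') one)) Pass"
  define s1 where "s1 = sem (Repeat ''j'' ?L1) s"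
  have m: "get s ''m'' 0 = m" using s by (simp add: graph_def)
  have fr: "get s1 y = get s y" if "y \<notin> {''j'', N}" for y
    unfolding s1_def by (rule sem_frame) (use that in auto)
  define I1 where "I1 = (\<lambda>i t. \<forall>u. (\<exists>e<i. inc e u) \<longrightarrow> get t N u = 0)"
  have "I1 (get s ''m'' 0) s1"
    unfolding s1_def
  proof (rule Repeat_invariant)
    show "I1 0 (put ''j'' 0 0 s)" by (simp add: I1_def)
  next
    fix i t assume i: "i < get s ''m'' 0" "get t ''j'' 0 = i"
      and t: "\<And>y. y \<notin> insert ''j'' (writes ?L1) \<Longrightarrow> get t y = get s y" and I: "I1 i t"
    have pq: "get t ''fst'' i = p i" "get t ''snd'' i = q i"
      using s t[of "''fst''"] t[of "''snd''"] Nn i m by (auto simp: graph_def)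
    show "I1 (Suc i) (put ''j'' 0 (Suc i) (sem ?L1 t))"
      using I pq Nn i by (auto simp: I1_def get_put_if less_Suc_eq inc_def)
  qed (use Nn in auto)
  then have 1: "\<forall>u. (\<exists>e<m. inc e u) \<longrightarrow> get s1 N u = 0" using m by (simp add: I1_def)
  define b where "b = get s a 0"
  define I where "I = (\<lambda>i t. \<forall>u. (\<exists>e<m. inc e u) \<longrightarrow> get t N u = 0 \<and> (\<forall>e<i. inc e u \<longrightarrow> col s e \<noteq> b) \<or>
     (\<exists>e<i. get t N u = Suc e \<and> inc e u \<and> col s e = b))"
  have "I (get s1 ''m'' 0) (sem (Repeat ''j'' ?L2) s1)"
  proof (rule Repeat_invariant)
    show "I 0 (put ''j'' 0 0 s1)" using 1 Nn by (simp add: I_def)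
  next
    fix i t assume i: "i < get s1 ''m'' 0" "get t ''j'' 0 = i"
      and t: "\<And>y. y \<notin> insert ''j'' (writes ?L2) \<Longrightarrow> get t y = get s1 y" and I: "I i t"
    have t': "get t y = get s y" if "y \<notin> {''j'', N}" for y using t[of y] fr[of y] that by simp
    have im: "i < m" using i fr[of "''m''"] m Nn by simp
    have pq: "get t ''fst'' i = p i" "get t ''snd'' i = q i"
      using s t'[of "''fst''"] t'[of "''snd''"] Nn im by (auto simp: graph_def)
    have tc: "get t ''c'' = col s" "get t a 0 = b" using t'[of "''c''"] t'[of a] Nn a by (auto simp: b_def)
    show "I (Suc i) (put ''j'' 0 (Suc i) (sem ?L2 t))"
      unfolding I_def
    proof (intro allI impI)
      fix u assume u: "\<exists>e<m. inc e u"
      let ?t = "put ''j'' 0 (Suc i) (sem ?L2 t)"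
      show "get ?t N u = 0 \<and> (\<forall>e<Suc i. inc e u \<longrightarrow> col s e \<noteq> b) \<or>
         (\<exists>e<Suc i. get ?t N u = Suc e \<and> inc e u \<and> col s e = b)"
      proof (cases "inc i u \<and> col s i = b")
        case True
        then have "get ?t N u = Suc i" using tc i pq Nn by (auto simp: get_put_if inc_def)
        then show ?thesis using True by auto
      next
        case False
        then have "get ?t N u = get t N u" using tc i pq Nn by (auto simp: get_put_if inc_def)
        then show ?thesis using I[unfolded I_def, rule_format, OF u] False by (auto simp: less_Suc_eq)
      qed
    qed
  qed (use Nn in auto)
  then have I: "I m (sem (edge_table N a) s)" using fr[of "''m''"] m Nn by (simp add: edge_table_def s1_def)
  then show ?thesis by (simp add: is_table_def I_def b_def)
qed

section \<open>Walking and swapping a Kempe chain\<close>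

definition marks :: "store \<Rightarrow> nat set" where
  "marks s = {e. e < m \<and> get s ''mark'' e = 1}"

text \<open>Every round of a running walk marks a new edge. After \<open>m\<close> rounds the walk
  has either stopped or marked all edges, and in both cases nothing remains to be explored.\<close>

lemma walk_explores:
  assumes s: "graph s" and c: "proper (col s)" "\<forall>e<m. col s e \<noteq> 0 \<longrightarrow> p e \<noteq> q e"
    and ab: "a = get s ''del'' 0" "b = get s ''bet'' 0" "0 < a" "a \<noteq> b"
    and v: "v = get s ''v'' 0" "\<exists>e<m. inc e v" "b \<in> miss k (col s) v"
    and na: "is_table ''na'' a (col s) s" and nb: "is_table ''nb'' b (col s) s"
  shows "kempe (col s) a b v (marks (sem walk s)) (get (sem walk s) ''w'' 0)"
proof -
  let ?L1 = "Put ''mark'' (var ''j'') (Const 0)"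
  let ?P1 = "IfElse (Equal (var ''want'') (var ''del''))
          (Put ''y'' (Const 0) (Cell ''na'' (var ''w''))) (Put ''y'' (Const 0) (Cell ''nb'' (var ''w'')))"
  let ?P2 = "IfElse (Equal (var ''y'') (Const 0)) (Put ''stop'' (Const 0) one)
          (Put ''y'' (Const 0) (Minus (var ''y'') one) ;;
           IfElse (Equal (Cell ''mark'' (var ''y'')) one) (Put ''stop'' (Const 0) one)
            (Put ''mark'' (var ''y'') one ;;
             Put ''w'' (Const 0) (Minus (Plus (Cell ''fst'' (var ''y'')) (Cell ''snd'' (var ''y''))) (var ''w'')) ;;
             Put ''want'' (Const 0) (Minus (Plus (var ''del'') (var ''bet'')) (var ''want''))))"
  let ?L2 = "IfElse (Equal (var ''stop'') (Const 0)) (?P1 ;; ?P2) Pass"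
  define s1 where "s1 = sem (Repeat ''j'' ?L1) s"
  define s2 where "s2 = put ''stop'' 0 0 (put ''want'' 0 a (put ''w'' 0 v s1))"
  have m: "get s ''m'' 0 = m" using s by (simp add: graph_def)
  have fr1: "get s1 y = get s y" if "y \<notin> {''j'', ''mark''}" for y
    unfolding s1_def by (rule sem_frame) (use that in auto)
  have fr: "get s2 y = get s y" if "y \<notin> {''j'', ''mark'', ''stop'', ''want'', ''w''}" for y
    using that fr1[of y] by (simp add: s2_def)
  have b0: "0 < b" using v(3) by (simp add: miss_iff)
  have 1: "\<forall>j<m. get s1 ''mark'' j = 0"
    unfolding s1_def
    using Repeat_invariant[where I = "\<lambda>i t. \<forall>j<i. get t ''mark'' j = 0" and x = "''j''" and c = ?L1 and s = s] m
    by (fastforce simp: get_put_if less_Suc_eq)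
  define I where "I = (\<lambda>i t. get t ''stop'' 0 = 1 \<and> kempe (col s) a b v (marks t) (get t ''w'' 0) \<or>
    get t ''stop'' 0 = 0 \<and> explored (col s) a b v (marks t) (get t ''w'' 0) (get t ''want'' 0) \<and>
      (\<exists>e<m. inc e (get t ''w'' 0)) \<and> i \<le> card (marks t))"
  have "I (get s2 ''m'' 0) (sem (Repeat ''j'' ?L2) s2)"
  proof (rule Repeat_invariant)
    have "marks (put ''j'' 0 0 s2) = {}" using 1 by (auto simp: marks_def s2_def)
    then show "I 0 (put ''j'' 0 0 s2)" using explored_start[OF v(3), of a] v(2) by (simp add: I_def s2_def)
  next
    fix i t assume i: "i < get s2 ''m'' 0" "get t ''j'' 0 = i"
      and t: "\<And>y. y \<notin> insert ''j'' (writes ?L2) \<Longrightarrow> get t y = get s2 y" and I: "I i t"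
    have t': "get t y = get s y" if "y \<notin> {''j'', ''mark'', ''stop'', ''want'', ''w'', ''y''}" for y
      using t[of y] fr[of y] that by simp
    have im: "i < m" using i fr[of "''m''"] m by simp
    have dl: "get t ''del'' 0 = a" "get t ''bet'' 0 = b" using t' ab by auto
    have pq: "get t ''fst'' e = p e" "get t ''snd'' e = q e" if "e < m" for e
      using s t'[of "''fst''"] t'[of "''snd''"] that by (auto simp: graph_def)
    have mk: "marks (put ''j'' 0 x t) = marks t" for x t by (simp add: marks_def)
    show "I (Suc i) (put ''j'' 0 (Suc i) (sem ?L2 t))"
    proof (cases "get t ''stop'' 0 = 0")
      case False
      then show ?thesis using I by (auto simp: I_def mk)
    next
      case True
      define n w where "n = get t ''want'' 0" and "w = get t ''w'' 0"
      have X: "explored (col s) a b v (marks t) w n" "\<exists>e<m. inc e w" "i \<le> card (marks t)"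
        using I True by (auto simp: I_def n_def w_def)
      have n: "n = a \<or> n = b" using X by (auto simp: explored_def)
      define t1 where "t1 = sem ?P1 t"
      have t1: "get t1 y = get t y" if "y \<noteq> ''y''" for y using that by (simp add: t1_def)
      have mt1: "marks t1 = marks t" using t1[of "''mark''"] by (simp add: marks_def)
      have Y: "get t1 ''y'' 0 = 0 \<and> (\<forall>e<m. inc e w \<longrightarrow> col s e \<noteq> n) \<or>
          (\<exists>e<m. get t1 ''y'' 0 = Suc e \<and> inc e w \<and> col s e = n)"
      proof (cases "n = a")
        case n: True
        then have "get t1 ''y'' 0 = get s ''na'' w" using dl t'[of "''na''"] by (simp add: t1_def n_def w_def)
        then show ?thesis using na X(2) n unfolding is_table_def by metis
      next
        case False
        then have "get t1 ''y'' 0 = get s ''nb'' w" using dl t'[of "''nb''"] by (simp add: t1_def n_def w_def)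
        then show ?thesis using nb X(2) False n unfolding is_table_def by metis
      qed
      have L2: "sem ?L2 t = sem ?P2 t1" using True by (simp add: t1_def)
      consider (none) "get t1 ''y'' 0 = 0" "\<forall>e<m. inc e w \<longrightarrow> col s e \<noteq> n"
        | (some) e where "e < m" "get t1 ''y'' 0 = Suc e" "inc e w" "col s e = n" using Y by metis
      then show ?thesis
      proof cases
        case none
        have "kempe (col s) a b v (marks t) w" by (rule explored_stop[OF X(1)]) (use none in auto)
        moreover have "sem ?L2 t = put ''stop'' 0 1 t1" using L2 none by simp
        moreover have "get t1 ''w'' 0 = w" using t1 by (simp add: w_def)
        moreover have "marks (put ''stop'' 0 1 t1) = marks t" using mt1 by (simp add: marks_def)
        ultimately show ?thesis by (simp add: I_def mk)
      next
        case some
        show ?thesis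
        proof (cases "e \<in> marks t")
          case True
          have "f \<in> marks t" if "f \<in> {..<m}" "inc f w" "col s f = n" for f
          proof -
            have "f = e" using c(1) that some n ab(3) b0 unfolding proper_def by (metis lessThan_iff less_irrefl)
            then show ?thesis using True by simp
          qed
          then have "kempe (col s) a b v (marks t) w" by (intro explored_stop[OF X(1)])
          moreover have "sem ?L2 t = put ''stop'' 0 1 (put ''y'' 0 e t1)"
            using L2 some True t1[of "''mark''"] by (simp add: marks_def)
          moreover have "get t1 ''w'' 0 = w" using t1 by (simp add: w_def)
          moreover have "marks (put ''stop'' 0 1 (put ''y'' 0 e t1)) = marks t" using mt1 by (simp add: marks_def)
          ultimately show ?thesis by (simp add: I_def mk)
        next
          case False
          let ?t = "put ''want'' 0 (a + b - n) (put ''w'' 0 (p e + q e - w) (put ''mark'' e 1 (put ''y'' 0 e t1)))"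
          have nm: "get t1 ''mark'' e \<noteq> 1" using False some mt1 by (auto simp: marks_def)
          then have st: "sem ?L2 t = ?t"
            using L2 some t1 pq[OF some(1)] dl by (simp add: n_def w_def)
          have j: "joins e w (p e + q e - w)" using some(3) by (rule inc_joins_sum)
          have "col s e \<noteq> 0" using some n ab(3) b0 by auto
          \<comment> \<open>Every coloured edge has two distinct ends, so the walk does not stay at
            \<open>w\<close>.\<close>
          then have "w \<noteq> p e + q e - w" using joins_neq[OF j] c(2) some(1) by (auto simp: links_def)
          then have "explored (col s) a b v (insert e (marks t)) (p e + q e - w) (a + b - n)"
            using explored_step[OF X(1) c(1) ab(3) b0 ab(4) _ False some(4) j] some(1) by simp
          moreover have mkt: "marks ?t = insert e (marks t)" using some(1) mt1 by (auto simp: marks_def get_put_if)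
          moreover have "card (insert e (marks t)) = Suc (card (marks t))"
            using False by (intro card_insert_disjoint) (auto simp: marks_def)
          moreover have "\<exists>e<m. inc e (p e + q e - w)" using joins_inc(2)[OF j] some(1) by blast
          moreover have "get ?t ''stop'' 0 = 0" using t1[of "''stop''"] \<open>get t ''stop'' 0 = 0\<close> by simp
          ultimately show ?thesis using X(3) joins_inc(2)[OF j] some(1) unfolding st by (auto simp: I_def mk)
        qed
      qed
    qed
  qed auto
  then have I: "I m (sem walk s)" using fr[of "''m''"] m fr1[of "''v''"] fr1[of "''del''"] ab v
    by (simp add: walk_def s2_def s1_def)
  then show ?thesis
  proof (cases "get (sem walk s) ''stop'' 0 = 0")
    case True
    let ?K = "marks (sem walk s)"
    have X: "explored (col s) a b v ?K (get (sem walk s) ''w'' 0) (get (sem walk s) ''want'' 0)" "m \<le> card ?K"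
      using I True by (auto simp: I_def)
    have "?K \<subseteq> {..<m}" by (auto simp: marks_def)
    then have "?K = {..<m}" using X(2) by (intro card_seteq) auto
    then show ?thesis by (intro explored_stop[OF X(1)]) auto
  qed (simp add: I_def)
qed

lemma swap_marked_swaps:
  assumes s: "get s ''m'' 0 = m"
  shows "get (sem swap_marked s) ''c'' = swap (get s ''del'' 0) (get s ''bet'' 0) (marks s) (col s)"
proof -
  let ?L = "IfElse (Equal (Cell ''mark'' (var ''j'')) one)
       (IfElse (Equal (Cell ''c'' (var ''j'')) (var ''bet''))
          (Put ''c'' (var ''j'') (var ''del'')) (Put ''c'' (var ''j'') (var ''bet''))) Pass"
  define I where "I = (\<lambda>i t. col t = swap (get s ''del'' 0) (get s ''bet'' 0) {e\<in>marks s. e < i} (col s))"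
  have "I (get s ''m'' 0) (sem (Repeat ''j'' ?L) s)"
  proof (rule Repeat_invariant)
    show "I 0 (put ''j'' 0 0 s)" by (simp add: I_def swap_def fun_eq_iff)
  next
    fix i t assume i: "i < get s ''m'' 0" "get t ''j'' 0 = i"
      and t: "\<And>y. y \<notin> insert ''j'' (writes ?L) \<Longrightarrow> get t y = get s y" and I: "I i t"
    have f: "get t ''mark'' = get s ''mark''" "get t ''bet'' = get s ''bet''" "get t ''del'' = get s ''del''"
      using t by auto
    have c: "col t e = swap (get s ''del'' 0) (get s ''bet'' 0) {e\<in>marks s. e < i} (col s) e" for e
      using I by (simp add: I_def)
    have "col (put ''j'' 0 (Suc i) (sem ?L t)) e =
        swap (get s ''del'' 0) (get s ''bet'' 0) {e\<in>marks s. e < Suc i} (col s) e" for e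
      using i s f c[of e] c[of i] by (auto simp: swap_def marks_def get_put_if less_Suc_eq)
    then show "I (Suc i) (put ''j'' 0 (Suc i) (sem ?L t))" unfolding I_def by blast
  qed auto
  moreover have "{e\<in>marks s. e < m} = marks s" by (auto simp: marks_def)
  ultimately show ?thesis using s by (simp add: I_def swap_marked_def)
qed

lemma kempe_cmd_swaps:
  assumes s: "graph s" and c: "proper (col s)" "\<forall>e<m. col s e \<noteq> 0 \<longrightarrow> p e \<noteq> q e"
    and ab: "a = get s ''del'' 0" "b = get s ''bet'' 0" "0 < a" "a \<noteq> b"
    and v: "v = get s ''v'' 0" "\<exists>e<m. inc e v" "b \<in> miss k (col s) v"
  shows "\<exists>K. kempe (col s) a b v K (get (sem kempe_cmd s) ''w'' 0) \<and>
    col (sem kempe_cmd s) = swap a b K (col s)"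
proof -
  define s1 where "s1 = sem (edge_table ''na'' ''del'') s"
  define s2 where "s2 = sem (edge_table ''nb'' ''bet'') s1"
  define s3 where "s3 = sem walk s2"
  have f1: "get s1 y = get s y" if "y \<notin> {''j'', ''na''}" for y
    unfolding s1_def by (rule sem_frame) (use that in simp)
  have f2: "get s2 y = get s1 y" if "y \<notin> {''j'', ''nb''}" for y
    unfolding s2_def by (rule sem_frame) (use that in simp)
  have f3: "get s3 y = get s2 y" if "y \<notin> {''j'', ''mark'', ''w'', ''want'', ''stop'', ''y''}" for y
    unfolding s3_def by (rule sem_frame) (use that in simp)
  have g1: "graph s1" "graph s2" "get s3 ''m'' 0 = m"
    using s f1 f2 f3 graph_cong[of s1 s] graph_cong[of s2 s1] by (simp_all add: graph_def)
  have "is_table ''na'' (get s ''del'' 0) (col s) s1"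
    unfolding s1_def by (rule edge_table_is_table[OF s]) auto
  then have na: "is_table ''na'' a (col s2) s2" using f1 f2 ab by (simp add: is_table_def)
  have "is_table ''nb'' (get s1 ''bet'' 0) (col s1) s2"
    unfolding s2_def by (rule edge_table_is_table[OF g1(1)]) auto
  then have nb: "is_table ''nb'' b (col s2) s2" using f1 f2 ab by (simp add: is_table_def)
  have c2: "col s2 = col s" using f1 f2 by simp
  have K: "kempe (col s) a b v (marks s3) (get s3 ''w'' 0)"
    unfolding c2[symmetric] s3_def
    by (rule walk_explores[OF g1(2), where k = k]) (use na nb c2 c ab v f1 f2 in simp_all)
  have kc: "sem kempe_cmd s = sem swap_marked s3" by (simp add: kempe_cmd_def s3_def s2_def s1_def)
  have "col (sem kempe_cmd s) = swap (get s3 ''del'' 0) (get s3 ''bet'' 0) (marks s3) (col s3)"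
    unfolding kc by (rule swap_marked_swaps[OF g1(3)])
  moreover have "get s3 ''del'' 0 = a" "get s3 ''bet'' 0 = b" "col s3 = col s" using ab f1 f2 f3 by auto
  moreover have "get (sem kempe_cmd s) ''w'' = get s3 ''w''" unfolding kc by (rule sem_frame) simp
  ultimately show ?thesis using K by auto
qed

end

section \<open>Correctness of the program\<close>

lemma get_put_same: "get (put x i v s) x = (get s x)(i := v)"
  by (simp add: put_def)

section \<open>State invariants and operations that close the hole\<close>

text \<open>An abstract view of \<open>gamma_l'\<close>: \<open>gam\<close> occurs only in
  assertions, never in the program. Since \<open>gam_good\<close> speaks of all \<open>k\<close>
  from \<open>gam\<close> upwards, refuting \<open>good k\<close> shows \<open>k < gam\<close>;
  \<open>gam_loop\<close> plays this part for the greedy colouring of loops.\<close>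

locale bounded_edge_memory = edge_memory +
  fixes gam :: nat
  assumes gam_good: "gam \<le> k \<Longrightarrow> good k"
    and gam_loop: "e < m \<Longrightarrow> p e = q e \<Longrightarrow> card {i. i < m \<and> inc i (p e)} \<le> gam"
begin

text \<open>The last conjunct keeps the number of colours at most \<open>m\<close>, the length of
  the colour tables, independently of how large \<open>gam\<close> is.\<close>

definition finished :: "nat set \<Rightarrow> store \<Rightarrow> bool" where
  "finished S s \<longleftrightarrow> graph s \<and> coloured S (ncol s) (col s) \<and> ncol s \<le> gam \<and> ncol s \<le> card S"

text \<open>The final inequality is strict because \<open>S\<close> counts the uncoloured hole; this
  leaves room for one fresh colour.\<close>

definition pending :: "nat set \<Rightarrow> store \<Rightarrow> bool" where
  "pending S s \<longleftrightarrow> graph s \<and> holed S (ncol s) (col s) (get s ''h'' 0) (get s ''v'' 0) (get s ''r'' 0) \<and>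
     ncol s \<le> gam \<and> ncol s < card S"

definition child :: "store \<Rightarrow> nat \<Rightarrow> nat \<Rightarrow> bool" where
  "child s e x \<longleftrightarrow> e < m \<and> joins e (get s ''v'' 0) x \<and> col s e \<in> free s (get s ''r'' 0)"

abbreviation success :: "nat set \<Rightarrow> store \<Rightarrow> bool" where
  "success S s \<equiv> finished S s \<and> get s ''done'' 0 = 1"

lemma pending_cong:
  assumes "get t ''m'' = get s ''m''" "get t ''fst'' = get s ''fst''" "get t ''snd'' = get s ''snd''" "get t ''c'' = get s ''c''"
    "get t ''k'' = get s ''k''" "get t ''h'' = get s ''h''" "get t ''v'' = get s ''v''" "get t ''r'' = get s ''r''"
  shows "pending S t \<longleftrightarrow> pending S s"
  using assms graph_cong[of t s] by (simp add: pending_def)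

lemma child_cong:
  assumes "get t ''c'' = get s ''c''" "get t ''k'' = get s ''k''" "get t ''v'' = get s ''v''" "get t ''r'' = get s ''r''"
  shows "child t e x \<longleftrightarrow> child s e x"
  using assms by (simp add: child_def)

lemma pendingD:
  assumes "pending S s"
  shows "graph s" "get s ''m'' 0 = m" "ncol s \<le> m"
    "holed S (ncol s) (col s) (get s ''h'' 0) (get s ''v'' 0) (get s ''r'' 0)"
proof -
  show s: "graph s" "holed S (ncol s) (col s) (get s ''h'' 0) (get s ''v'' 0) (get s ''r'' 0)"
    using assms by (auto simp: pending_def)
  show "get s ''m'' 0 = m" using s(1) by (simp add: graph_def)
  have "S \<subseteq> {..<m}" using holedD(6)[OF s(2)] links_subset by blast
  then have "card S \<le> m" using card_mono[of "{..<m}" S] by simp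
  then show "ncol s \<le> m" using assms by (simp add: pending_def)
qed

lemma childD:
  assumes "pending S s" "child s e x"
  shows "e \<in> {..<m}" "joins e (get s ''v'' 0) x" "col s e \<in> free s (get s ''r'' 0)"
    "x \<noteq> get s ''v'' 0" "x \<noteq> get s ''r'' 0"
  using assms move_hole(4,5)[OF pendingD(4)[OF assms(1)], of e x] by (auto simp: child_def)

lemma fresh_finished:
  assumes "graph s" "coloured S (ncol s) (col s)" "get s ''h'' 0 < m" "get s ''h'' 0 \<notin> S"
    "ncol s < gam" "ncol s \<le> card S"
  shows "success (insert (get s ''h'' 0) S) (sem fresh s)"
proof -
  have "finite S" using coloured_subset[OF assms(2)] finite_subset by blast
  moreover have "graph (sem fresh s)" using assms(1) graph_cong[of "sem fresh s" s] by (simp add: sem_frame)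
  moreover have "ncol (sem fresh s) = Suc (ncol s)" "col (sem fresh s) = (col s)(get s ''h'' 0 := Suc (ncol s))"
    "get (sem fresh s) ''done'' 0 = 1"
    by (simp_all add: fresh_def finish_def get_put_same)
  ultimately show ?thesis
    using fresh_colour[OF assms(2), of "get s ''h'' 0"] assms by (simp add: finished_def)
qed

lemma fresh_success:
  assumes s: "pending S s" and k: "\<not> good (ncol s)"
  shows "success S (sem fresh s)"
proof -
  note h = holedD[OF pendingD(4)[OF s]]
  have fin: "finite S" using h(6) finite_links finite_subset by blast
  have "success (insert (get s ''h'' 0) (S - {get s ''h'' 0})) (sem fresh s)"
  proof (rule fresh_finished)
    show "ncol s < gam" using k gam_good by (meson not_less)
    have "ncol s < card S" using s by (simp add: pending_def)
    then show "ncol s \<le> card (S - {get s ''h'' 0})" using h(5) fin by simp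
  qed (use s h(4) in \<open>auto simp: pending_def holed_def\<close>)
  then show ?thesis using h(5) by (simp add: insert_absorb)
qed

lemma finish_success:
  assumes s: "pending S s" and a: "a \<noteq> ''c''"
    and t: "get s a 0 \<in> free s (get s ''v'' 0)" "get s a 0 \<in> free s (get s ''r'' 0)"
  shows "success S (sem (finish a) s)"
proof -
  have "graph (sem (finish a) s)" using pendingD(1)[OF s] graph_cong[of "sem (finish a) s" s] by (simp add: sem_frame)
  moreover have "ncol (sem (finish a) s) = ncol s" by (simp add: sem_frame)
  moreover have "col (sem (finish a) s) = (col s)(get s ''h'' 0 := get s a 0)"
    "get (sem (finish a) s) ''done'' 0 = 1" by (simp_all add: finish_def get_put_same)
  ultimately show ?thesis
    using colour_hole[OF pendingD(4)[OF s] t] s by (simp add: finished_def pending_def)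
qed

lemma shift_success:
  assumes s: "pending S s" and c: "child s (get s f 0) x" and f: "f \<noteq> ''c''" and a: "a \<noteq> ''c''"
    and t: "get s a 0 \<in> free s (get s ''v'' 0)" "get s a 0 \<in> free s x"
  shows "success S (sem (shift f a) s)"
proof -
  note ch = childD[OF s c]
  have "graph (sem (shift f a) s)" using pendingD(1)[OF s] graph_cong[of "sem (shift f a) s" s] by (simp add: sem_frame)
  moreover have "ncol (sem (shift f a) s) = ncol s" by (simp add: sem_frame)
  moreover have "col (sem (shift f a) s) = (col s)(get s ''h'' 0 := col s (get s f 0), get s f 0 := get s a 0)"
    "get (sem (shift f a) s) ''done'' 0 = 1" using f a by (simp_all add: shift_def get_put_same)
  ultimately show ?thesis
    using shift_hole[OF pendingD(4)[OF s] ch(1,2,3) t] s by (simp add: finished_def pending_def)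
qed

text \<open>A fan edge whose far end misses \<open>''del''\<close> keeps its colour: that colour
  occurs at \<open>''v''\<close>, so it is not \<open>''bet''\<close>, and at the far end, so it is
  not \<open>''del''\<close>. Hence the edge is still a fan edge after the swap.\<close>

lemma kempe_cmd_result:
  assumes s: "pending S s" and b: "get s ''bet'' 0 \<in> free s (get s ''v'' 0)"
    and a: "get s ''del'' 0 \<in> {1..ncol s}" "get s ''del'' 0 \<notin> free s (get s ''v'' 0)"
  defines "s' \<equiv> sem kempe_cmd s"
  shows "pending S s'" "get s ''del'' 0 \<in> free s' (get s ''v'' 0)"
    "\<And>x. x \<noteq> get s ''v'' 0 \<Longrightarrow> x \<noteq> get s' ''w'' 0 \<Longrightarrow> get s ''del'' 0 \<in> free s x \<Longrightarrow> get s ''del'' 0 \<in> free s' x"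
    "\<And>e x. child s e x \<Longrightarrow> get s ''del'' 0 \<in> free s x \<Longrightarrow> child s' e x"
    "\<exists>K. kempe (col s) (get s ''del'' 0) (get s ''bet'' 0) (get s ''v'' 0) K (get s' ''w'' 0)"
    "\<And>y. y \<notin> {''j'', ''na'', ''nb'', ''mark'', ''w'', ''want'', ''stop'', ''y'', ''c''} \<Longrightarrow> get s' y = get s y"
proof -
  let ?a = "get s ''del'' 0" and ?b = "get s ''bet'' 0" and ?v = "get s ''v'' 0" and ?r = "get s ''r'' 0"
  note H = pendingD(4)[OF s]
  note h = holedD[OF H]
  show fr: "\<And>y. y \<notin> {''j'', ''na'', ''nb'', ''mark'', ''w'', ''want'', ''stop'', ''y'', ''c''} \<Longrightarrow> get s' y = get s y"
    unfolding s'_def by (rule sem_frame) simp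
  have ab: "0 < ?a" "?a \<le> ncol s" "?a \<noteq> ?b" using a b by auto
  have "\<exists>K. kempe (col s) ?a ?b ?v K (get s' ''w'' 0) \<and> col s' = swap ?a ?b K (col s)"
    unfolding s'_def
  proof (rule kempe_cmd_swaps[OF pendingD(1)[OF s] h(1) _ refl refl ab(1,3) refl _ b])
    show "\<forall>e<m. col s e \<noteq> 0 \<longrightarrow> p e \<noteq> q e" using h(3,6) by (auto simp: links_def)
    show "\<exists>e<m. inc e ?v" using h(4,10) by auto
  qed
  then obtain K where K: "kempe (col s) ?a ?b ?v K (get s' ''w'' 0)" "col s' = swap ?a ?b K (col s)" by blast
  note sw = kempe_swap[OF H ab b K(1), folded K(2)]
  have n: "ncol s' = ncol s" "get s' ''v'' = get s ''v''" "get s' ''r'' = get s ''r''" "get s' ''h'' = get s ''h''"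
    using fr by auto
  show "pending S s'" using s sw(1) fr graph_cong[of s' s] by (simp add: pending_def)
  show "?a \<in> free s' ?v" using sw(2) n by simp
  show "\<And>x. x \<noteq> ?v \<Longrightarrow> x \<noteq> get s' ''w'' 0 \<Longrightarrow> ?a \<in> free s x \<Longrightarrow> ?a \<in> free s' x" using sw(3) n by simp
  show "\<exists>K. kempe (col s) ?a ?b ?v K (get s' ''w'' 0)" using K by blast
  fix e x assume c: "child s e x" and x: "?a \<in> free s x"
  note ch = childD[OF s c]
  have "col s e \<noteq> ?b" using b ch(1) joins_inc(1)[OF ch(2)] by (auto simp: miss_iff)
  moreover have "col s e \<noteq> ?a" using x ch(1) joins_inc(2)[OF ch(2)] by (auto simp: miss_iff)
  ultimately have "col s' e = col s e" "col s e \<in> free s' ?r" using sw(4,5) n ch(3) by auto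
  then show "child s' e x" using ch n by (simp add: child_def)
qed

section \<open>Correctness of the fan search\<close>

lemma test_child_result:
  assumes s: "pending S s" and names: "(f, x, A) \<in> {(''f'', ''x'', ''X''), (''g'', ''z'', ''Z'')}"
    and c: "child s (get s f 0) (get s x 0)"
    and V: "shows_free ''V'' (get s ''v'' 0) s" and R: "shows_free ''R'' (get s ''r'' 0) s"
    and b: "get s ''bet'' 0 \<in> free s (get s ''v'' 0)"
    and VR: "free s (get s ''v'' 0) \<inter> free s (get s ''r'' 0) = {}"
  defines "s' \<equiv> sem (test_child f x A) s"
  shows "success S s' \<or> (\<forall>y. y \<notin> {''j'', ''found'', ''pick'', A} \<longrightarrow> get s' y = get s y) \<and>
    shows_free A (get s x 0) s' \<and> free s (get s ''v'' 0) \<inter> free s (get s x 0) = {} \<and>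
    free s (get s ''r'' 0) \<inter> free s (get s x 0) = {}"
proof -
  let ?v = "get s ''v'' 0" and ?r = "get s ''r'' 0" and ?x = "get s x 0"
  have ne: "f \<noteq> ''j''" "f \<noteq> ''found''" "f \<noteq> ''pick''" "f \<noteq> ''c''" "f \<noteq> ''del''" "f \<noteq> ''na''" "f \<noteq> ''nb''" "f \<noteq> ''mark''" "f \<noteq> ''w''" "f \<noteq> ''want''" "f \<noteq> ''stop''" "f \<noteq> ''y''"
    "x \<noteq> ''j''" "x \<noteq> ''found''" "x \<noteq> ''pick''" "x \<noteq> ''c''" "x \<noteq> ''del''" "x \<noteq> ''na''" "x \<noteq> ''nb''" "x \<noteq> ''mark''" "x \<noteq> ''w''" "x \<noteq> ''want''" "x \<noteq> ''stop''" "x \<noteq> ''y''"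
    "''j'' \<noteq> A" "''m'' \<noteq> A" "''fst'' \<noteq> A" "''snd'' \<noteq> A" "''c'' \<noteq> A" "''k'' \<noteq> A" "''h'' \<noteq> A" "''v'' \<noteq> A" "''r'' \<noteq> A" "''V'' \<noteq> A" "''R'' \<noteq> A" "''bet'' \<noteq> A" "''found'' \<noteq> A" "''pick'' \<noteq> A"
    "x \<noteq> A" "f \<noteq> A"
    using names by auto
  define s1 where "s1 = sem (fill A x) s"
  define s2 where "s2 = sem (common ''V'' A) s1"
  define s3 where "s3 = sem (common ''R'' A) s2"
  define s4 where "s4 = put ''del'' 0 (get s3 ''pick'' 0) s3"
  define s5 where "s5 = sem kempe_cmd s4"
  have f1: "get s1 y = get s y" if "y \<notin> {''j'', A}" for y
    unfolding s1_def by (rule sem_frame) (use that in simp)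
  have f2: "get s2 y = get s y" if "y \<notin> {''j'', ''found'', ''pick'', A}" for y
    unfolding s2_def using f1[of y] that by (subst sem_frame) auto
  have f3: "get s3 y = get s y" if "y \<notin> {''j'', ''found'', ''pick'', A}" for y
    unfolding s3_def using f2[of y] that by (subst sem_frame) auto
  have A1: "shows_free A ?x s1" unfolding s1_def
    by (rule fill_shows_free) (use pendingD[OF s] ne in auto)
  have "get s2 A = get s1 A" "get s3 A = get s2 A" unfolding s2_def s3_def using ne by (auto intro!: sem_frame)
  then have A23: "get s2 A = get s1 A" "get s3 A = get s1 A" by auto
  have free1: "free s1 = free s" and free2: "free s2 = free s" and free3: "free s3 = free s"
    using f1 f2 f3 ne by simp_all
  have A2: "shows_free A ?x s2" and A3: "shows_free A ?x s3"
    using A1 A23 f1 f2 f3 ne shows_free_cong[of s2 A s1] shows_free_cong[of s3 A s1] by simp_all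
  have V1: "shows_free ''V'' ?v s1" and R2: "shows_free ''R'' ?r s2"
    using V R f1 f2 ne shows_free_cong[of s1 "''V''" s] shows_free_cong[of s2 "''R''" s] by simp_all
  have p2: "pending S s2" using s pending_cong[of s2 s S] f2 ne by simp
  have c2: "child s2 (get s2 f 0) ?x" using c f2 ne child_cong[of s2 s] by simp
  have m1: "get s1 ''m'' 0 = m" "ncol s1 \<le> m" "get s2 ''m'' 0 = m" "ncol s2 \<le> m"
    using pendingD[OF s] f1 f2 ne by simp_all
  have An: "A \<notin> {''j'', ''found'', ''pick''}" using ne by auto
  consider (both) "get s2 ''found'' 0 = 1" "get s2 ''pick'' 0 \<in> free s ?v" "get s2 ''pick'' 0 \<in> free s ?x"
    | (disj) "get s2 ''found'' 0 = 0" "free s ?v \<inter> free s ?x = {}"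
    unfolding s2_def by (rule common_result[OF m1(1,2) V1 _ A1 An]) (auto simp: free1)
  then show ?thesis
  proof cases
    case both
    have "success S (sem (shift f ''pick'') s2)"
      by (rule shift_success[OF p2 c2]) (use both f2 ne free2 in simp_all)
    then show ?thesis using both by (simp add: s'_def test_child_def s2_def s1_def)
  next
    case disj
    note d = disj
    consider (both) "get s3 ''found'' 0 = 1" "get s3 ''pick'' 0 \<in> free s ?r" "get s3 ''pick'' 0 \<in> free s ?x"
      | (disj) "get s3 ''found'' 0 = 0" "free s ?r \<inter> free s ?x = {}"
      unfolding s3_def by (rule common_result[OF m1(3,4) R2 _ A2 An]) (auto simp: free2)
    then show ?thesis
    proof cases
      case both
      let ?a = "get s3 ''pick'' 0"
      have f4: "get s4 y = get s y" if "y \<notin> {''j'', ''found'', ''pick'', ''del'', A}" for y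
        using f3[of y] that by (simp add: s4_def)
      have p4: "pending S s4" using s pending_cong[of s4 s S] f4 ne by simp
      have fr4: "col s4 = col s" "get s4 ''v'' 0 = ?v" "get s4 ''r'' 0 = ?r"
        "get s4 ''bet'' 0 = get s ''bet'' 0" "ncol s4 = ncol s" "get s4 f 0 = get s f 0" "get s4 ''del'' 0 = ?a"
        using f4 ne by simp_all (simp add: s4_def)
      have c4: "child s4 (get s f 0) ?x" using c f4 ne child_cong[of s4 s] by simp
      \<comment> \<open>By \<open>VR\<close> the colour is not missing at \<open>?v\<close>, so it
        differs from \<open>''bet''\<close>.\<close>
      have a: "?a \<in> {1..ncol s}" "?a \<notin> free s ?v" using both VR by (auto simp: miss_def)
      note K = kempe_cmd_result[OF p4, folded s5_def, unfolded fr4, OF b a]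
      have v5: "get s5 ''v'' 0 = ?v" "get s5 ''r'' 0 = ?r" "get s5 ''del'' 0 = ?a" "get s5 f 0 = get s f 0"
        using K(6) fr4 ne by simp_all
      have rx: "?r \<noteq> ?v" "?x \<noteq> ?v" "?x \<noteq> ?r"
        using childD(4,5)[OF s c] holedD(9)[OF pendingD(4)[OF s]] by auto
      have e: "s' = (if get s5 ''w'' 0 = get s5 ''r'' 0 then sem (shift f ''del'') s5 else sem (finish ''del'') s5)"
        using d both by (simp add: s'_def test_child_def s1_def[symmetric] s2_def[symmetric] s3_def[symmetric]
            s4_def[symmetric] s5_def[symmetric])
      show ?thesis
      proof (cases "get s5 ''w'' 0 = ?r")
        case True
        have "success S (sem (shift f ''del'') s5)"
          by (rule shift_success[OF K(1), of f ?x]) (use K(2) K(3)[of ?x] K(4)[OF c4] True both rx v5 ne in auto)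
        then show ?thesis using e True v5 by simp
      next
        case False
        have "success S (sem (finish ''del'') s5)"
          by (rule finish_success[OF K(1)]) (use K(2) K(3)[of ?r] False both rx v5 in auto)
        then show ?thesis using e False v5 by simp
      qed
    next
      case disj
      then have "s' = s3" using d by (simp add: s'_def test_child_def s1_def[symmetric] s2_def[symmetric] s3_def[symmetric])
      then show ?thesis using f3 A3 d(2) disj(2) by blast
    qed
  qed
qed

text \<open>There is no failing outcome: if no two of the four missing sets meet,
  \<open>three_fan\<close> refutes \<open>good\<close>, and a fresh colour is legitimate.\<close>

lemma third_child_success:
  assumes s: "pending S s" and d: "get s ''done'' 0 = 0"
    and c: "child s (get s ''f'' 0) (get s ''x'' 0)"
    and V: "shows_free ''V'' (get s ''v'' 0) s" and R: "shows_free ''R'' (get s ''r'' 0) s"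
    and X: "shows_free ''X'' (get s ''x'' 0) s"
    and b: "get s ''bet'' 0 \<in> free s (get s ''v'' 0)"
    and VR: "free s (get s ''v'' 0) \<inter> free s (get s ''r'' 0) = {}"
    and VX: "free s (get s ''v'' 0) \<inter> free s (get s ''x'' 0) = {}"
    and RX: "free s (get s ''r'' 0) \<inter> free s (get s ''x'' 0) = {}"
    and e: "get s ''at'' (get s ''pick'' 0) = Suc e" "get s ''ot'' (get s ''pick'' 0) = z"
      "child s e z" "z \<noteq> get s ''x'' 0"
  shows "success S (sem third_child s)"
proof -
  let ?v = "get s ''v'' 0" and ?r = "get s ''r'' 0" and ?x = "get s ''x'' 0"
  define s1 where "s1 = put ''z'' 0 z (put ''g'' 0 e s)"
  define s2 where "s2 = sem (test_child ''g'' ''z'' ''Z'') s1"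
  define s3 where "s3 = sem (common ''X'' ''Z'') s2"
  define s4 where "s4 = put ''del'' 0 (get s3 ''pick'' 0) s3"
  define s5 where "s5 = sem kempe_cmd s4"
  have f1: "get s1 y = get s y" if "y \<notin> {''g'', ''z''}" for y using that by (simp add: s1_def)
  have gz: "get s1 ''g'' 0 = e" "get s1 ''z'' 0 = z" by (simp_all add: s1_def)
  have p1: "pending S s1" using s pending_cong[of s1 s S] f1 by simp
  have c1: "child s1 e z" using e child_cong[of s1 s] f1 by simp
  have sh1: "shows_free ''V'' ?v s1" "shows_free ''R'' ?r s1"
    using V R f1 shows_free_cong[of s1 "''V''" s] shows_free_cong[of s1 "''R''" s] by simp_all
  have s': "sem third_child s = (if get s2 ''done'' 0 = 0 then
      (if get s3 ''found'' 0 = 1 then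
        (if get s5 ''w'' 0 = get s5 ''x'' 0 then sem (shift ''g'' ''del'') s5 else sem (shift ''f'' ''del'') s5)
       else sem fresh s3) else s2)"
    using e by (simp add: third_child_def s1_def[symmetric] s2_def[symmetric] s3_def[symmetric]
        s4_def[symmetric] s5_def[symmetric])
  have "success S s2 \<or> (\<forall>y. y \<notin> {''j'', ''found'', ''pick'', ''Z''} \<longrightarrow> get s2 y = get s1 y) \<and>
    shows_free ''Z'' z s2 \<and> free s ?v \<inter> free s z = {} \<and> free s ?r \<inter> free s z = {}"
    using test_child_result[OF p1, of "''g''" "''z''" "''Z''", folded s2_def] c1 sh1 b VR gz f1 by simp
  then consider (succ) "success S s2"
    | (disj) "\<And>y. y \<notin> {''j'', ''found'', ''pick'', ''Z''} \<Longrightarrow> get s2 y = get s1 y"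
      "shows_free ''Z'' z s2" "free s ?v \<inter> free s z = {}" "free s ?r \<inter> free s z = {}" by blast
  then show ?thesis
  proof cases
    case succ
    then show ?thesis using s' by simp
  next
    case disj
    have f2: "get s2 y = get s y" if "y \<notin> {''g'', ''z'', ''j'', ''found'', ''pick'', ''Z''}" for y
      using disj(1)[of y] f1[of y] that by simp
    have f3: "get s3 y = get s y" if "y \<notin> {''g'', ''z'', ''j'', ''found'', ''pick'', ''Z''}" for y
      unfolding s3_def using f2[of y] that by (subst sem_frame) auto
    have gz2: "get s2 ''g'' 0 = e" "get s2 ''z'' 0 = z" using disj(1) gz by simp_all
    have "get s3 ''g'' = get s2 ''g''" "get s3 ''z'' = get s2 ''z''" unfolding s3_def by (auto intro!: sem_frame)
    then have gz3: "get s3 ''g'' 0 = e" "get s3 ''z'' 0 = z" using gz2 by auto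
    have fr2: "free s2 = free s" using f2 by simp
    have X2: "shows_free ''X'' ?x s2" using X f2 shows_free_cong[of s2 "''X''" s] by simp
    have m2: "get s2 ''m'' 0 = m" "ncol s2 \<le> m" using pendingD[OF s] f2 by simp_all
    have p3: "pending S s3" using s pending_cong[of s3 s S] f3 by simp
    have xz: "?x \<noteq> ?v" "z \<noteq> ?v" "?x \<noteq> ?r" "z \<noteq> ?r"
      using childD(4,5)[OF s c] childD(4,5)[OF s e(3)] by auto
    have d2: "get s2 ''done'' 0 = 0" using f2 d by simp
    consider (both) "get s3 ''found'' 0 = 1" "get s3 ''pick'' 0 \<in> free s ?x" "get s3 ''pick'' 0 \<in> free s z"
      | (none) "get s3 ''found'' 0 = 0" "free s ?x \<inter> free s z = {}"
      unfolding s3_def by (rule common_result[OF m2 X2 _ disj(2)]) (auto simp: fr2)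
    then show ?thesis
    proof cases
      case both
      let ?a = "get s3 ''pick'' 0"
      have f4: "get s4 y = get s y" if "y \<notin> {''g'', ''z'', ''j'', ''found'', ''pick'', ''Z'', ''del''}" for y
        using f3[of y] that by (simp add: s4_def)
      have p4: "pending S s4" using s pending_cong[of s4 s S] f4 by simp
      have fr4: "col s4 = col s" "get s4 ''v'' 0 = ?v" "get s4 ''bet'' 0 = get s ''bet'' 0" "ncol s4 = ncol s"
        using f4 by simp_all
      have a4: "get s4 ''del'' 0 = ?a" "get s4 ''g'' 0 = e" "get s4 ''f'' = get s ''f''" "get s4 ''x'' = get s ''x''"
        using gz3 f4 by (simp_all add: s4_def)
      have c4: "child s4 (get s ''f'' 0) ?x" "child s4 e z"
        using c e(3) f4 child_cong[of s4 s] by simp_all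
      have a: "?a \<in> {1..ncol s}" "?a \<notin> free s ?v" using both VX by (auto simp: miss_def)
      note K = kempe_cmd_result[OF p4, folded s5_def, unfolded fr4 a4, OF b a]
      have v5: "get s5 ''v'' 0 = ?v" "get s5 ''del'' 0 = ?a" "get s5 ''f'' 0 = get s ''f'' 0"
        "get s5 ''g'' 0 = e" "get s5 ''x'' 0 = ?x"
        using K(6) fr4 a4 by simp_all
      show ?thesis
      proof (cases "get s5 ''w'' 0 = ?x")
        case True
        have "success S (sem (shift ''g'' ''del'') s5)"
          by (rule shift_success[OF K(1), of _ z]) (use K(2) K(3)[of z] K(4)[OF c4(2)] True both xz e v5 in auto)
        then show ?thesis using s' d2 both True v5 by simp
      next
        case False
        have "success S (sem (shift ''f'' ''del'') s5)"
          by (rule shift_success[OF K(1), of _ ?x]) (use K(2) K(3)[of ?x] K(4)[OF c4(1)] False both xz v5 in auto)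
        then show ?thesis using s' d2 both False v5 by simp
      qed
    next
      case none
      have "\<not> good (ncol s)"
        by (rule three_fan[OF pendingD(4)[OF s] childD(1,2)[OF s c] xz(3,1) childD(1,2)[OF s e(3)] xz(4) e(4) xz(2)])
          (use VR VX RX disj none in auto)
      then have "success S (sem fresh s3)" using f3 by (intro fresh_success[OF p3]) simp
      then show ?thesis using s' d2 none by simp
    qed
  qed
qed

text \<open>Disjointness survives the change of root. The colour of the old fan edge leaves the
  missing set of the old root and enters that of the new one, and it occurs at
  \<open>''v''\<close>.\<close>

lemma reroot_third_success:
  assumes s: "pending S s" and d: "get s ''done'' 0 = 0"
    and c: "child s (get s ''f'' 0) (get s ''x'' 0)"
    and V: "shows_free ''V'' (get s ''v'' 0) s"
    and b: "get s ''bet'' 0 \<in> free s (get s ''v'' 0)"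
    and VR: "free s (get s ''v'' 0) \<inter> free s (get s ''r'' 0) = {}"
    and VX: "free s (get s ''v'' 0) \<inter> free s (get s ''x'' 0) = {}"
    and RX: "free s (get s ''r'' 0) \<inter> free s (get s ''x'' 0) = {}"
    and e: "get s ''at'' (get s ''pick'' 0) = Suc e" "get s ''ot'' (get s ''pick'' 0) = z" "e < m"
      "joins e (get s ''v'' 0) z" "z \<noteq> get s ''x'' 0" "z \<noteq> get s ''r'' 0" "col s e \<in> free s (get s ''x'' 0)"
  shows "success S (sem third_child (sem reroot s))"
proof -
  let ?v = "get s ''v'' 0" and ?r = "get s ''r'' 0" and ?x = "get s ''x'' 0"
    and ?h = "get s ''h'' 0" and ?f = "get s ''f'' 0"
  let ?c = "(col s)(?h := col s ?f, ?f := 0)"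
  note H = pendingD(4)[OF s] and ch = childD[OF s c]
  note h = holedD[OF H] and mv = move_hole[OF H ch(1-3)] and ms = move_hole_miss[OF H ch(1-3)]
  define t where "t = put ''x'' 0 ?r (put ''r'' 0 ?x (put ''y'' 0 ?r
    (put ''f'' 0 ?h (put ''h'' 0 ?f (put ''y'' 0 ?h (put ''c'' ?f 0 (put ''c'' ?h (col s ?f) s)))))))"
  define t1 where "t1 = sem (fill ''R'' ''r'') t"
  define t2 where "t2 = sem (fill ''X'' ''x'') t1"
  have s': "sem reroot s = t2" by (simp add: reroot_def t2_def t1_def t_def)
  have f0: "get t y = get s y" if "y \<notin> {''x'', ''r'', ''y'', ''f'', ''h'', ''c''}" for y using that by (simp add: t_def)
  have v0: "col t = ?c" "get t ''x'' 0 = ?r" "get t ''r'' 0 = ?x" "get t ''f'' 0 = ?h" "get t ''h'' 0 = ?f"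
    by (simp_all add: t_def get_put_same)
  have f1: "get t1 y = get t y" if "y \<notin> {''R'', ''j''}" for y
    unfolding t1_def by (rule sem_frame) (use that in auto)
  have f2: "get t2 y = get t1 y" if "y \<notin> {''X'', ''j''}" for y
    unfolding t2_def by (rule sem_frame) (use that in auto)
  have f: "get t2 y = get s y" if "y \<notin> {''x'', ''r'', ''y'', ''f'', ''h'', ''c'', ''R'', ''X'', ''j''}" for y
    using f0[of y] f1[of y] f2[of y] that by simp
  have v2: "col t2 = ?c" "get t2 ''x'' 0 = ?r" "get t2 ''r'' 0 = ?x" "get t2 ''f'' 0 = ?h" "get t2 ''h'' 0 = ?f"
    "get t2 ''v'' 0 = ?v" "ncol t2 = ncol s" "get t2 ''bet'' 0 = get s ''bet'' 0"
    using v0 f1 f2 f by simp_all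
  have g: "graph t" "graph t1" "graph t2"
    using pendingD(1)[OF s] f0 f1 f graph_cong[of t s] graph_cong[of t1 t] graph_cong[of t2 s] by simp_all
  have p2: "pending S t2" using s mv(1) g(3) v2 by (simp add: pending_def)
  have k: "ncol t \<le> m" "ncol t1 \<le> m" using pendingD(3)[OF s] f0 f1 by simp_all
  have free: "free t2 ?v = free s ?v" "free t2 ?x = insert (col s ?f) (free s ?x)" "free t2 ?r = free s ?r - {col s ?f}"
    using v2 mv(3) ms by simp_all
  have R1: "shows_free ''R'' ?x t1"
    unfolding t1_def v0(3)[symmetric] by (rule fill_shows_free[OF g(1) k(1)]) auto
  have R: "shows_free ''R'' ?x t2" using R1 f2 shows_free_cong[of t2 "''R''" t1] by simp
  have "shows_free ''X'' (get t1 ''x'' 0) t2"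
    unfolding t2_def by (rule fill_shows_free[OF g(2) k(2)]) auto
  then have X: "shows_free ''X'' ?r t2" using f1 v0 by simp
  have V2: "shows_free ''V'' ?v t2" using V free(1) f[of "''V''"] v2 by (simp add: shows_free_def)
  have c0: "0 < col s ?f" "0 < col s e" using ch(3) e(7) by (auto simp: miss_iff)
  \<comment> \<open>The edge to the third vertex has a positive colour and does not lead to
    \<open>?x\<close>, so it is neither the old nor the new hole and keeps its colour.\<close>
  have eh: "e \<noteq> ?h" "e \<noteq> ?f" using c0 h(8) e(4,5) ch(2) joins_unique by auto
  have c1: "child t2 ?h ?r" using v2 free(2) h(4,7) mv(6) by (simp add: child_def)
  have c2: "child t2 e z" using e v2 free(2) eh by (simp add: child_def)
  have nV: "col s ?f \<notin> free s ?v" using ch(1) joins_inc(1)[OF ch(2)] by (auto simp: miss_iff)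
  show ?thesis
    unfolding s'
  proof (rule third_child_success[OF p2, where e = e and z = z])
    show "get t2 ''done'' 0 = 0" using f d by simp
  qed (use V2 R X c1 c2 b VR VX RX nV free f v2 e in auto)
qed

lemma grow_fan_result:
  assumes s: "pending S s" and d: "get s ''done'' 0 = 0"
    and c: "child s (get s ''f'' 0) (get s ''x'' 0)"
    and V: "shows_free ''V'' (get s ''v'' 0) s" and R: "shows_free ''R'' (get s ''r'' 0) s"
    and X: "shows_free ''X'' (get s ''x'' 0) s" and at: "shows_at (get s ''v'' 0) s"
    and b: "get s ''bet'' 0 \<in> free s (get s ''v'' 0)"
    and VR: "free s (get s ''v'' 0) \<inter> free s (get s ''r'' 0) = {}"
    and VX: "free s (get s ''v'' 0) \<inter> free s (get s ''x'' 0) = {}"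
    and RX: "free s (get s ''r'' 0) \<inter> free s (get s ''x'' 0) = {}"
  defines "s' \<equiv> sem grow_fan s"
  shows "success S s' \<or> (\<forall>y. y \<notin> {''j'', ''found'', ''pick''} \<longrightarrow> get s' y = get s y) \<and>
    closed_fan (ncol s) (col s) (get s ''v'' 0) (get s ''r'' 0) (get s ''x'' 0)"
proof -
  let ?v = "get s ''v'' 0" and ?r = "get s ''r'' 0" and ?x = "get s ''x'' 0"
  note H = pendingD[OF s]
  define s1 where "s1 = sem (search_out ''R'') s"
  define s2 where "s2 = sem (search_out ''X'') s1"
  have f1: "get s1 y = get s y" if "y \<notin> {''j'', ''found'', ''pick''}" for y
    unfolding s1_def by (rule sem_frame) (use that in auto)
  have f2: "get s2 y = get s y" if "y \<notin> {''j'', ''found'', ''pick''}" for y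
    unfolding s2_def using f1[of y] that by (subst sem_frame) auto
  have p1: "pending S s1" using s pending_cong[of s1 s S] f1 by simp
  have p2: "pending S s2" using s pending_cong[of s2 s S] f2 by simp
  have sh1: "shows_free ''V'' ?v s1" "shows_free ''R'' ?r s1" "shows_free ''X'' ?x s1" "shows_free ''V'' ?v s2"
    using V R X f1 f2 shows_free_cong[of s1 "''V''" s] shows_free_cong[of s1 "''R''" s]
      shows_free_cong[of s1 "''X''" s] shows_free_cong[of s2 "''V''" s] by simp_all
  have at1: "shows_at ?v s1" using at f1 by (simp add: shows_at_def)
  have c1: "child s1 (get s ''f'' 0) ?x" "child s2 (get s ''f'' 0) ?x"
    using c f1 f2 child_cong[of s1 s] child_cong[of s2 s] by simp_all
  have m1: "get s1 ''m'' 0 = m" "ncol s1 \<le> m" using H f1 by simp_all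
  consider (third) e where "get s1 ''found'' 0 = 1" "e < m" "get s1 ''pick'' 0 = col s e"
      "get s ''at'' (col s e) = Suc e" "col s e \<in> free s ?r" "joins e ?v (get s ''ot'' (col s e))"
      "get s ''ot'' (col s e) \<noteq> ?r" "get s ''ot'' (col s e) \<noteq> ?x"
    | (none) "get s1 ''found'' 0 = 0"
      "\<And>e. e < m \<Longrightarrow> inc e ?v \<Longrightarrow> col s e \<in> free s ?r \<Longrightarrow> proper (col s) \<Longrightarrow> joins e ?v ?r \<or> joins e ?v ?x"
    unfolding s1_def by (rule search_out_result[OF H(2,3) R _ at]) auto
  then show ?thesis
  proof cases
    case third
    have "success S (sem third_child s1)"
    proof (rule third_child_success[OF p1, where e = e and z = "get s ''ot'' (col s e)"])
      show "child s1 e (get s ''ot'' (col s e))" using third f1 by (simp add: child_def)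
    qed (use d c1 sh1 b VR VX RX f1 third in simp_all)
    then show ?thesis using third by (simp add: s'_def grow_fan_def s1_def[symmetric])
  next
    case none
    note n1 = none
    consider (third) e where "get s2 ''found'' 0 = 1" "e < m" "get s2 ''pick'' 0 = col s e"
        "get s ''at'' (col s e) = Suc e" "col s e \<in> free s ?x" "joins e ?v (get s ''ot'' (col s e))"
        "get s ''ot'' (col s e) \<noteq> ?r" "get s ''ot'' (col s e) \<noteq> ?x"
      | (none) "get s2 ''found'' 0 = 0"
        "\<And>e. e < m \<Longrightarrow> inc e ?v \<Longrightarrow> col s e \<in> free s ?x \<Longrightarrow> proper (col s) \<Longrightarrow> joins e ?v ?r \<or> joins e ?v ?x"
      unfolding s2_def by (rule search_out_result[OF m1 sh1(3) _ at1]) (simp_all add: f1)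
    then show ?thesis
    proof cases
      case third
      have "success S (sem third_child (sem reroot s2))"
        by (rule reroot_third_success[OF p2, where e = e and z = "get s ''ot'' (col s e)"])
          (use d c1 sh1 b VR VX RX f2 third in simp_all)
      then show ?thesis using third n1 by (simp add: s'_def grow_fan_def s1_def[symmetric] s2_def[symmetric])
    next
      case none
      have "closed_fan (ncol s) (col s) ?v ?r ?x"
        using n1(2) none(2) holedD(1)[OF H(4)] VR VX unfolding closed_fan_def by auto
      moreover have "s' = s2" using none n1 by (simp add: s'_def grow_fan_def s1_def[symmetric] s2_def[symmetric])
      ultimately show ?thesis using f2 by simp
    qed
  qed
qed

text \<open>In the failing outcome the colours are untouched, so the certificates
  \<open>closed_fan\<close> obtained at the two ends of the hole concern the same colouring and can
  be combined.\<close>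

lemma fan_result:
  assumes s: "pending S s"
  defines "s' \<equiv> sem fan s"
  shows "success S s' \<or> get s' ''done'' 0 = 0 \<and> pending S s' \<and>
    get s' ''c'' = get s ''c'' \<and> get s' ''k'' = get s ''k'' \<and> get s' ''h'' = get s ''h'' \<and> get s' ''r'' = get s ''r'' \<and>
    child s' (get s' ''f'' 0) (get s' ''x'' 0) \<and> get s' ''bet'' 0 \<in> free s (get s ''v'' 0) \<and>
    closed_fan (ncol s) (col s) (get s ''v'' 0) (get s ''r'' 0) (get s' ''x'' 0)"
proof -
  let ?v = "get s ''v'' 0" and ?r = "get s ''r'' 0"
  note H = pendingD[OF s]
  define s0 where "s0 = put ''done'' 0 0 s"
  define s1 where "s1 = sem (fill ''V'' ''v'') s0"
  define s2 where "s2 = sem (fill ''R'' ''r'') s1"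
  define s3 where "s3 = sem fill_at s2"
  define s4 where "s4 = sem (common ''V'' ''V'') s3"
  define s5 where "s5 = put ''bet'' 0 (get s4 ''pick'' 0) s4"
  define s6 where "s6 = sem (common ''V'' ''R'') s5"
  define s7 where "s7 = put ''x'' 0 (get s6 ''r'' 0) s6"
  define s8 where "s8 = sem (search_out ''R'') s7"
  define s9 where "s9 = put ''x'' 0 (get s8 ''ot'' (get s8 ''pick'' 0))
     (put ''f'' 0 (get s8 ''at'' (get s8 ''pick'' 0) - 1) s8)"
  define s10 where "s10 = sem (test_child ''f'' ''x'' ''X'') s9"
  have s': "s' = (if get s4 ''found'' 0 = 0 then sem fresh s4 else
     if get s6 ''found'' 0 = 1 then sem (finish ''pick'') s6 else
     if get s8 ''found'' 0 = 0 then sem fresh s8 else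
     if get s10 ''done'' 0 = 0 then sem grow_fan s10 else s10)"
    by (simp add: s'_def fan_def s0_def[symmetric] s1_def[symmetric] s2_def[symmetric] s3_def[symmetric]
        s4_def[symmetric] s5_def[symmetric] s6_def[symmetric] s7_def[symmetric] s8_def[symmetric]
        s9_def[unfolded One_nat_def, symmetric] s10_def[symmetric])
  let ?L = "{''j'', ''found'', ''pick'', ''done'', ''V'', ''R'', ''at'', ''ot'', ''bet'', ''x''}"
  have f0: "get s0 y = get s y" if "y \<noteq> ''done''" for y using that by (simp add: s0_def)
  have f1: "get s1 y = get s0 y" if "y \<notin> {''j'', ''V''}" for y
    unfolding s1_def by (rule sem_frame) (use that in auto)
  have f2: "get s2 y = get s1 y" if "y \<notin> {''j'', ''R''}" for y
    unfolding s2_def by (rule sem_frame) (use that in auto)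
  have f3: "get s3 y = get s2 y" if "y \<notin> {''j'', ''at'', ''ot''}" for y
    unfolding s3_def by (rule sem_frame) (use that in auto)
  have f4: "get s4 y = get s3 y" if "y \<notin> {''j'', ''found'', ''pick''}" for y
    unfolding s4_def by (rule sem_frame) (use that in auto)
  have f5: "get s5 y = get s4 y" if "y \<noteq> ''bet''" for y using that by (simp add: s5_def)
  have f6: "get s6 y = get s5 y" if "y \<notin> {''j'', ''found'', ''pick''}" for y
    unfolding s6_def by (rule sem_frame) (use that in auto)
  have f7: "get s7 y = get s6 y" if "y \<noteq> ''x''" for y using that by (simp add: s7_def)
  have f8: "get s8 y = get s7 y" if "y \<notin> {''j'', ''found'', ''pick''}" for y
    unfolding s8_def by (rule sem_frame) (use that in auto)
  have F1: "get s1 y = get s y" "get s2 y = get s y" "get s3 y = get s y" "get s4 y = get s y"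
    "get s5 y = get s y" "get s6 y = get s y" "get s7 y = get s y" "get s8 y = get s y" if "y \<notin> ?L" for y
    using that f0[of y] f1[of y] f2[of y] f3[of y] f4[of y] f5[of y] f6[of y] f7[of y] f8[of y] by simp_all
  have g: "graph s0" "graph s1" "graph s2"
    using H(1) f0 F1 graph_cong[of s0 s] graph_cong[of s1 s] graph_cong[of s2 s] by simp_all
  have k0: "ncol s0 \<le> m" "ncol s1 \<le> m" using H(3) f0 F1 by simp_all
  have p: "pending S s4" "pending S s6" "pending S s8"
    using s F1 pending_cong[of s4 s S] pending_cong[of s6 s S] pending_cong[of s8 s S] by simp_all
  have "shows_free ''V'' (get s0 ''v'' 0) s1" unfolding s1_def by (rule fill_shows_free[OF g(1) k0(1)]) auto
  then have V1: "shows_free ''V'' ?v s1" using f0 by simp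
  have "shows_free ''R'' (get s1 ''r'' 0) s2" unfolding s2_def by (rule fill_shows_free[OF g(2) k0(2)]) auto
  then have R2: "shows_free ''R'' ?r s2" using F1 by simp
  have "shows_at (get s2 ''v'' 0) s3" unfolding s3_def by (rule fill_at_shows[OF g(3)])
  then have at3: "shows_at ?v s3" using F1 by simp
  have V: "shows_free ''V'' ?v s3" "shows_free ''V'' ?v s5" "shows_free ''V'' ?v s8"
    using V1 F1 f2 f3 f4 f5 f6 f7 f8 shows_free_cong[of s3 "''V''" s1] shows_free_cong[of s5 "''V''" s1]
      shows_free_cong[of s8 "''V''" s1] by simp_all
  have R: "shows_free ''R'' ?r s5" "shows_free ''R'' ?r s7" "shows_free ''R'' ?r s8"
    using R2 F1 f3 f4 f5 f6 f7 f8 shows_free_cong[of s5 "''R''" s2] shows_free_cong[of s7 "''R''" s2]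
      shows_free_cong[of s8 "''R''" s2] by simp_all
  have at: "shows_at ?v s7" "shows_at ?v s8" using at3 F1 f4 f5 f6 f7 f8 by (simp_all add: shows_at_def)
  have mm: "get s3 ''m'' 0 = m" "ncol s3 \<le> m" "get s5 ''m'' 0 = m" "ncol s5 \<le> m" "get s7 ''m'' 0 = m" "ncol s7 \<le> m"
    using H F1 by simp_all
  have xr: "get s7 ''x'' 0 = ?r" using F1 by (simp add: s7_def)
  consider (bet) "get s4 ''found'' 0 = 1" "get s4 ''pick'' 0 \<in> free s ?v"
    | (full) "get s4 ''found'' 0 = 0" "free s ?v = {}"
    unfolding s4_def by (rule common_result[OF mm(1,2) V(1) _ V(1)]) (use F1 in auto)
  then show ?thesis
  proof cases
    case full
    then have "\<not> good (ncol s)" using holed_miss_nonempty(1)[OF _ H(4)] by blast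
    then have "success S (sem fresh s4)" using F1 by (intro fresh_success[OF p(1)]) simp
    then show ?thesis using s' full by simp
  next
    case bet
    consider (both) "get s6 ''found'' 0 = 1" "get s6 ''pick'' 0 \<in> free s ?v" "get s6 ''pick'' 0 \<in> free s ?r"
      | (disj) "get s6 ''found'' 0 = 0" "free s ?v \<inter> free s ?r = {}"
      unfolding s6_def by (rule common_result[OF mm(3,4) V(2) _ R(1)]) (use F1 in auto)
    then show ?thesis
    proof cases
      case both
      have "success S (sem (finish ''pick'') s6)" by (rule finish_success[OF p(2)]) (use both F1 in auto)
      then show ?thesis using s' bet both by simp
    next
      case disj
      consider (edge) e where "get s8 ''found'' 0 = 1" "e < m" "get s8 ''pick'' 0 = col s e"
          "get s7 ''at'' (col s e) = Suc e" "col s e \<in> free s ?r" "joins e ?v (get s7 ''ot'' (col s e))"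
        | (none) "get s8 ''found'' 0 = 0"
          "\<And>e. e < m \<Longrightarrow> inc e ?v \<Longrightarrow> col s e \<in> free s ?r \<Longrightarrow> proper (col s) \<Longrightarrow> joins e ?v ?r"
        unfolding s8_def by (rule search_out_result[OF mm(5,6) R(2) _ at(1)]) (use F1 xr in auto)
      then show ?thesis
      proof cases
        case none
        \<comment> \<open>A colour missing at \<open>?r\<close> would occur at \<open>?v\<close> on
          an edge to \<open>?r\<close>, which is absurd.\<close>
        have "free s ?r = {}"
        proof (rule ccontr)
          assume "free s ?r \<noteq> {}"
          then obtain t where t: "t \<in> free s ?r" by blast
          then have "t \<notin> free s ?v" using disj by blast
          then obtain e where e: "e < m" "inc e ?v" "col s e = t" using t by (auto simp: miss_iff)
          then have "joins e ?v ?r" using none(2) t holedD(1)[OF H(4)] by blast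
          then have "inc e ?r" by (rule joins_inc(2))
          then show False using t e by (auto simp: miss_iff)
        qed
        then have "\<not> good (ncol s)" using holed_miss_nonempty(2)[OF _ H(4)] by blast
        then have "success S (sem fresh s8)" using F1 by (intro fresh_success[OF p(3)]) simp
        then show ?thesis using s' bet disj none by simp
      next
        case edge
        let ?x = "get s7 ''ot'' (col s e)"
        have fx: "get s9 ''f'' 0 = e" "get s9 ''x'' 0 = ?x" using edge f8 by (simp_all add: s9_def)
        have f9: "get s9 y = get s8 y" if "y \<notin> {''f'', ''x''}" for y using that by (simp add: s9_def)
        have F9: "get s9 y = get s y" if "y \<notin> insert ''f'' ?L" for y using f9[of y] F1(8)[of y] that by simp
        have p9: "pending S s9" using s F9 pending_cong[of s9 s S] by simp
        have c9: "child s9 e ?x" using edge F9 by (simp add: child_def)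
        have sh9: "shows_free ''V'' ?v s9" "shows_free ''R'' ?r s9"
          using V(3) R(3) f9 shows_free_cong[of s9 "''V''" s8] shows_free_cong[of s9 "''R''" s8] by simp_all
        have at9: "shows_at ?v s9" using at(2) f9 by (simp add: shows_at_def)
        have b9: "get s9 ''bet'' 0 \<in> free s ?v" using bet f9 f8 f7 f6 by (simp add: s5_def)
        have "get s9 ''done'' 0 = get s0 ''done'' 0" using f9 f8 f7 f6 f5 f4 f3 f2 f1 by simp
        then have d9: "get s9 ''done'' 0 = 0" by (simp add: s0_def)
        have "success S s10 \<or> (\<forall>y. y \<notin> {''j'', ''found'', ''pick'', ''X''} \<longrightarrow> get s10 y = get s9 y) \<and>
            shows_free ''X'' ?x s10 \<and> free s ?v \<inter> free s ?x = {} \<and> free s ?r \<inter> free s ?x = {}"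
          using test_child_result[OF p9, of "''f''" "''x''" "''X''", folded s10_def] c9 sh9 b9 disj(2) fx F9 by simp
        then consider (succ) "success S s10"
          | (ok) "\<And>y. y \<notin> {''j'', ''found'', ''pick'', ''X''} \<Longrightarrow> get s10 y = get s9 y"
            "shows_free ''X'' ?x s10" "free s ?v \<inter> free s ?x = {}" "free s ?r \<inter> free s ?x = {}" by blast
        then show ?thesis
        proof cases
          case succ
          then show ?thesis using s' bet disj edge by simp
        next
          case ok
          have F10: "get s10 y = get s y" if "y \<notin> insert ''X'' (insert ''f'' ?L)" for y
            using ok(1)[of y] F9[of y] that by simp
          have p10: "pending S s10" using s F10 pending_cong[of s10 s S] by simp
          have fx10: "get s10 ''f'' 0 = e" "get s10 ''x'' 0 = ?x" "get s10 ''bet'' 0 \<in> free s ?v" "get s10 ''done'' 0 = 0"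
            using ok(1) fx b9 d9 by simp_all
          have c10: "child s10 e ?x" using c9 ok(1) child_cong[of s10 s9] by simp
          have sh10: "shows_free ''V'' ?v s10" "shows_free ''R'' ?r s10"
            using sh9 ok(1) shows_free_cong[of s10 "''V''" s9] shows_free_cong[of s10 "''R''" s9] by simp_all
          have at10: "shows_at ?v s10" using at9 ok(1) by (simp add: shows_at_def)
          have e: "s' = sem grow_fan s10" using s' bet disj edge fx10 by simp
          have "success S s' \<or> (\<forall>y. y \<notin> {''j'', ''found'', ''pick''} \<longrightarrow> get s' y = get s10 y) \<and>
              closed_fan (ncol s) (col s) ?v ?r ?x"
            using grow_fan_result[OF p10 fx10(4), folded e] c10 sh10 ok(2-4) at10 fx10 disj(2) F10 by simp
          then show ?thesis
          proof
            assume "(\<forall>y. y \<notin> {''j'', ''found'', ''pick''} \<longrightarrow> get s' y = get s10 y) \<and> closed_fan (ncol s) (col s) ?v ?r ?x"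
            then have f11: "\<And>y. y \<notin> {''j'', ''found'', ''pick''} \<Longrightarrow> get s' y = get s10 y"
              and cl: "closed_fan (ncol s) (col s) ?v ?r ?x" by blast+
            have "pending S s'" using p10 f11 pending_cong[of s' s10 S] by simp
            moreover have "child s' e ?x" using c10 f11 child_cong[of s' s10] by simp
            ultimately show ?thesis using f11 F10 fx10 cl by simp
          qed simp
        qed
      qed
    qed
  qed
qed

section \<open>Both ends of the hole closed\<close>

lemma swap_ends_result:
  assumes s: "pending S s"
  defines "s' \<equiv> sem swap_ends s"
  shows "pending S s'" "get s' ''v'' 0 = get s ''r'' 0" "get s' ''r'' 0 = get s ''v'' 0"
    "\<And>y. y \<notin> {''y'', ''v'', ''r''} \<Longrightarrow> get s' y = get s y"
proof -
  show fr: "\<And>y. y \<notin> {''y'', ''v'', ''r''} \<Longrightarrow> get s' y = get s y"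
    and v: "get s' ''v'' 0 = get s ''r'' 0" "get s' ''r'' 0 = get s ''v'' 0"
    by (simp_all add: s'_def swap_ends_def)
  show "pending S s'"
    using s v fr graph_cong[of s' s] holed_commute[of S "ncol s" "col s" "get s ''h'' 0"] by (simp add: pending_def)
qed

lemma both_closed_success:
  assumes s: "pending S s"
    and C1: "closed_fan (ncol s) (col s) (get s ''r'' 0) (get s ''v'' 0) (get s ''x1'' 0)"
    and C2: "closed_fan (ncol s) (col s) (get s ''v'' 0) (get s ''r'' 0) (get s ''x'' 0)"
    and x1: "get s ''f1'' 0 < m" "joins (get s ''f1'' 0) (get s ''r'' 0) (get s ''x1'' 0)"
      "col s (get s ''f1'' 0) \<in> free s (get s ''v'' 0)"
    and c: "child s (get s ''f'' 0) (get s ''x'' 0)"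
    and b: "get s ''b1'' 0 \<in> free s (get s ''r'' 0)"
  shows "success S (sem both_closed s)"
proof -
  \<comment> \<open>On entry \<open>''v''\<close> and \<open>''r''\<close> are exchanged;
    \<open>?v\<close> and \<open>?r\<close> follow the first fan, as after
    \<open>swap_ends\<close>.\<close>
  let ?v = "get s ''r'' 0" and ?r = "get s ''v'' 0" and ?x = "get s ''x1'' 0" and ?y = "get s ''x'' 0"
  define s1 where "s1 = sem swap_ends s"
  define s2 where "s2 = sem (fill ''X'' ''x1'') s1"
  define s3 where "s3 = sem (fill ''Z'' ''x'') s2"
  define s4 where "s4 = sem (common ''X'' ''Z'') s3"
  define s5 where "s5 = put ''bet'' 0 (get s4 ''b1'' 0) (put ''del'' 0 (get s4 ''pick'' 0) s4)"
  define s6 where "s6 = sem kempe_cmd s5"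
  have s': "sem both_closed s = (if get s1 ''x'' 0 = get s1 ''x1'' 0 then sem fresh s1 else
      if get s4 ''found'' 0 = 1 then sem (shift ''f1'' ''del'') s6 else sem fresh s4)"
    by (simp add: both_closed_def s1_def[symmetric] s2_def[symmetric] s3_def[symmetric]
        s4_def[symmetric] s5_def[symmetric] s6_def[symmetric])
  note S1 = swap_ends_result[OF s, folded s1_def]
  have f2: "get s2 y = get s1 y" if "y \<notin> {''j'', ''X''}" for y
    unfolding s2_def by (rule sem_frame) (use that in auto)
  have f3: "get s3 y = get s2 y" if "y \<notin> {''j'', ''Z''}" for y
    unfolding s3_def by (rule sem_frame) (use that in auto)
  have f4: "get s4 y = get s3 y" if "y \<notin> {''j'', ''found'', ''pick''}" for y
    unfolding s4_def by (rule sem_frame) (use that in auto)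
  have F: "get s2 y = get s1 y" "get s3 y = get s1 y" "get s4 y = get s1 y"
    if "y \<notin> {''j'', ''X'', ''Z'', ''found'', ''pick''}" for y
    using f2[of y] f3[of y] f4[of y] that by simp_all
  have v1: "col s1 = col s" "ncol s1 = ncol s" "get s1 ''x'' 0 = ?y" "get s1 ''x1'' 0 = ?x"
    "get s1 ''f1'' 0 = get s ''f1'' 0" "get s1 ''b1'' 0 = get s ''b1'' 0" "get s1 ''h'' 0 = get s ''h'' 0"
    using S1(4) by simp_all
  note H = pendingD[OF S1(1), unfolded v1 S1(2,3)]
  have p: "pending S s4" using S1(1) F pending_cong[of s4 s1 S] by simp
  have c1: "child s1 (get s ''f1'' 0) ?x" using x1 v1 S1(2,3) by (simp add: child_def)
  note ch1 = childD[OF S1(1) c1, unfolded v1 S1(2,3)] and ch = childD[OF s c]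
  show ?thesis
  proof (cases "?y = ?x")
    case True
    have "\<not> good (ncol s)"
      by (rule closed_triangle[OF H(4) C1]) (use C2 True ch1 in auto)
    then have "success S (sem fresh s1)" using v1 by (intro fresh_success[OF S1(1)]) simp
    then show ?thesis using s' True v1 by simp
  next
    case False
    have g: "graph s1" "graph s2" using H(1) F graph_cong[of s2 s1] by simp_all
    have k: "ncol s1 \<le> m" "ncol s2 \<le> m" using H(3) v1 F by simp_all
    have "shows_free ''X'' (get s1 ''x1'' 0) s2" unfolding s2_def by (rule fill_shows_free[OF g(1) k(1)]) auto
    then have X: "shows_free ''X'' ?x s3" using v1 F f3 shows_free_cong[of s3 "''X''" s2] by simp
    have "shows_free ''Z'' (get s2 ''x'' 0) s3" unfolding s3_def by (rule fill_shows_free[OF g(2) k(2)]) auto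
    then have Z: "shows_free ''Z'' ?y s3" using v1 F by simp
    have m3: "get s3 ''m'' 0 = m" "ncol s3 \<le> m" using H(2,3) F v1 by simp_all
    consider (both) "get s4 ''found'' 0 = 1" "get s4 ''pick'' 0 \<in> free s ?x" "get s4 ''pick'' 0 \<in> free s ?y"
      | (disj) "get s4 ''found'' 0 = 0" "free s ?x \<inter> free s ?y = {}"
      unfolding s4_def by (rule common_result[OF m3 X _ Z]) (use F v1 in auto)
    then show ?thesis
    proof cases
      case both
      let ?a = "get s4 ''pick'' 0" and ?b = "get s ''b1'' 0"
      have f5: "get s5 y = get s1 y" if "y \<notin> {''j'', ''X'', ''Z'', ''found'', ''pick'', ''del'', ''bet''}" for y
        using F[of y] that by (simp add: s5_def)
      have p5: "pending S s5" using p F f5 pending_cong[of s5 s1 S] S1(1) by simp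
      have v5: "col s5 = col s" "ncol s5 = ncol s" "get s5 ''v'' 0 = ?v" "get s5 ''del'' 0 = ?a" "get s5 ''bet'' 0 = ?b"
        "get s5 ''f1'' 0 = get s ''f1'' 0"
        using f5 v1 S1(2) F by (simp_all add: s5_def)
      have c5: "child s5 (get s ''f1'' 0) ?x" using c1 f5 child_cong[of s5 s1] by simp
      have "free s ?v \<inter> free s ?x = {}" using C1 by (simp add: closed_fan_def)
      then have a: "?a \<in> {1..ncol s}" "?a \<notin> free s ?v" using both by (auto simp: miss_def)
      note K = kempe_cmd_result[OF p5, folded s6_def, unfolded v5, OF b a]
      obtain M where "kempe (col s) ?a ?b ?v M (get s6 ''w'' 0)" using K(5) by blast
      \<comment> \<open>The end of the chain is \<open>?y\<close> and not \<open>?x\<close>, so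
        \<open>?a\<close> stays missing at \<open>?x\<close> and becomes missing at
        \<open>?v\<close>.\<close>
      from closed_pair_end[OF H(4) C1 C2 ch(5) both(2,3) b this] have w: "get s6 ''w'' 0 = ?y" .
      have v6: "get s6 ''v'' 0 = ?v" "get s6 ''del'' 0 = ?a" "get s6 ''f1'' 0 = get s ''f1'' 0"
        using K(6) v5 by simp_all
      have "success S (sem (shift ''f1'' ''del'') s6)"
        by (rule shift_success[OF K(1), of _ ?x]) (use K(2) K(3)[of ?x] K(4)[OF c5] w False both ch1 v6 in auto)
      then show ?thesis using s' False v1 both by simp
    next
      case disj
      have "\<not> good (ncol s)"
        by (rule closed_pair[OF H(4) C1 C2 ch1(1,2,4,5) ch(1,2,5,4) disj(2)])
      then have "success S (sem fresh s4)" using F v1 by (intro fresh_success[OF p]) simp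
      then show ?thesis using s' False v1 disj by simp
    qed
  qed
qed

lemma extend_finished:
  assumes s: "pending S s"
  shows "finished S (sem extend s)"
proof -
  let ?v = "get s ''v'' 0" and ?r = "get s ''r'' 0"
  define s1 where "s1 = sem fan s"
  define s2 where "s2 = put ''b1'' 0 (get s1 ''bet'' 0) (put ''f1'' 0 (get s1 ''f'' 0) (put ''x1'' 0 (get s1 ''x'' 0) s1))"
  define s3 where "s3 = sem swap_ends s2"
  define s4 where "s4 = sem fan s3"
  have s': "sem extend s = (if get s1 ''done'' 0 = 0 then if get s4 ''done'' 0 = 0 then sem both_closed s4 else s4 else s1)"
    by (simp add: extend_def s1_def[symmetric] s2_def[symmetric] s3_def[symmetric] s4_def[symmetric])
  have fv: "get (sem fan t) y = get t y" if "y \<in> {''v'', ''x1'', ''f1'', ''b1''}" for t y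
    by (rule sem_frame) (use that in auto)
  show ?thesis
  proof (cases "success S s1")
    case True
    then show ?thesis using s' by simp
  next
    case False
    then have 1: "get s1 ''done'' 0 = 0" "pending S s1" "col s1 = col s" "ncol s1 = ncol s"
      "get s1 ''h'' = get s ''h''" "get s1 ''r'' = get s ''r''" "child s1 (get s1 ''f'' 0) (get s1 ''x'' 0)"
      "get s1 ''bet'' 0 \<in> free s ?v" "closed_fan (ncol s) (col s) ?v ?r (get s1 ''x'' 0)"
      using fan_result[OF s, folded s1_def] by auto
    have v1: "get s1 ''v'' 0 = ?v" using fv by (simp add: s1_def)
    have f2: "get s2 y = get s1 y" if "y \<notin> {''x1'', ''f1'', ''b1''}" for y using that by (simp add: s2_def)
    have p2: "pending S s2" using 1(2) f2 pending_cong[of s2 s1 S] by simp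
    note S3 = swap_ends_result[OF p2, folded s3_def]
    have v3: "get s3 ''v'' 0 = ?r" "get s3 ''r'' 0 = ?v" "col s3 = col s" "ncol s3 = ncol s"
      "get s3 ''x1'' 0 = get s1 ''x'' 0" "get s3 ''f1'' 0 = get s1 ''f'' 0" "get s3 ''b1'' 0 = get s1 ''bet'' 0"
      using S3(2-4) f2 1 v1 by (simp_all add: s2_def)
    show ?thesis
    proof (cases "success S s4")
      case True
      then show ?thesis using s' 1 by simp
    next
      case False
      then have 4: "get s4 ''done'' 0 = 0" "pending S s4" "col s4 = col s" "ncol s4 = ncol s"
        "get s4 ''r'' 0 = ?v" "child s4 (get s4 ''f'' 0) (get s4 ''x'' 0)"
        "closed_fan (ncol s) (col s) ?r ?v (get s4 ''x'' 0)"
        using fan_result[OF S3(1), folded s4_def] v3 by auto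
      have v4: "get s4 ''v'' 0 = ?r" "get s4 ''x1'' 0 = get s1 ''x'' 0" "get s4 ''f1'' 0 = get s1 ''f'' 0"
        "get s4 ''b1'' 0 = get s1 ''bet'' 0"
        using fv v3 by (simp_all add: s4_def)
      have "success S (sem both_closed s4)"
        by (rule both_closed_success[OF 4(2)]) (use 1 4 v4 v1 in \<open>simp_all add: child_def\<close>)
      then show ?thesis using s' 1 4 by simp
    qed
  qed
qed

section \<open>The loops over all edges\<close>

lemma colour_links_finished:
  assumes s: "graph s" "ncol s = 0" "\<And>e. col s e = 0"
  shows "finished links (sem colour_links s)"
proof -
  let ?L = "IfElse (Equal (Cell ''fst'' (var ''e'')) (Cell ''snd'' (var ''e''))) Pass
       (Put ''h'' (Const 0) (var ''e'') ;; Put ''v'' (Const 0) (Cell ''fst'' (var ''e'')) ;;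
        Put ''r'' (Const 0) (Cell ''snd'' (var ''e'')) ;; extend)"
  define I where "I = (\<lambda>i t. finished {e \<in> links. e < i} t)"
  have fin_put: "finished S (put ''e'' 0 x t) \<longleftrightarrow> finished S t" for S x t
    by (simp add: finished_def graph_def)
  have "I (get s ''m'' 0) (sem (Repeat ''e'' ?L) s)"
  proof (rule Repeat_invariant)
    have "finished {} s" using s by (simp add: finished_def coloured_def proper_def)
    then show "I 0 (put ''e'' 0 0 s)" unfolding I_def fin_put by simp
  next
    fix i t assume i: "i < get s ''m'' 0" "get t ''e'' 0 = i" and I: "I i t"
    have im: "i < m" using i s by (simp add: graph_def)
    have t: "finished {e \<in> links. e < i} t" using I by (simp add: I_def)
    then have pq: "get t ''fst'' i = p i" "get t ''snd'' i = q i" using im by (auto simp: finished_def graph_def)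
    show "I (Suc i) (put ''e'' 0 (Suc i) (sem ?L t))"
    proof (cases "p i = q i")
      case True
      then have "{e \<in> links. e < Suc i} = {e \<in> links. e < i}" by (auto simp: links_def less_Suc_eq)
      then show ?thesis using t True pq i fin_put by (simp add: I_def)
    next
      case False
      have ins: "{e \<in> links. e < Suc i} = insert i {e \<in> links. e < i}"
        using False im by (auto simp: links_def less_Suc_eq)
      define t1 where "t1 = put ''r'' 0 (q i) (put ''v'' 0 (p i) (put ''h'' 0 i t))"
      have f: "get t1 y = get t y" if "y \<notin> {''h'', ''v'', ''r''}" for y using that by (simp add: t1_def)
      have v: "get t1 ''h'' 0 = i" "get t1 ''v'' 0 = p i" "get t1 ''r'' 0 = q i" by (simp_all add: t1_def)
      have "finite {e \<in> links. e < i}" by simp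
      \<comment> \<open>Adding the hole raises the cardinality by one without colouring anything,
        which makes the inequality strict.\<close>
      then have "pending {e \<in> links. e < Suc i} t1"
        using t f v graph_cong[of t1 t] unfolding ins
        by (auto simp: pending_def finished_def holed_def joins_def links_def False im)
      then have "finished {e \<in> links. e < Suc i} (sem extend t1)" by (rule extend_finished)
      moreover have "sem ?L t = sem extend t1" using False pq i by (simp add: t1_def)
      ultimately show ?thesis using fin_put by (simp add: I_def)
    qed
  qed auto
  moreover have "{e \<in> links. e < m} = links" by (auto simp: links_def)
  ultimately show ?thesis using s by (simp add: I_def colour_links_def graph_def)
qed

lemma colour_loops_finished:
  assumes s: "finished links s"
  shows "finished {..<m} (sem colour_loops s)"
proof -
  let ?L = "IfElse (Equal (Cell ''fst'' (var ''e'')) (Cell ''snd'' (var ''e'')))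
       (Put ''h'' (Const 0) (var ''e'') ;; Put ''v'' (Const 0) (Cell ''fst'' (var ''e'')) ;;
        fill ''V'' ''v'' ;; common ''V'' ''V'' ;;
        IfElse (Equal (var ''found'') one) (finish ''pick'') fresh) Pass"
  \<comment> \<open>All links are coloured beforehand, so in round \<open>i\<close> only the loops
    below \<open>i\<close> are added to them.\<close>
  define U where "U = (\<lambda>i. links \<union> {e. e < i \<and> e < m})"
  define I where "I = (\<lambda>i t. finished (U i) t)"
  have fin_put: "finished S (put ''e'' 0 x t) \<longleftrightarrow> finished S t" for S x t
    by (simp add: finished_def graph_def)
  have "I (get s ''m'' 0) (sem (Repeat ''e'' ?L) s)"
  proof (rule Repeat_invariant)
    show "I 0 (put ''e'' 0 0 s)" using s fin_put by (simp add: I_def U_def)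
  next
    fix i t assume i: "i < get s ''m'' 0" "get t ''e'' 0 = i" and I: "I i t"
    have im: "i < m" using i s by (simp add: finished_def graph_def)
    have t: "finished (U i) t" using I by (simp add: I_def)
    then have pq: "get t ''fst'' i = p i" "get t ''snd'' i = q i" using im by (auto simp: finished_def graph_def)
    show "I (Suc i) (put ''e'' 0 (Suc i) (sem ?L t))"
    proof (cases "p i = q i")
      case False
      then have "U (Suc i) = U i" using im by (auto simp: U_def links_def less_Suc_eq)
      then show ?thesis using t False pq i fin_put by (simp add: I_def)
    next
      case True
      have ins: "U (Suc i) = insert i (U i)" "i \<notin> U i"
        using True im by (auto simp: U_def links_def less_Suc_eq)
      define t1 where "t1 = put ''v'' 0 (p i) (put ''h'' 0 i t)"
      define t2 where "t2 = sem (fill ''V'' ''v'') t1"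
      define t3 where "t3 = sem (common ''V'' ''V'') t2"
      have f1: "get t1 y = get t y" if "y \<notin> {''h'', ''v''}" for y using that by (simp add: t1_def)
      have f2: "get t2 y = get t1 y" if "y \<notin> {''j'', ''V''}" for y
        unfolding t2_def by (rule sem_frame) (use that in auto)
      have f3: "get t3 y = get t2 y" if "y \<notin> {''j'', ''found'', ''pick''}" for y
        unfolding t3_def by (rule sem_frame) (use that in auto)
      have v: "get t1 ''h'' 0 = i" "get t1 ''v'' 0 = p i" by (simp_all add: t1_def)
      have h3: "get t3 ''h'' 0 = i" using v f2 f3 by simp
      have UE: "U i \<subseteq> {..<m}" by (auto simp: U_def links_def)
      have finU: "finite (U i)" using UE finite_subset by blast
      have cl: "coloured (U i) (ncol t) (col t)" "graph t" "ncol t \<le> card (U i)" "ncol t \<le> gam"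
        using t by (auto simp: finished_def)
      have km: "ncol t \<le> m" using cl(3) card_mono[OF _ UE] by simp
      have g: "graph t1" "graph t2" "graph t3"
        using cl(2) f1 f2 f3 graph_cong[of t1 t] graph_cong[of t2 t1] graph_cong[of t3 t2] by simp_all
      have "shows_free ''V'' (get t1 ''v'' 0) t2"
        unfolding t2_def by (rule fill_shows_free[OF g(1)]) (use km f1 in auto)
      then have V: "shows_free ''V'' (p i) t2" using v by simp
      have m2: "get t2 ''m'' 0 = m" "ncol t2 \<le> m" using g(2) km f1 f2 by (simp_all add: graph_def)
      have L: "sem ?L t = (if get t3 ''found'' 0 = 1 then sem (finish ''pick'') t3 else sem fresh t3)"
        using pq True[symmetric] i by (simp add: t1_def[symmetric] t2_def[symmetric] t3_def[symmetric])
      consider (found) "get t3 ''found'' 0 = 1" "get t3 ''pick'' 0 \<in> free t (p i)"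
        | (none) "get t3 ''found'' 0 = 0" "free t (p i) = {}"
        unfolding t3_def by (rule common_result[OF m2 V _ V]) (use f1 f2 in auto)
      then have "finished (insert i (U i)) (sem ?L t)"
      proof cases
        case found
        let ?t = "sem (finish ''pick'') t3"
        have "col ?t = (col t)(i := get t3 ''pick'' 0)" "ncol ?t = ncol t"
          using h3 f1 f2 f3 by (simp_all add: finish_def get_put_same)
        moreover have "graph ?t" using g(3) graph_cong[of ?t t3] by (simp add: sem_frame)
        moreover have "coloured (insert i (U i)) (ncol t) ((col t)(i := get t3 ''pick'' 0))"
          by (rule coloured_update[OF cl(1)]) (use found im True in \<open>auto simp: miss_iff inc_def\<close>)
        ultimately have "finished (insert i (U i)) ?t" using cl finU ins(2) by (simp add: finished_def)
        then show ?thesis using L found by simp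
      next
        case none
        \<comment> \<open>No colour is missing, so each of them is used at the vertex; the loop
          \<open>i\<close> itself is still uncoloured, which makes the count strictly smaller than
          the number of all edges there.\<close>
        have "ncol t \<le> card {e \<in> U i. inc e (p i)}" using miss_card[OF cl(1), of "p i"] none by simp
        also have "\<dots> < card {j. j < m \<and> inc j (p i)}"
          using UE ins(2) im by (intro psubset_card_mono) (auto simp: inc_def)
        also have "\<dots> \<le> gam" by (rule gam_loop[OF im True])
        finally have "success (insert (get t3 ''h'' 0) (U i)) (sem fresh t3)"
          using g cl im ins(2) h3 f1 f2 f3 by (intro fresh_finished) simp_all
        then show ?thesis using L none h3 by simp
      qed
      then show ?thesis using fin_put ins by (simp add: I_def)
    qed
  qed auto
  moreover have "U m = {..<m}" by (auto simp: U_def links_def)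
  ultimately show ?thesis using s by (simp add: I_def colour_loops_def finished_def graph_def)
qed

lemma colour_edges_correct:
  assumes s: "graph s" "ncol s = 0" "\<And>e. col s e = 0" and e: "e < m" and f: "f < m"
  defines "c \<equiv> get (sem colour_edges s) ''colour''"
  shows "c e < gam" "e \<noteq> f \<Longrightarrow> inc e w \<Longrightarrow> inc f w \<Longrightarrow> c e \<noteq> c f"
proof -
  define t where "t = sem colour_loops (sem colour_links s)"
  have t: "finished {..<m} t"
    unfolding t_def by (rule colour_loops_finished[OF colour_links_finished[OF s]])
  let ?L = "Put ''colour'' (var ''j'') (Minus (Cell ''c'' (var ''j'')) one)"
  have "\<forall>e<get t ''m'' 0. get (sem (Repeat ''j'' ?L) t) ''colour'' e = col t e - 1"
    by (rule Repeat_invariant[where I = "\<lambda>i t'. \<forall>e<i. get t' ''colour'' e = col t e - 1"])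
      (auto simp: get_put_if less_Suc_eq)
  moreover have "sem colour_edges s = sem (Repeat ''j'' ?L) t"
    by (simp add: colour_edges_def output_colours_def t_def)
  ultimately have c: "\<forall>e<m. c e = col t e - 1" using t by (simp add: c_def finished_def graph_def)
  have pr: "coloured {..<m} (ncol t) (col t)" "ncol t \<le> gam" using t by (auto simp: finished_def)
  \<comment> \<open>With positive colours the truncated subtraction of 1 is injective and ends
    strictly below \<open>gam\<close>.\<close>
  have pos: "0 < col t e" "0 < col t f" "col t e \<le> ncol t" using pr(1) e f unfolding coloured_def by auto
  show "c e < gam" using c e pos pr(2) by auto
  assume "e \<noteq> f" "inc e w" "inc f w"
  then have "col t e \<noteq> col t f" using pr(1) pos e f unfolding coloured_def proper_def by auto
  then show "c e \<noteq> c f" using c e f pos by auto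
qed

end

section \<open>The parameter \<open>gamma_l'\<close>\<close>

definition gamma_term :: "('v, 'e) multigraph \<Rightarrow> 'v \<Rightarrow> 'v \<Rightarrow> nat" where
  "gamma_term G u v =
     nat \<lceil>Max {real (vertex_degree G u) + 1/2 * (real (vertex_degree G v) - real (edge_mult G u v)),
               real (vertex_degree G v) + 1/2 * (real (vertex_degree G u) - real (edge_mult G u v)),
               1/2 * (real (vertex_degree G u) + real (vertex_degree G v) - real (edge_mult G u v)
                       + real (triple G u v))}\<rceil>"

definition adjacent_pairs :: "('v, 'e) multigraph \<Rightarrow> ('v \<times> 'v) set" where
  "adjacent_pairs G = {(u, v). u \<noteq> v \<and> (\<exists>e\<in>edges G. ends G e = {u, v})}"

lemma gamma_l'_alt: "gamma_l' G = Max (insert 0 ((\<lambda>(u, v). gamma_term G u v) ` adjacent_pairs G))"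
proof -
  have "(\<lambda>(u, v). F u v) ` adjacent_pairs G = {F u v | u v. u \<noteq> v \<and> (\<exists>e\<in>edges G. ends G e = {u, v})}"
    for F :: "'a \<Rightarrow> 'a \<Rightarrow> nat"
    by (auto simp: adjacent_pairs_def)
  then show ?thesis by (simp only: gamma_l'_def gamma_term_def)
qed

text \<open>Doubling removes halves and the ceiling. The middle term of the maximum is the first one
  for the exchanged pair, and \<open>adjacent_pairs\<close> contains both orders.\<close>

lemma gamma_term_le:
  assumes "gamma_term G u v \<le> k"
  shows "2 * vertex_degree G u + vertex_degree G v \<le> 2 * k + edge_mult G u v"
    "vertex_degree G u + vertex_degree G v + triple G u v \<le> 2 * k + edge_mult G u v"
proof -
  define a where "a = real (vertex_degree G u) + 1/2 * (real (vertex_degree G v) - real (edge_mult G u v))"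
  define b where "b = real (vertex_degree G v) + 1/2 * (real (vertex_degree G u) - real (edge_mult G u v))"
  define c where "c = 1/2 * (real (vertex_degree G u) + real (vertex_degree G v) - real (edge_mult G u v)
       + real (triple G u v))"
  have "nat \<lceil>Max {a, b, c}\<rceil> \<le> k" using assms by (simp only: gamma_term_def a_def b_def c_def)
  then have "Max {a, b, c} \<le> real k" by linarith
  then have "a \<le> real k" "c \<le> real k" by auto
  then have "real (2 * vertex_degree G u + vertex_degree G v) \<le> real (2 * k + edge_mult G u v)"
    "real (vertex_degree G u + vertex_degree G v + triple G u v) \<le> real (2 * k + edge_mult G u v)"
    by (simp_all add: a_def c_def field_simps)
  then show "2 * vertex_degree G u + vertex_degree G v \<le> 2 * k + edge_mult G u v"
    "vertex_degree G u + vertex_degree G v + triple G u v \<le> 2 * k + edge_mult G u v"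
    by (simp_all only: of_nat_le_iff)
qed

lemma gamma_l'_ge:
  assumes G: "fin_multigraph G" and e: "e \<in> edges G" "ends G e = {u, v}" "u \<noteq> v"
  shows "2 * vertex_degree G u + vertex_degree G v \<le> 2 * gamma_l' G + edge_mult G u v"
    "vertex_degree G u + vertex_degree G v + triple G u v \<le> 2 * gamma_l' G + edge_mult G u v"
proof -
  have "ends G e \<subseteq> verts G" if "e \<in> edges G" for e
    using G that unfolding fin_multigraph_def by fastforce
  then have "adjacent_pairs G \<subseteq> verts G \<times> verts G" by (fastforce simp: adjacent_pairs_def)
  then have fin: "finite (adjacent_pairs G)"
    using G finite_subset unfolding fin_multigraph_def by (metis finite_cartesian_product)
  have "(u, v) \<in> adjacent_pairs G" using e by (auto simp: adjacent_pairs_def)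
  then have "gamma_term G u v \<in> (\<lambda>(u, v). gamma_term G u v) ` adjacent_pairs G" by force
  then have "gamma_term G u v \<le> gamma_l' G" unfolding gamma_l'_alt using fin by (intro Max_ge) simp_all
  then show "2 * vertex_degree G u + vertex_degree G v \<le> 2 * gamma_l' G + edge_mult G u v"
    "vertex_degree G u + vertex_degree G v + triple G u v \<le> 2 * gamma_l' G + edge_mult G u v"
    by (rule gamma_term_le)+
qed

lemma triple_ge:
  assumes "finite (verts G)" "w \<in> verts G" "w \<noteq> u" "w \<noteq> v"
  shows "edge_mult G u v + edge_mult G u w + edge_mult G v w \<le> triple G u v"
proof -
  have "w \<in> verts G - {u, v}" using assms by simp
  then have "triple G u v = Max ((\<lambda>w. edge_mult G u v + edge_mult G u w + edge_mult G v w) ` (verts G - {u, v}))"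
    by (auto simp: triple_def)
  then show ?thesis using assms by (auto intro!: Max_ge)
qed

lemma edge_mult_le_degree:
  assumes "finite (edges G)"
  shows "edge_mult G u v \<le> vertex_degree G v"
  unfolding edge_mult_def vertex_degree_def
  by (rule trans_le_add1) (use assms in \<open>auto intro!: card_mono\<close>)

section \<open>The list representation as an instance\<close>

locale input_graph =
  fixes n :: nat and es :: "(nat \<times> nat) list"
  assumes edge_list: "edge_list n es" and attached: "loops_attached (multigraph_of n es)"
begin

abbreviation G :: "(nat, nat) multigraph" where "G \<equiv> multigraph_of n es"

sublocale edge_memory "length es" "\<lambda>i. fst (es ! i)" "\<lambda>i. snd (es ! i)" .

lemma finite_G: "fin_multigraph G"
  using edge_list by (rule fin_multigraph_multigraph_of)

lemma G_simps [simp]: "edges G = {..<length es}" "verts G = {..<n}"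
  "ends G i = {fst (es ! i), snd (es ! i)}"
  by (simp_all add: multigraph_of_def)

lemma ends_iff: "w \<in> ends G e \<longleftrightarrow> inc e w" "u \<noteq> w \<Longrightarrow> ends G e = {u, w} \<longleftrightarrow> joins e u w"
  by (auto simp: inc_def joins_def doubleton_eq_iff)

lemma edge_mult_eq: "u \<noteq> w \<Longrightarrow> edge_mult G u w = mu u w"
  unfolding edge_mult_def mu_def using ends_iff(2)[of u w] by simp

text \<open>\<open>deg\<close> leaves out loops, which \<open>vertex_degree\<close> counts twice, so
  bounds for the whole multigraph carry over to its loopless part.\<close>

lemma deg_le: "deg w \<le> vertex_degree G w"
  unfolding deg_def vertex_degree_def
  by (rule trans_le_add1) (auto intro!: card_mono simp: links_def inc_def)

lemma edge_end:
  assumes "e < length es" "inc e w"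
  shows "w < n"
proof -
  have "fst (es ! e) < n \<and> snd (es ! e) < n"
    using edge_list nth_mem[OF assms(1)] by (auto simp: edge_list_def case_prod_beta)
  then show ?thesis using assms(2) by (auto simp: inc_def)
qed

sublocale bounded_edge_memory "length es" "\<lambda>i. fst (es ! i)" "\<lambda>i. snd (es ! i)" "gamma_l' G"
proof
  fix k assume k: "gamma_l' G \<le> k"
  show "good k"
    unfolding good_def
  proof (intro allI impI conjI)
    fix u v assume "u \<noteq> v \<and> 0 < mu u v"
    then have uv: "u \<noteq> v" and "0 < mu u v" by auto
    then obtain e where e: "e < length es" "joins e u v" by (auto simp: mu_def card_gt_0_iff)
    then have "e \<in> edges G" "ends G e = {u, v}" using ends_iff(2)[OF uv] by auto
    note g = gamma_l'_ge[OF finite_G this uv, unfolded edge_mult_eq[OF uv]]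
    show "2 * deg u + deg v \<le> 2 * k + mu u v" using g(1) k deg_le[of u] deg_le[of v] by linarith
    fix w assume "w \<noteq> u \<and> w \<noteq> v \<and> 0 < mu u w"
    then have w: "w \<noteq> u" "w \<noteq> v" "0 < mu u w" by auto
    then obtain f where "f < length es" "joins f u w" by (auto simp: mu_def card_gt_0_iff)
    \<comment> \<open>Adjacency to \<open>u\<close> makes \<open>w\<close> a vertex, hence a
      candidate in the maximum \<open>triple\<close>; the summand \<open>mu u v\<close> of
      \<open>triple\<close> then cancels against the right-hand side.\<close>
    then have "w < n" using edge_end joins_inc by blast
    then have "edge_mult G u v + edge_mult G u w + edge_mult G v w \<le> triple G u v"
      by (intro triple_ge) (use w in auto)
    then show "deg u + deg v + mu u w + mu v w \<le> 2 * k"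
      using g(2) k deg_le[of u] deg_le[of v] w uv by (simp add: edge_mult_eq)
  qed
next
  fix e assume e: "e < length es" "fst (es ! e) = snd (es ! e)"
  define v where "v = fst (es ! e)"
  have "e \<in> edges G" "ends G e = {v}" using e by (auto simp: v_def)
  then obtain f w where f: "f \<in> edges G" "w \<noteq> v" "ends G f = {v, w}"
    using attached unfolding loops_attached_def by blast
  \<comment> \<open>The edge attached to the loop gives the first term of \<open>gamma_l'\<close>.
    As its multiplicity is at most the degree of \<open>w\<close>, what remains is
    \<open>vertex_degree G v \<le> gamma_l' G\<close>.\<close>
  have "2 * vertex_degree G v + vertex_degree G w \<le> 2 * gamma_l' G + edge_mult G v w"
    by (rule gamma_l'_ge(1)[OF finite_G f(1,3)]) (use f in simp)
  moreover have "edge_mult G v w \<le> vertex_degree G w" by (rule edge_mult_le_degree) simp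
  moreover have "card {i. i < length es \<and> inc i v} \<le> vertex_degree G v"
    unfolding vertex_degree_def by (rule trans_le_add1) (auto intro!: card_mono simp: inc_def)
  ultimately show "card {i. i < length es \<and> inc i (fst (es ! e))} \<le> gamma_l' G" by (simp add: v_def)
qed

lemma colouring:
  "edge_colouring_with G (gamma_l' G) (get (sem colour_edges (Store_of (input n es))) ''colour'')"
proof -
  let ?s = "Store_of (input n es)"
  have s: "graph ?s" "ncol ?s = 0" "\<And>e. col ?s e = 0" by (simp_all add: graph_def input_def)
  show ?thesis
    unfolding edge_colouring_with_def proper_edge_colouring_def
  proof (intro conjI ballI impI)
    fix e f assume ef: "e \<in> edges G" "f \<in> edges G" "e \<noteq> f \<and> ends G e \<inter> ends G f \<noteq> {}"
    then obtain w where "inc e w" "inc f w" using ends_iff(1) by blast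
    then show "get (sem colour_edges ?s) ''colour'' e \<noteq> get (sem colour_edges ?s) ''colour'' f"
      using colour_edges_correct(2)[OF s, of e f w] ef by simp
  next
    show "get (sem colour_edges ?s) ''colour'' ` edges G \<subseteq> {..<gamma_l' G}"
      using colour_edges_correct(1)[OF s] by auto
  qed
qed

lemma colouring_runs:
  "\<exists>t. runs (prog colour_edges) (input n es) t (get (sem colour_edges (Store_of (input n es)))) \<and>
     t \<le> cost colour_edges * (length es + 1)\<^sup>2"
  using runs_prog[OF wf_colour_edges, of "Store_of (input n es)"]
  by (simp add: nesting_colour_edges input_def)

end

section \<open>Transfer along isomorphisms\<close>

text \<open>The maps run in opposite directions to suit the list model \<open>H\<close>: vertices of
  \<open>G\<close> are numbered by \<open>f\<close>, while edges of \<open>H\<close> are list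
  positions and \<open>g\<close> looks them up.\<close>

locale multigraph_iso =
  fixes G :: "('v, 'e) multigraph" and H :: "('w, 'f) multigraph" and f :: "'v \<Rightarrow> 'w" and g :: "'f \<Rightarrow> 'e"
  assumes fin: "fin_multigraph G"
    and f: "bij_betw f (verts G) (verts H)" and g: "bij_betw g (edges H) (edges G)"
    and ends: "i \<in> edges H \<Longrightarrow> ends H i = f ` ends G (g i)"
begin

lemma ends_subset: "e \<in> edges G \<Longrightarrow> ends G e \<subseteq> verts G"
  using fin unfolding fin_multigraph_def by fastforce

lemma ends_eq_iff:
  assumes "i \<in> edges H" "A \<subseteq> verts G"
  shows "ends H i = f ` A \<longleftrightarrow> ends G (g i) = A"
proof -
  have "g i \<in> edges G" using g assms(1) by (auto dest: bij_betwE)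
  then show ?thesis
    using inj_on_image_eq_iff[OF bij_betw_imp_inj_on[OF f] ends_subset assms(2)] ends assms(1) by auto
qed

lemma card_edges_eq:
  assumes "\<And>i. i \<in> edges H \<Longrightarrow> P (ends H i) \<longleftrightarrow> Q (ends G (g i))"
  shows "card {i \<in> edges H. P (ends H i)} = card {e \<in> edges G. Q (ends G e)}"
proof (rule bij_betw_same_card[of g])
  have "g ` {i \<in> edges H. P (ends H i)} = {e \<in> edges G. Q (ends G e)}"
    using assms bij_betw_imp_surj_on[OF g] by force
  moreover have "inj_on g {i \<in> edges H. P (ends H i)}"
    using bij_betw_imp_inj_on[OF g] by (rule inj_on_subset) auto
  ultimately show "bij_betw g {i \<in> edges H. P (ends H i)} {e \<in> edges G. Q (ends G e)}"
    by (simp add: bij_betw_def)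
qed

lemma degree_eq:
  assumes "v \<in> verts G"
  shows "vertex_degree H (f v) = vertex_degree G v"
proof -
  have "f v \<in> ends H i \<longleftrightarrow> v \<in> ends G (g i)" if "i \<in> edges H" for i
  proof -
    have "g i \<in> edges G" using g that by (auto dest: bij_betwE)
    then show ?thesis
      unfolding ends[OF that] by (intro inj_on_image_mem_iff[OF bij_betw_imp_inj_on[OF f] assms] ends_subset)
  qed
  then show ?thesis
    unfolding vertex_degree_def
    using card_edges_eq[of "\<lambda>A. f v \<in> A" "\<lambda>A. v \<in> A"]
      card_edges_eq[of "\<lambda>A. A = {f v}" "\<lambda>A. A = {v}"] ends_eq_iff[of _ "{v}"] assms by simp
qed

lemma edge_mult_eq:
  assumes "u \<in> verts G" "v \<in> verts G"
  shows "edge_mult H (f u) (f v) = edge_mult G u v"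
  unfolding edge_mult_def
  using card_edges_eq[of "\<lambda>A. A = {f u, f v}" "\<lambda>A. A = {u, v}"] ends_eq_iff[of _ "{u, v}"] assms by simp

lemma triple_eq:
  assumes "u \<in> verts G" "v \<in> verts G"
  shows "triple H (f u) (f v) = triple G u v"
proof -
  have V: "verts H - {f u, f v} = f ` (verts G - {u, v})"
    using inj_on_image_set_diff[OF bij_betw_imp_inj_on[OF f], of "verts G" "{u, v}"] assms
      bij_betw_imp_surj_on[OF f] by auto
  have "(\<lambda>w. edge_mult H (f u) (f v) + edge_mult H (f u) w + edge_mult H (f v) w) ` (verts H - {f u, f v}) =
      (\<lambda>w. edge_mult G u v + edge_mult G u w + edge_mult G v w) ` (verts G - {u, v})"
    unfolding V image_image by (rule image_cong) (use assms in \<open>auto simp: edge_mult_eq\<close>)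
  then show ?thesis unfolding triple_def using V assms by (simp add: edge_mult_eq)
qed

lemma adjacent_pairs_eq: "adjacent_pairs H = map_prod f f ` adjacent_pairs G"
proof (intro set_eqI iffI)
  fix a assume "a \<in> adjacent_pairs H"
  then obtain i u' v' where i: "a = (u', v')" "u' \<noteq> v'" "i \<in> edges H" "ends H i = {u', v'}"
    by (auto simp: adjacent_pairs_def)
  have gi: "g i \<in> edges G" using g i(3) by (auto dest: bij_betwE)
  have im: "f ` ends G (g i) = {u', v'}" using ends i by simp
  then obtain u v where uv: "u \<in> ends G (g i)" "v \<in> ends G (g i)" "u' = f u" "v' = f v" by blast
  then have V: "u \<in> verts G" "v \<in> verts G" using ends_subset[OF gi] by auto
  have "ends G (g i) = {u, v}" using ends_eq_iff[of i "{u, v}"] i uv V by simp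
  then have "(u, v) \<in> adjacent_pairs G" using gi uv i(2) by (auto simp: adjacent_pairs_def)
  then show "a \<in> map_prod f f ` adjacent_pairs G" using i(1) uv by force
next
  fix a assume "a \<in> map_prod f f ` adjacent_pairs G"
  then obtain u v e where *: "a = (f u, f v)" "u \<noteq> v" "e \<in> edges G" "ends G e = {u, v}"
    by (auto simp: adjacent_pairs_def)
  have "e \<in> g ` edges H" using *(3) bij_betw_imp_surj_on[OF g] by simp
  then obtain i where i: "i \<in> edges H" "g i = e" by blast
  have "ends H i = {f u, f v}" using ends[OF i(1)] i *(4) by simp
  moreover have "u \<in> verts G" "v \<in> verts G" using ends_subset[OF *(3)] *(4) by auto
  then have "f u \<noteq> f v" using inj_onD[OF bij_betw_imp_inj_on[OF f]] *(2) by blast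
  ultimately show "a \<in> adjacent_pairs H" using i(1) *(1) by (auto simp: adjacent_pairs_def)
qed

lemma gamma_eq: "gamma_l' H = gamma_l' G"
proof -
  have "gamma_term H (f u) (f v) = gamma_term G u v" if "(u, v) \<in> adjacent_pairs G" for u v
  proof -
    have "u \<in> verts G" "v \<in> verts G" using that ends_subset by (fastforce simp: adjacent_pairs_def)+
    then show ?thesis by (simp only: gamma_term_def degree_eq edge_mult_eq triple_eq)
  qed
  then have "(\<lambda>(u, v). gamma_term H u v) ` adjacent_pairs H = (\<lambda>(u, v). gamma_term G u v) ` adjacent_pairs G"
    unfolding adjacent_pairs_eq image_image by (intro image_cong) auto
  then show ?thesis by (simp only: gamma_l'_alt)
qed

lemma loops_attached_iso:
  assumes "loops_attached G"
  shows "loops_attached H"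
  unfolding loops_attached_def
proof (intro ballI allI impI)
  fix i v' assume i: "i \<in> edges H" "ends H i = {v'}"
  have gi: "g i \<in> edges G" using g i(1) by (auto dest: bij_betwE)
  have "f ` ends G (g i) = {v'}" using ends i by simp
  then obtain v where v: "v \<in> ends G (g i)" "v' = f v" by blast
  then have V: "v \<in> verts G" using ends_subset[OF gi] by auto
  then have "ends G (g i) = {v}" using ends_eq_iff[of i "{v}"] i v by simp
  then obtain e w where e: "e \<in> edges G" "w \<noteq> v" "ends G e = {v, w}"
    using assms gi unfolding loops_attached_def by blast
  then have "e \<in> g ` edges H" using bij_betw_imp_surj_on[OF g] by simp
  then obtain j where j: "j \<in> edges H" "g j = e" by blast
  have "w \<in> verts G" using ends_subset[OF e(1)] e by simp
  then have "f w \<noteq> v'" using inj_onD[OF bij_betw_imp_inj_on[OF f]] V v(2) e(2) by blast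
  moreover have "ends H j = {v', f w}" using ends j e v by simp
  ultimately show "\<exists>j\<in>edges H. \<exists>w. w \<noteq> v' \<and> ends H j = {v', w}" using j by blast
qed

lemma colouring_iso:
  assumes "edge_colouring_with H k c"
  shows "edge_colouring_with G k (c \<circ> the_inv_into (edges H) g)"
  unfolding edge_colouring_with_def proper_edge_colouring_def
proof (intro conjI ballI impI)
  let ?h = "the_inv_into (edges H) g"
  have h: "?h e \<in> edges H" "g (?h e) = e" if "e \<in> edges G" for e
    using that g the_inv_into_into[OF bij_betw_imp_inj_on[OF g], of e "edges H"]
      f_the_inv_into_f[OF bij_betw_imp_inj_on[OF g], of e] by (auto simp: bij_betw_def)
  fix e d assume ed: "e \<in> edges G" "d \<in> edges G" "e \<noteq> d \<and> ends G e \<inter> ends G d \<noteq> {}"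
  then have "?h e \<noteq> ?h d" "ends H (?h e) \<inter> ends H (?h d) \<noteq> {}" using h ends by (metis, auto)
  then show "(c \<circ> ?h) e \<noteq> (c \<circ> ?h) d"
    using assms h ed unfolding edge_colouring_with_def proper_edge_colouring_def by simp
next
  show "(c \<circ> the_inv_into (edges H) g) ` edges G \<subseteq> {..<k}"
    using assms g the_inv_into_into[OF bij_betw_imp_inj_on[OF g] _ order_refl]
    by (force simp: edge_colouring_with_def bij_betw_def)
qed

end

lemma multigraph_of_iso:
  fixes G :: "('v, 'e) multigraph"
  assumes "fin_multigraph G"
  obtains n es f g where "edge_list n es" "multigraph_iso G (multigraph_of n es) f g"
proof -
  have fin: "finite (verts G)" "finite (edges G)" using assms by (auto simp: fin_multigraph_def)
  obtain f where f: "bij_betw f (verts G) {..<card (verts G)}"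
    using ex_bij_betw_finite_nat[OF fin(1)] by (auto simp: atLeast0LessThan)
  obtain l where l: "set l = edges G" "distinct l" using finite_distinct_list[OF fin(2)] by blast
  have "\<forall>e\<in>edges G. \<exists>uv. fst uv \<in> verts G \<and> snd uv \<in> verts G \<and> ends G e = {fst uv, snd uv}"
    using assms unfolding fin_multigraph_def by fastforce
  then obtain uv where uv: "\<And>e. e \<in> edges G \<Longrightarrow> fst (uv e) \<in> verts G \<and> snd (uv e) \<in> verts G \<and> ends G e = {fst (uv e), snd (uv e)}"
    by (metis bchoice)
  let ?es = "map (\<lambda>e. (f (fst (uv e)), f (snd (uv e)))) l"
  have "f v < card (verts G)" if "v \<in> verts G" for v using bij_betwE[OF f] that by auto
  then have "edge_list (card (verts G)) ?es" using uv l by (auto simp: edge_list_def)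
  moreover have "multigraph_iso G (multigraph_of (card (verts G)) ?es) f ((!) l)"
  proof
    show "bij_betw ((!) l) (edges (multigraph_of (card (verts G)) ?es)) (edges G)"
      using bij_betw_nth[OF l(2) refl l(1)[symmetric]] by (simp add: multigraph_of_def)
    fix i assume "i \<in> edges (multigraph_of (card (verts G)) ?es)"
    then have "i < length l" by (simp add: multigraph_of_def)
    then show "ends (multigraph_of (card (verts G)) ?es) i = f ` ends G (l ! i)"
      using uv[of "l ! i"] l(1) nth_mem[of i l] by (simp add: multigraph_of_def)
  qed (use assms f in \<open>simp_all add: multigraph_of_def\<close>)
  ultimately show thesis by (rule that)
qed

section \<open>The bound and the running time\<close>

text \<open>The bound is a consequence of the program's correctness: the colouring computed for an
  isomorphic edge list is carried back.\<close>

lemma chromatic_index_le: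
  fixes G :: "('v, 'e) multigraph"
  assumes "fin_multigraph G" "loops_attached G"
  shows "chromatic_index G \<le> gamma_l' G"
proof -
  obtain n es f g where "edge_list n es" and iso: "multigraph_iso G (multigraph_of n es) f g"
    using multigraph_of_iso[OF assms(1)] .
  then interpret input_graph n es
    using multigraph_iso.loops_attached_iso[OF iso assms(2)] by unfold_locales
  show ?thesis
    using multigraph_iso.colouring_iso[OF iso colouring] multigraph_iso.gamma_eq[OF iso]
    unfolding chromatic_index_def by (intro Least_le) auto
qed

theorem theorem5:
  "(\<forall>G :: ('v, 'e) multigraph.
      fin_multigraph G \<and> loops_attached G \<longrightarrow> chromatic_index G \<le> gamma_l' G) \<and>
   (\<exists>(P :: program) (T :: nat \<Rightarrow> nat).
      (\<lambda>m. real (T m)) \<in> O(\<lambda>m. real m ^ 2) \<and>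
      (\<forall>n es. edge_list n es \<and> loops_attached (multigraph_of n es) \<longrightarrow>
         (\<exists>t s. runs P (input n es) t s \<and> t \<le> T (length es) \<and>
            edge_colouring_with (multigraph_of n es) (gamma_l' (multigraph_of n es)) (s ''colour''))))"
proof (intro conjI allI impI)
  fix G :: "('v, 'e) multigraph"
  assume "fin_multigraph G \<and> loops_attached G"
  then show "chromatic_index G \<le> gamma_l' G" using chromatic_index_le by blast
next
  let ?T = "\<lambda>m. cost colour_edges * (m + 1)\<^sup>2"
  show "\<exists>(P :: program) (T :: nat \<Rightarrow> nat).
      (\<lambda>m. real (T m)) \<in> O(\<lambda>m. real m ^ 2) \<and>
      (\<forall>n es. edge_list n es \<and> loops_attached (multigraph_of n es) \<longrightarrow>
         (\<exists>t s. runs P (input n es) t s \<and> t \<le> T (length es) \<and>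
            edge_colouring_with (multigraph_of n es) (gamma_l' (multigraph_of n es)) (s ''colour'')))"
  proof (intro exI[of _ "prog colour_edges"] exI[of _ ?T] conjI allI impI)
    show "(\<lambda>m. real (?T m)) \<in> O(\<lambda>m. real m ^ 2)"
    \<comment> \<open>The 4 comes from \<open>m + 1 \<le> 2 * m\<close> for positive
      \<open>m\<close>.\<close>
    proof (rule bigoI[where c = "4 * real (cost colour_edges)"], rule eventually_at_top_linorderI[of 1])
      fix m :: nat assume "1 \<le> m"
      then have "(real m + 1)\<^sup>2 \<le> (2 * real m)\<^sup>2" by (intro power_mono) auto
      then have "real (cost colour_edges) * (real m + 1)\<^sup>2 \<le> real (cost colour_edges) * (4 * (real m)\<^sup>2)"
        by (intro mult_left_mono) (auto simp: power_mult_distrib)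
      then show "norm (real (?T m)) \<le> 4 * real (cost colour_edges) * norm (real m ^ 2)"
        by (simp add: algebra_simps)
    qed
    fix n and es :: "(nat \<times> nat) list"
    assume "edge_list n es \<and> loops_attached (multigraph_of n es)"
    then interpret input_graph n es by unfold_locales auto
    show "\<exists>t s. runs (prog colour_edges) (input n es) t s \<and> t \<le> ?T (length es) \<and>
        edge_colouring_with (multigraph_of n es) (gamma_l' (multigraph_of n es)) (s ''colour'')"
      using colouring_runs colouring by blast
  qed
qed

end
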